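(* Let $\Bbbk$ be a field and let $I\subseteq S=\Bbbk[x,y,z]$ be a strongly stable ideal such that $\dim_\Bbbk(S/I)=d<\infty$. Then $\dim_{\Bbbk} T(I) = 3d+6$ if and only if $I = J(a,b,c) = (x^2,xy,y^2,xz^a,yz^b,z^{c+1})$ for some integers $1\le a\leq b \leq c$ with either $a = 1$ or $b=c$.
   Context: $T(I)=\mathrm{Hom}_S(I,S/I)$ is the tangent space to $\mathrm{Hilb}^d(\mathbb{A}^3)$ at $[S/I]$. A monomial ideal $I\subseteq\Bbbk[x_1,\dots,x_n]$ is strongly stable if for every minimal monomial generator $m\in I$ and every $x_j$ dividing $m$ one has $\frac{x_i}{x_j}m\in I$ for all $i<j$; here $(x_1,x_2,x_3)=(x,y,z)$. *)

theory Defs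
  imports "HOL-Library.Poly_Mapping" "HOL-Library.Numeral_Type" "HOL-Algebra.QuotRing" "Jordan_Normal_Form.VS_Connect"
begin

section \<open>Modules over a ring\<close>

text \<open>In the module records below the fields \<open>mult\<close> and \<open>one\<close> carry no information; they are
  only there because the record type \<open>module\<close> extends \<open>ring\<close>.\<close>

definition ring_module :: "('a, 'm) ring_scheme \<Rightarrow> ('a, 'a) module" where
  "ring_module R =
     \<lparr>carrier = carrier R, mult = mult R, one = one R, zero = zero R, add = add R, smult = mult R\<rparr>"

definition ideal_module :: "('a, 'm) ring_scheme \<Rightarrow> 'a set \<Rightarrow> ('a, 'a) module" where
  "ideal_module R I = ring_module R\<lparr>carrier := I\<rparr>"

definition quot_module :: "('a, 'm) ring_scheme \<Rightarrow> 'a set \<Rightarrow> ('a, 'a set) module" where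
  "quot_module R I =
     \<lparr>carrier = carrier (R Quot I), mult = mult (R Quot I), one = one (R Quot I),
      zero = zero (R Quot I), add = add (R Quot I),
      smult = (\<lambda>r X. (I +>\<^bsub>R\<^esub> r) \<otimes>\<^bsub>R Quot I\<^esub> X)\<rparr>"

text \<open>The set \<open>module_hom R M N\<close> does not constrain functions outside \<open>carrier M\<close>; intersecting with
  \<open>extensional (carrier M)\<close> makes every homomorphism occur exactly once.\<close>

definition hom_module ::
    "('r, 'm) ring_scheme \<Rightarrow> ('r, 'a, 'c) module_scheme \<Rightarrow> ('r, 'b, 'e) module_scheme
      \<Rightarrow> ('r, 'a \<Rightarrow> 'b) module" where
  "hom_module R M N =
     \<lparr>carrier = LinearCombinations.module_hom R M N \<inter> extensional (carrier M),
      mult = (\<lambda>f g. \<lambda>x\<in>carrier M. \<zero>\<^bsub>N\<^esub>),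
      one = (\<lambda>x\<in>carrier M. \<zero>\<^bsub>N\<^esub>),
      zero = (\<lambda>x\<in>carrier M. \<zero>\<^bsub>N\<^esub>),
      add = (\<lambda>f g. \<lambda>x\<in>carrier M. f x \<oplus>\<^bsub>N\<^esub> g x),
      smult = (\<lambda>r f. \<lambda>x\<in>carrier M. r \<odot>\<^bsub>N\<^esub> f x)\<rparr>"

definition restrict_scalars :: "('k \<Rightarrow> 'r) \<Rightarrow> ('r, 'a) module \<Rightarrow> ('k, 'a) module" where
  "restrict_scalars h M =
     \<lparr>carrier = carrier M, mult = mult M, one = one M, zero = zero M, add = add M,
      smult = (\<lambda>c x. h c \<odot>\<^bsub>M\<^esub> x)\<rparr>"

text \<open>\<open>vectorspace.dim\<close> is an unspecified number when the space is not finite-dimensional.\<close>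

definition has_dim :: "('k, 'm) ring_scheme \<Rightarrow> ('k, 'v, 'c) module_scheme \<Rightarrow> nat \<Rightarrow> bool" where
  "has_dim K V n \<longleftrightarrow> vectorspace.fin_dim K V \<and> vectorspace.dim K V = n"


section \<open>Polynomial rings and monomial ideals\<close>

text \<open>A polynomial maps exponent vectors \<open>'n \<Rightarrow>\<^sub>0 nat\<close> to coefficients; the variables are
  indexed and ordered by \<open>'n\<close>.\<close>

type_synonym ('n, 'k) mpoly = "('n \<Rightarrow>\<^sub>0 nat) \<Rightarrow>\<^sub>0 'k"

abbreviation poly_ring :: "('n, 'k::comm_ring_1) mpoly ring" where
  "poly_ring \<equiv> class_ring"

definition const :: "'k::comm_ring_1 \<Rightarrow> ('n, 'k) mpoly" where
  "const c = Poly_Mapping.single 0 c"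

definition mon :: "('n \<Rightarrow>\<^sub>0 nat) \<Rightarrow> ('n, 'k::comm_ring_1) mpoly" where
  "mon m = Poly_Mapping.single m 1"

definition var :: "'n \<Rightarrow> ('n, 'k::comm_ring_1) mpoly" where
  "var i = mon (Poly_Mapping.single i 1)"

definition monomial_ideal :: "('n, 'k::comm_ring_1) mpoly set \<Rightarrow> bool" where
  "monomial_ideal I \<longleftrightarrow> (\<exists>M. I = genideal poly_ring (mon ` M))"

definition min_mon_gens :: "('n, 'k::comm_ring_1) mpoly set \<Rightarrow> ('n \<Rightarrow>\<^sub>0 nat) set" where
  "min_mon_gens I =
     {m. mon m \<in> I \<and> (\<forall>m'. mon m' \<in> I \<and> (mon m' :: ('n, 'k) mpoly) dvd mon m \<longrightarrow> m' = m)}"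

text \<open>Subtraction of exponent vectors truncates at \<open>0\<close>, but \<open>x\<^sub>j\<close> divides \<open>m\<close> here.\<close>

definition strongly_stable :: "('n::linorder, 'k::comm_ring_1) mpoly set \<Rightarrow> bool" where
  "strongly_stable I \<longleftrightarrow> monomial_ideal I \<and>
     (\<forall>m\<in>min_mon_gens I. \<forall>j. (var j :: ('n, 'k) mpoly) dvd mon m \<longrightarrow>
        (\<forall>i<j. mon (m - Poly_Mapping.single j 1 + Poly_Mapping.single i 1) \<in> I))"

definition coord_space :: "('n, 'k::field) mpoly set \<Rightarrow> ('k, ('n, 'k) mpoly set) module" where
  "coord_space I = restrict_scalars const (quot_module poly_ring I)"

definition tangent_space ::
    "('n, 'k::field) mpoly set \<Rightarrow> ('k, ('n, 'k) mpoly \<Rightarrow> ('n, 'k) mpoly set) module" where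
  "tangent_space I =
     restrict_scalars const
       (hom_module poly_ring (ideal_module poly_ring I) (quot_module poly_ring I))"

text \<open>Three variables are indexed by the type \<open>3\<close>, whose elements are ordered \<open>0 < 1 < 2\<close>;
  so \<open>x, y, z\<close> are the variables number \<open>0, 1, 2\<close>.\<close>

definition J :: "nat \<Rightarrow> nat \<Rightarrow> nat \<Rightarrow> (3, 'k::field) mpoly set" where
  "J a b c = (let x = var 0; y = var 1; z = var 2 in
     genideal poly_ring {x^2, x * y, y^2, x * z^a, y * z^b, z^(c + 1)})"


section \<open>The vector space structures\<close>

lemma const_add: "const (a + b) = const a + const b"
  by (simp add: const_def single_add)

lemma const_mult: "const (a * b) = const a * const b"
  by (simp add: const_def mult_single)

lemma const_one: "const 1 = 1"
  by (simp add: const_def)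

lemma module_ideal_module:
  assumes "cring R" "ideal I R"
  shows "Module.module R (ideal_module R I)"
proof -
  interpret cring R by fact
  interpret I: ideal I R by fact
  show ?thesis
  proof (rule Module.moduleI)
    show "abelian_group (ideal_module R I)"
    proof (rule abelian_groupI)
      fix x assume "x \<in> carrier (ideal_module R I)"
      then show "\<exists>y\<in>carrier (ideal_module R I). y \<oplus>\<^bsub>ideal_module R I\<^esub> x = \<zero>\<^bsub>ideal_module R I\<^esub>"
        by (intro bexI[of _ "\<ominus>\<^bsub>R\<^esub> x"]) (auto simp: ideal_module_def ring_module_def l_neg)
    qed (auto simp: ideal_module_def ring_module_def a_ac)
  qed (use assms in \<open>auto simp: ideal_module_def ring_module_def l_distr r_distr m_assoc I.I_l_closed\<close>)
qed

lemma module_quot_module: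
  assumes "cring R" "ideal I R"
  shows "Module.module R (quot_module R I)"
proof -
  interpret cring R by fact
  interpret I: ideal I R by fact
  interpret Q: cring "R Quot I" by (rule I.quotient_is_cring) fact
  interpret h: ring_hom_ring R "R Quot I" "a_r_coset R I" by (rule I.rcos_ring_hom_ring)
  show ?thesis
  proof (rule Module.moduleI)
    show "abelian_group (quot_module R I)"
    proof (rule abelian_groupI)
      fix x assume "x \<in> carrier (quot_module R I)"
      then show "\<exists>y\<in>carrier (quot_module R I). y \<oplus>\<^bsub>quot_module R I\<^esub> x = \<zero>\<^bsub>quot_module R I\<^esub>"
        by (intro bexI[of _ "\<ominus>\<^bsub>R Quot I\<^esub> x"]) (simp_all add: quot_module_def Q.l_neg)
    qed (simp_all add: quot_module_def Q.a_ac)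
  qed (use assms in \<open>simp_all add: quot_module_def Q.l_distr Q.r_distr Q.m_assoc\<close>)
qed

lemma module_hom_module:
  assumes "Module.module R M" "Module.module R N"
  shows "Module.module R (hom_module R M N)"
proof -
  interpret M: Module.module R M by fact
  interpret N: Module.module R N by fact
  show ?thesis
  proof (rule Module.moduleI)
    show "abelian_group (hom_module R M N)"
    proof (rule abelian_groupI)
      fix f assume f: "f \<in> carrier (hom_module R M N)"
      show "\<exists>g\<in>carrier (hom_module R M N). g \<oplus>\<^bsub>hom_module R M N\<^esub> f = \<zero>\<^bsub>hom_module R M N\<^esub>"
        using f
        by (intro bexI[of _ "\<lambda>x\<in>carrier M. \<ominus>\<^bsub>N\<^esub> f x"])
          (auto simp: hom_module_def LinearCombinations.module_hom_def Pi_iff N.l_neg N.minus_add N.smult_r_minus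
            intro!: ext)
    qed (auto simp: hom_module_def LinearCombinations.module_hom_def Pi_iff extensional_def N.a_ac N.smult_r_distr
          intro!: ext)
  qed (use M.R.is_cring in \<open>auto simp: hom_module_def LinearCombinations.module_hom_def Pi_iff extensional_def
        N.smult_l_distr N.smult_r_distr N.smult_assoc1[symmetric] M.R.m_comm N.a_ac intro!: ext\<close>)
qed

lemma vectorspace_restrict_scalars:
  fixes M :: "(('n, 'k::field) mpoly, 'a) module"
  assumes "Module.module poly_ring M"
  shows "vectorspace class_ring (restrict_scalars const M)"
proof -
  interpret M: Module.module poly_ring M by fact
  have "Module.module (class_ring :: 'k ring) (restrict_scalars const M)"
  proof (rule Module.moduleI)
    show "abelian_group (restrict_scalars const M)"
    proof (rule abelian_groupI)
      fix x assume "x \<in> carrier (restrict_scalars const M)"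
      then show "\<exists>y\<in>carrier (restrict_scalars const M).
          y \<oplus>\<^bsub>restrict_scalars const M\<^esub> x = \<zero>\<^bsub>restrict_scalars const M\<^esub>"
        by (intro bexI[of _ "\<ominus>\<^bsub>M\<^esub> x"]) (simp_all add: restrict_scalars_def M.l_neg)
    qed (simp_all add: restrict_scalars_def M.a_ac)
  qed (use M.smult_l_distr M.smult_r_distr M.smult_assoc1 M.smult_one M.smult_closed
      in \<open>auto simp: restrict_scalars_def const_add const_mult const_one class_cring.cring_axioms\<close>)
  then show ?thesis
    by (simp add: vectorspace_def class_field.field_axioms)
qed

lemma vectorspace_coord_space:
  assumes "ideal I poly_ring"
  shows "vectorspace class_ring (coord_space I)"
  unfolding coord_space_def
  by (intro vectorspace_restrict_scalars module_quot_module class_cring.cring_axioms assms)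

lemma vectorspace_tangent_space:
  assumes "ideal I poly_ring"
  shows "vectorspace class_ring (tangent_space I)"
  unfolding tangent_space_def
  by (intro vectorspace_restrict_scalars module_hom_module module_quot_module module_ideal_module
      class_cring.cring_axioms assms)

end

theory Submission
  imports Defs
begin

text \<open>Let \<open>B\<close> be the set of standard monomials of a monomial ideal \<open>I\<close>. A homomorphism \<open>I \<rightarrow> S/I\<close> is a
  function on the pairs \<open>(m, b)\<close> with \<open>m \<in> I\<close> and \<open>b \<in> B\<close> that does not change when \<open>m\<close> and \<open>b\<close> are
  multiplied by the same variable, and vanishes where the corresponding step is obstructed. Its level
  sets belong to a finite ring of closed sets of pairs, whose atoms index a basis of \<open>T(I)\<close>; so
  \<open>dim T(I) = n\<close> iff there are \<open>2^n\<close> closed sets.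

  The closed sets split according to the signs of \<open>b - m\<close>. The signs \<open>+++\<close> and \<open>---\<close> do not occur, and
  there are \<open>2^d\<close> times as many closed sets of sign \<open>++-\<close> as of sign \<open>--+\<close>. Indeed, restricting to bottoms
  of columns turns the two families into the kernels of two transposed incidence matrices over the field
  with two elements, because in the quadrant the cycles are exactly the boundaries of sets of squares; the
  exponent \<open>d\<close> is an Euler characteristic. Permuting the variables, the number of closed sets
  is \<open>2^(3 d) N^2\<close>, where \<open>N\<close> counts the closed sets with signs \<open>--+\<close>, \<open>-+-\<close> and \<open>+--\<close>, and
  \<open>dim T(I) = 3 d + 6\<close> iff \<open>N = 8\<close>.

  For strongly stable \<open>I\<close> one has \<open>N = 1\<close> if \<open>x \<in> I\<close>. Otherwise each of the three sign patterns admits a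
  nonempty closed set, so that \<open>N \<ge> 8\<close>. Explicit chains of pairs give a further closed set
  unless \<open>I = J(a, b, c)\<close> with \<open>a = 1\<close> or \<open>b = c\<close>; in the latter case there is no other, since a closed
  set is determined by the pairs in which \<open>m\<close> is a minimal generator.\<close>

section \<open>Planar duality modulo two\<close>

text \<open>The equations between the coefficients of a homomorphism only identify two coefficients
  or set one to zero. Their solutions therefore have the same combinatorics over every field, and
  counting 0-1 solutions is enough; the field with two elements is a counting device. The obstacle
  is that the numbers of closed sets of sign \<open>++-\<close> and \<open>--+\<close> are not known
  separately, only their ratio. The kernels of a matrix and of its transpose have such a known
  ratio, whatever the rank, which is why one family is realised on vertices and the other on cycles
  of the same complex. To keep everything finite, all chains live in one finite set
  \<open>cells\<close>, and the members outside the complex contribute powers of two that cancel in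
  the end. The constant 6 is twice 3: one dimension for each pattern with two minus signs, and one
  in the opposite pattern beyond the \<open>d\<close> that it has anyway.\<close>

lemma sum_Pow_prod_signs:
  assumes "finite E"
  shows "(\<Sum>G\<in>Pow E. \<Prod>e\<in>G. (-1::int) ^ c e) = (if \<forall>e\<in>E. even (c e) then 2 ^ card E else 0)"
proof -
  have "(\<Sum>G\<in>Pow E. \<Prod>e\<in>G. (-1::int) ^ c e) = (\<Prod>e\<in>E. (-1) ^ c e + 1)"
    using prod_add[OF assms, of "\<lambda>e. (-1::int) ^ c e" "\<lambda>_. 1"] by simp
  also have "\<dots> = (if \<forall>e\<in>E. even (c e) then 2 ^ card E else 0)"
    using assms by (induction E rule: finite_induct) auto
  finally show ?thesis .
qed

text \<open>Row rank equals column rank modulo two, in counting form. Sum the sign of the number of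
  related pairs in \<open>F \<times> G\<close> over all \<open>F\<close> and \<open>G\<close>: the
  sum over \<open>G\<close> vanishes unless \<open>F\<close> meets every condition evenly, and the
  sum over \<open>F\<close> likewise. The two orders of summation give the two sides.\<close>

lemma even_subsets_duality:
  fixes R :: "'a \<Rightarrow> 'b \<Rightarrow> bool"
  assumes A: "finite A" and E: "finite E"
  shows "card {F. F \<subseteq> A \<and> (\<forall>e\<in>E. even (card {a\<in>F. R a e}))} * 2 ^ card E =
    card {G. G \<subseteq> E \<and> (\<forall>a\<in>A. even (card {e\<in>G. R a e}))} * 2 ^ card A"
proof -
  have swap: "(\<Prod>e\<in>G. (-1::int) ^ card {a\<in>F. R a e}) = (\<Prod>a\<in>F. (-1) ^ card {e\<in>G. R a e})"
    if "F \<subseteq> A" "G \<subseteq> E" for F G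
  proof -
    have fin: "finite F" "finite G"
      using that A E finite_subset by auto
    have "(\<Sum>e\<in>G. card {a\<in>F. R a e}) = (\<Sum>a\<in>F. card {e\<in>G. R a e})"
      using sum.swap_restrict[OF fin(2,1), of "\<lambda>_ _. 1::nat" "\<lambda>e a. R a e"] by simp
    then show ?thesis
      by (simp add: power_sum[symmetric])
  qed
  have count: "(\<Sum>F\<in>Pow X. if P F then 2 ^ n else 0) = (of_nat (card {F. F \<subseteq> X \<and> P F} * 2 ^ n) :: int)"
    if "finite X" for X :: "'z set" and P n
    using that by (simp add: sum.If_cases Pow_def Collect_conj_eq Int_commute)
  have "(\<Sum>F\<in>Pow A. \<Sum>G\<in>Pow E. \<Prod>e\<in>G. (-1::int) ^ card {a\<in>F. R a e}) =
      (\<Sum>G\<in>Pow E. \<Sum>F\<in>Pow A. \<Prod>a\<in>F. (-1) ^ card {e\<in>G. R a e})"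
    by (subst sum.swap) (auto intro!: sum.cong swap)
  then have "int (card {F. F \<subseteq> A \<and> (\<forall>e\<in>E. even (card {a\<in>F. R a e}))} * 2 ^ card E) =
      int (card {G. G \<subseteq> E \<and> (\<forall>a\<in>A. even (card {e\<in>G. R a e}))} * 2 ^ card A)"
    unfolding sum_Pow_prod_signs[OF A] sum_Pow_prod_signs[OF E] count[OF A] count[OF E] .
  then show ?thesis
    by (simp only: of_nat_eq_iff)
qed

text \<open>Membership outside \<open>V\<close> is a free choice. This splits off those members of
  the ambient set \<open>cells\<close> that the parity conditions do not see.\<close>

lemma card_split_at:
  assumes fin: "finite A" and V: "V \<subseteq> A"
    and P: "\<And>F. F \<subseteq> A \<Longrightarrow> P F \<longleftrightarrow> P (F \<inter> V)"
  shows "card {F. F \<subseteq> A \<and> P F} = card {F. F \<subseteq> V \<and> P F} * 2 ^ (card A - card V)"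
proof -
  have "bij_betw (\<lambda>F. (F \<inter> V, F - V)) {F. F \<subseteq> A \<and> P F} ({F. F \<subseteq> V \<and> P F} \<times> Pow (A - V))"
  proof (rule bij_betw_byWitness[where f' = "\<lambda>(Y, W). Y \<union> W"])
    show "(\<lambda>F. (F \<inter> V, F - V)) ` {F. F \<subseteq> A \<and> P F} \<subseteq> {F. F \<subseteq> V \<and> P F} \<times> Pow (A - V)"
      using P by auto
    have "P (Y \<union> W)" if "Y \<subseteq> V" "P Y" "W \<subseteq> A - V" for Y W
    proof -
      have "(Y \<union> W) \<inter> V = Y" using that by auto
      then show ?thesis using P[of "Y \<union> W"] that V by auto
    qed
    then show "(\<lambda>(Y, W). Y \<union> W) ` ({F. F \<subseteq> V \<and> P F} \<times> Pow (A - V)) \<subseteq> {F. F \<subseteq> A \<and> P F}"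
      using V by auto
  qed auto
  then have "card {F. F \<subseteq> A \<and> P F} = card ({F. F \<subseteq> V \<and> P F} \<times> Pow (A - V))"
    by (rule bij_betw_same_card)
  also have "\<dots> = card {F. F \<subseteq> V \<and> P F} * 2 ^ card (A - V)"
    using fin by (simp add: card_cartesian_product card_Pow)
  also have "card (A - V) = card A - card V"
    using fin V by (simp add: card_Diff_subset finite_subset)
  finally show ?thesis .
qed

section \<open>Cell complexes over a plane staircase\<close>

type_synonym cell = "nat \<times> nat \<times> nat \<times> nat \<times> nat"

locale staircase =
  fixes h :: "nat \<Rightarrow> nat \<Rightarrow> nat"
  assumes mono: "i \<le> i' \<Longrightarrow> j \<le> j' \<Longrightarrow> h i' j' \<le> h i j"
    and fin: "finite {(i, j). 0 < h i j}"
begin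

text \<open>The function \<open>h\<close> gives the heights of the columns of an ideal in three variables: \<open>(i, j, k)\<close> lies
  in the ideal iff \<open>h i j \<le> k\<close>. The cell \<open>(i, j, a, b, n)\<close> stands for the bottom of the column over
  \<open>(i, j)\<close>, looked at in degree \<open>(a, b, - n)\<close>. In each degree the vertices, edges and squares form a cell
  complex relative to the part where \<open>h i j < n\<close>; an edge is given by its lower left end and its
  direction (\<open>True\<close> for the first coordinate), a square by its lower left corner.\<close>

definition cells :: "cell set" where
  "cells = {(i, j, a, b, n). 0 < n \<and> n \<le> h i j \<and> 0 < h a b}"

text \<open>The last inequality says that \<open>(i + a, j + b, h i j - n)\<close> is a standard
  monomial, hence a possible target of the column bottom \<open>(i, j, h i j)\<close>. It forces
  \<open>h a b\<close> to be positive, so only finitely many degrees occur.\<close>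

definition verts :: "cell set" where
  "verts = {(i, j, a, b, n). 0 < n \<and> n \<le> h i j \<and> h i j < h (i + a) (j + b) + n}"

definition squares :: "cell set" where
  "squares = {(i, j, a, b, n). 0 < n \<and> n \<le> h i j \<and> h i j < h (Suc (i + a)) (Suc (j + b)) + n}"

definition edges :: "(cell \<times> bool) set" where
  "edges = {((i, j, a, b, n), d). 0 < n \<and> n \<le> h i j \<and>
     h i j < (if d then h (Suc (i + a)) (j + b) else h (i + a) (Suc (j + b))) + n}"

fun endpoint :: "cell \<Rightarrow> cell \<times> bool \<Rightarrow> bool" where
  "endpoint v ((i, j, r), d) \<longleftrightarrow> v = (i, j, r) \<or> v = (if d then (Suc i, j, r) else (i, Suc j, r))"

text \<open>If the far end of an edge is not in \<open>verts\<close>, the condition forces the near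
  end out of \<open>F\<close>. This is the obstructed case: the source can be divided by a higher
  power of the third variable than the target.\<close>

definition cocycles :: "cell set set" where
  "cocycles = {F. F \<subseteq> verts \<and> (\<forall>((i, j, r), d)\<in>edges.
     (i, j, r) \<in> F \<longleftrightarrow> (if d then (Suc i, j, r) else (i, Suc j, r)) \<in> F)}"

text \<open>The boundary modulo two of a set of squares, relative to the edges based outside
  \<open>cells\<close>.\<close>

definition boundary :: "cell set \<Rightarrow> (cell \<times> bool) set" where
  "boundary c = {((i, j, r), d). (i, j, r) \<in> cells \<and>
     ((i, j, r) \<in> c \<longleftrightarrow> \<not> (if d then 0 < j \<and> (i, j - 1, r) \<in> c else 0 < i \<and> (i - 1, j, r) \<in> c))}"

text \<open>These represent the cycles in \<open>edges\<close> up to boundaries of subsets of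
  \<open>squares\<close>, which can be added and removed freely.\<close>

definition cochains :: "cell set set" where
  "cochains = {c. c \<subseteq> cells - squares \<and> boundary c \<subseteq> edges}"


lemma finite_cells [simp]: "finite cells"
proof (rule finite_subset)
  show "cells \<subseteq> (\<lambda>((i, j), (a, b), n). (i, j, a, b, n)) `
      ({(i, j). 0 < h i j} \<times> {(i, j). 0 < h i j} \<times> {..h 0 0})"
  proof
    fix v assume v: "v \<in> cells"
    obtain i j a b n where "v = (i, j, a, b, n)" by (cases v)
    with v mono[of 0 i 0 j] show "v \<in> (\<lambda>((i, j), (a, b), n). (i, j, a, b, n)) `
      ({(i, j). 0 < h i j} \<times> {(i, j). 0 < h i j} \<times> {..h 0 0})"
      by (intro image_eqI[of _ _ "((i, j), (a, b), n)"]) (auto simp: cells_def)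
  qed
qed (use fin in auto)

lemma verts_subset: "verts \<subseteq> cells"
proof clarify
  fix i j a b n assume "(i, j, a, b, n) \<in> verts"
  with mono[of a "i + a" b "j + b"] show "(i, j, a, b, n) \<in> cells"
    by (simp add: verts_def cells_def)
qed

lemma squares_subset: "squares \<subseteq> cells"
proof clarify
  fix i j a b n assume "(i, j, a, b, n) \<in> squares"
  with mono[of a "Suc (i + a)" b "Suc (j + b)"] show "(i, j, a, b, n) \<in> cells"
    by (simp add: squares_def cells_def)
qed

lemma edges_subset: "edges \<subseteq> cells \<times> UNIV"
proof
  fix e assume e: "e \<in> edges"
  obtain i j a b n d where eq: "e = ((i, j, a, b, n), d)" by (metis prod.exhaust)
  from e eq
    mono[of a "Suc (i + a)" b "j + b"] mono[of a "i + a" b "Suc (j + b)"]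
  show "e \<in> cells \<times> UNIV"
    by (simp add: edges_def cells_def split: if_splits)
qed

lemma finite_edges [simp]: "finite edges"
  by (rule finite_subset[OF edges_subset]) simp

lemma cells_pred:
  assumes "(i, j, r) \<in> cells" "i' \<le> i" "j' \<le> j"
  shows "(i', j', r) \<in> cells"
  using assms mono[of i' i j' j] by (cases r) (auto simp: cells_def)

text \<open>The kernel of the incidence matrix of vertices and edges: an even number of endpoints
  means both or neither. Cells outside \<open>verts\<close> are not an endpoint of any member of
  \<open>edges\<close>, which yields the power of two.\<close>

lemma card_cocycles:
  "card {F. F \<subseteq> cells \<and> (\<forall>e\<in>edges. even (card {v\<in>F. endpoint v e}))} =
    card cocycles * 2 ^ (card cells - card verts)"
proof -
  have even_iff: "even (card {v\<in>F. endpoint v ((i, j, r), d)}) \<longleftrightarrow>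
      ((i, j, r) \<in> F \<longleftrightarrow> (if d then (Suc i, j, r) else (i, Suc j, r)) \<in> F)" for F i j r d
  proof -
    have "{v\<in>F. endpoint v ((i, j, r), d)} =
        F \<inter> {(i, j, r), if d then (Suc i, j, r) else (i, Suc j, r)}"
      by auto
    then show ?thesis by (cases d) (simp_all add: Int_insert_right)
  qed
  have restrict: "(\<forall>e\<in>edges. even (card {v\<in>F. endpoint v e})) \<longleftrightarrow>
      (\<forall>e\<in>edges. even (card {v\<in>F \<inter> verts. endpoint v e}))" if F: "F \<subseteq> cells" for F
  proof (rule ball_cong[OF refl])
    fix e assume e: "e \<in> edges"
    obtain i j a b n d where eq: "e = ((i, j, a, b, n), d)" by (cases e) auto
    let ?w = "if d then (Suc i, j, a, b, n) else (i, Suc j, a, b, n)"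
    have "(i, j, a, b, n) \<in> verts"
      using e eq mono[of "i + a" "Suc (i + a)" "j + b" "j + b"] mono[of "i + a" "i + a" "j + b" "Suc (j + b)"]
      by (simp add: edges_def verts_def split: if_splits)
    \<comment> \<open>A far end that is a cell has \<open>n\<close> at most its height, and heights
      decrease along the edge, so it is a vertex. Any other far end is missing from
      \<open>F\<close>, which consists of cells.\<close>
    moreover have "?w \<in> F \<longleftrightarrow> ?w \<in> F \<inter> verts"
      using e eq F mono[of i "Suc i" j j] mono[of i i j "Suc j"]
      by (auto simp: edges_def verts_def cells_def split: if_splits dest!: subsetD)
    ultimately show "even (card {v\<in>F. endpoint v e}) \<longleftrightarrow> even (card {v\<in>F \<inter> verts. endpoint v e})"
      unfolding eq even_iff by (cases d) auto
  qed
  have "cocycles = {F. F \<subseteq> verts \<and> (\<forall>e\<in>edges. even (card {v\<in>F. endpoint v e}))}"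
    unfolding cocycles_def using even_iff by fastforce
  with card_split_at[of cells verts "\<lambda>F. \<forall>e\<in>edges. even (card {v\<in>F. endpoint v e})",
      OF finite_cells verts_subset restrict]
  show ?thesis by simp
qed


lemma even_card_at_vertex:
  "even (card {e\<in>G. endpoint (i, j, r) e}) \<longleftrightarrow>
    ((((i, j, r), True) \<in> G \<longleftrightarrow> ((i, j, r), False) \<in> G) \<longleftrightarrow>
     (0 < i \<and> ((i - 1, j, r), True) \<in> G \<longleftrightarrow> 0 < j \<and> ((i, j - 1, r), False) \<in> G))"
proof -
  have "{e\<in>G. endpoint (i, j, r) e} = G \<inter> ({((i, j, r), True), ((i, j, r), False)} \<union>
      (if 0 < i then {((i - 1, j, r), True)} else {}) \<union> (if 0 < j then {((i, j - 1, r), False)} else {}))"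
    (is "?L = ?R")
  proof (rule Set.set_eqI)
    fix e :: "cell \<times> bool"
    obtain i' j' r' d where "e = ((i', j', r'), d)" by (metis prod.exhaust)
    then show "e \<in> ?L \<longleftrightarrow> e \<in> ?R" by (cases d) auto
  qed
  then show ?thesis
    by (cases i; cases j) (simp_all add: Int_insert_right Un_insert_right)
qed

lemma boundary_iff:
  assumes "(i, j, r) \<in> cells"
  shows "((i, j, r), True) \<in> boundary c \<longleftrightarrow> \<not> ((i, j, r) \<in> c \<longleftrightarrow> 0 < j \<and> (i, j - 1, r) \<in> c)"
    and "((i, j, r), False) \<in> boundary c \<longleftrightarrow> \<not> ((i, j, r) \<in> c \<longleftrightarrow> 0 < i \<and> (i - 1, j, r) \<in> c)"
  using assms by (auto simp: boundary_def)

lemma boundary_subset: "boundary c \<subseteq> cells \<times> UNIV"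
  by (auto simp: boundary_def)

text \<open>No nonempty set of squares in the quadrant has zero boundary: along a row, starting at
  \<open>i = 0\<close> where there is no left neighbour, each square is determined by its left edge
  and the preceding square.\<close>

lemma inj_on_boundary: "inj_on boundary (Pow cells)"
proof (rule inj_onI)
  fix c c' assume sub: "c \<in> Pow cells" "c' \<in> Pow cells" and eq: "boundary c = boundary c'"
  have "(i, j, r) \<in> c \<longleftrightarrow> (i, j, r) \<in> c'" if "(i, j, r) \<in> cells" for i j r
    using that
  proof (induction i)
    case 0
    then show ?case using boundary_iff(2)[OF 0, of c] boundary_iff(2)[OF 0, of c'] eq by simp
  next
    case (Suc i)
    have "(i, j, r) \<in> cells" using Suc.prems by (rule cells_pred) auto
    with Suc boundary_iff(2)[OF Suc.prems, of c] boundary_iff(2)[OF Suc.prems, of c'] eq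
    show ?case by auto
  qed
  with sub show "c = c'" by auto
qed

text \<open>The boundary of a boundary vanishes: each of the at most four squares around a vertex
  has exactly two edges there.\<close>

lemma boundary_even:
  assumes "v \<in> cells"
  shows "even (card {e\<in>boundary c. endpoint v e})"
proof -
  obtain i j r where v: "v = (i, j, r)" by (cases v)
  have cell: "(i, j, r) \<in> cells" "(i - 1, j, r) \<in> cells" "(i, j - 1, r) \<in> cells"
    using assms unfolding v by (auto intro: cells_pred)
  show ?thesis
    unfolding v even_card_at_vertex boundary_iff[OF cell(1)] boundary_iff(1)[OF cell(2)] boundary_iff(2)[OF cell(3)]
    by auto
qed

text \<open>The squares enclosed by a cycle \<open>G\<close> are found by counting modulo 2 how often \<open>G\<close> is crossed on the
  way out to the left.\<close>

lemma cycle_is_boundary: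
  assumes G: "G \<subseteq> cells \<times> UNIV" and even: "\<And>v. v \<in> cells \<Longrightarrow> even (card {e\<in>G. endpoint v e})"
  shows "\<exists>c\<subseteq>cells. boundary c = G"
proof -
  define c where "c = {(i, j, r). (i, j, r) \<in> cells \<and> odd (card {i'. i' \<le> i \<and> ((i', j, r), False) \<in> G})}"
  have c0: "(0, j, r) \<in> c \<longleftrightarrow> ((0, j, r), False) \<in> G" if "(0, j, r) \<in> cells" for j r
  proof -
    have "{i'. i' \<le> 0 \<and> ((i', j, r), False) \<in> G} = (if ((0, j, r), False) \<in> G then {0} else {})"
      by auto
    then show ?thesis using that by (auto simp: c_def)
  qed
  have cSuc: "(Suc i, j, r) \<in> c \<longleftrightarrow> \<not> (((Suc i, j, r), False) \<in> G \<longleftrightarrow> (i, j, r) \<in> c)"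
    if cell: "(Suc i, j, r) \<in> cells" for i j r
  proof -
    have "(i, j, r) \<in> cells" using cell by (rule cells_pred) auto
    moreover have "{i'. i' \<le> Suc i \<and> ((i', j, r), False) \<in> G} =
        (if ((Suc i, j, r), False) \<in> G then {Suc i} else {}) \<union> {i'. i' \<le> i \<and> ((i', j, r), False) \<in> G}"
      by (auto simp: le_Suc_eq)
    ultimately show ?thesis using cell by (auto simp: c_def)
  qed
  have False_iff: "((i, j, r), False) \<in> G \<longleftrightarrow> \<not> ((i, j, r) \<in> c \<longleftrightarrow> 0 < i \<and> (i - 1, j, r) \<in> c)"
    if "(i, j, r) \<in> cells" for i j r
    using that by (cases i) (auto simp: c0 cSuc)
  \<comment> \<open>\<open>False_iff\<close> holds by construction of \<open>c\<close>. Evenness at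
    a vertex now determines the edge leaving it in the first direction from the one arriving in that
    direction and the two edges in the second direction, so the claim propagates along the
    row.\<close>
  have True_iff: "((i, j, r), True) \<in> G \<longleftrightarrow> \<not> ((i, j, r) \<in> c \<longleftrightarrow> 0 < j \<and> (i, j - 1, r) \<in> c)"
    if "(i, j, r) \<in> cells" for i j r
    using that
  proof (induction i)
    case 0
    then have "(0, j - 1, r) \<in> cells" by (rule cells_pred) auto
    with False_iff[OF 0] False_iff[OF this] even[OF 0] show ?case
      unfolding even_card_at_vertex by auto
  next
    case (Suc i)
    have cell: "(i, j, r) \<in> cells" "(Suc i, j - 1, r) \<in> cells"
      using Suc.prems by (auto elim: cells_pred)
    show ?case
      using Suc.IH[OF cell(1)] False_iff[OF Suc.prems] False_iff[OF cell(2)] even[OF Suc.prems]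
      unfolding even_card_at_vertex by auto
  qed
  have "boundary c = G"
  proof (rule Set.set_eqI)
    fix e :: "cell \<times> bool"
    obtain i j r d where e: "e = ((i, j, r), d)" by (metis prod.exhaust)
    show "e \<in> boundary c \<longleftrightarrow> e \<in> G"
    proof (cases "(i, j, r) \<in> cells")
      case True
      then show ?thesis
        using True_iff[OF True] False_iff[OF True] boundary_iff[OF True, of c] e by (cases d) auto
    next
      case False
      then show ?thesis using e G boundary_subset[of c] by auto
    qed
  qed
  moreover have "c \<subseteq> cells" by (auto simp: c_def)
  ultimately show ?thesis by auto
qed

lemma card_cycles:
  "card {G. G \<subseteq> edges \<and> (\<forall>v\<in>cells. even (card {e\<in>G. endpoint v e}))} =
    card {c. c \<subseteq> cells \<and> boundary c \<subseteq> edges}"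
proof -
  have "{G. G \<subseteq> edges \<and> (\<forall>v\<in>cells. even (card {e\<in>G. endpoint v e}))} =
      boundary ` {c. c \<subseteq> cells \<and> boundary c \<subseteq> edges}" (is "?L = ?R")
  proof (rule Set.set_eqI, rule iffI)
    fix G assume "G \<in> ?L"
    with edges_subset have "G \<subseteq> edges" "\<exists>c\<subseteq>cells. boundary c = G"
      by (auto intro!: cycle_is_boundary)
    then show "G \<in> ?R" by auto
  qed (auto simp: boundary_even)
  then show ?thesis
    by (simp add: card_image inj_on_subset[OF inj_on_boundary] Pow_def subset_iff)
qed

text \<open>A cell edge outside \<open>edges\<close> must not occur in the boundary, so the two
  squares beside it agree. In this form the condition can be compared with the rules for multiplying
  by the first two variables.\<close>

lemma cochain_iff:
  assumes "c \<subseteq> cells"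
  shows "boundary c \<subseteq> edges \<longleftrightarrow> (\<forall>(i, j, a, b, n)\<in>cells.
    (h (Suc (i + a)) (j + b) + n \<le> h i j \<longrightarrow> ((i, j, a, b, n) \<in> c \<longleftrightarrow> 0 < j \<and> (i, j - 1, a, b, n) \<in> c)) \<and>
    (h (i + a) (Suc (j + b)) + n \<le> h i j \<longrightarrow> ((i, j, a, b, n) \<in> c \<longleftrightarrow> 0 < i \<and> (i - 1, j, a, b, n) \<in> c)))"
proof -
  have edge: "((i, j, a, b, n), True) \<in> edges \<longleftrightarrow> \<not> h (Suc (i + a)) (j + b) + n \<le> h i j"
    "((i, j, a, b, n), False) \<in> edges \<longleftrightarrow> \<not> h (i + a) (Suc (j + b)) + n \<le> h i j"
    if "(i, j, a, b, n) \<in> cells" for i j a b n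
    using that by (auto simp: edges_def cells_def)
  have "boundary c \<subseteq> edges \<longleftrightarrow> (\<forall>(i, j, a, b, n)\<in>cells. \<forall>d.
      ((i, j, a, b, n), d) \<in> boundary c \<longrightarrow> ((i, j, a, b, n), d) \<in> edges)"
    using boundary_subset[of c] by fast
  also have "\<dots> \<longleftrightarrow> (\<forall>(i, j, a, b, n)\<in>cells.
    (h (Suc (i + a)) (j + b) + n \<le> h i j \<longrightarrow> ((i, j, a, b, n) \<in> c \<longleftrightarrow> 0 < j \<and> (i, j - 1, a, b, n) \<in> c)) \<and>
    (h (i + a) (Suc (j + b)) + n \<le> h i j \<longrightarrow> ((i, j, a, b, n) \<in> c \<longleftrightarrow> 0 < i \<and> (i - 1, j, a, b, n) \<in> c)))"
    by (rule ball_cong[OF refl]) (auto simp: all_bool_eq edge boundary_iff)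
  finally show ?thesis .
qed

text \<open>The boundary of a member of \<open>squares\<close> lies in \<open>edges\<close>, so the
  condition on \<open>c\<close> does not depend on them. The proof uses the converse view: both
  squares beside a missing edge are outside \<open>squares\<close>.\<close>

lemma card_cochains:
  "card {c. c \<subseteq> cells \<and> boundary c \<subseteq> edges} = card cochains * 2 ^ card squares"
proof -
  let ?V = "cells - squares"
  have restrict: "boundary c \<subseteq> edges \<longleftrightarrow> boundary (c \<inter> ?V) \<subseteq> edges" if c: "c \<subseteq> cells" for c
  proof -
    have c': "c \<inter> ?V \<subseteq> cells" by auto
    show ?thesis
      unfolding cochain_iff[OF c] cochain_iff[OF c']
    proof (rule ball_cong[OF refl], clarify)
      fix i j a b n assume cell: "(i, j, a, b, n) \<in> cells"
      have 1: "(i, j, a, b, n) \<notin> squares \<and> (0 < j \<longrightarrow> (i, j - 1, a, b, n) \<in> ?V)"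
        if "h (Suc (i + a)) (j + b) + n \<le> h i j"
      proof -
        have "(0 < j \<longrightarrow> (i, j - 1, a, b, n) \<in> cells)"
          using cell by (auto intro: cells_pred)
        then show ?thesis using that cell
            mono[of "Suc (i + a)" "Suc (i + a)" "j + b" "Suc (j + b)"] mono[of i i "j - 1" j]
          by (auto simp: squares_def)
      qed
      have 2: "(i, j, a, b, n) \<notin> squares \<and> (0 < i \<longrightarrow> (i - 1, j, a, b, n) \<in> ?V)"
        if "h (i + a) (Suc (j + b)) + n \<le> h i j"
      proof -
        have "(0 < i \<longrightarrow> (i - 1, j, a, b, n) \<in> cells)"
          using cell by (auto intro: cells_pred)
        then show ?thesis using that cell
            mono[of "i + a" "Suc (i + a)" "Suc (j + b)" "Suc (j + b)"] mono[of "i - 1" i j j]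
          by (auto simp: squares_def)
      qed
      from 1 2 cell show
        "((h (Suc (i + a)) (j + b) + n \<le> h i j \<longrightarrow> ((i, j, a, b, n) \<in> c \<longleftrightarrow> 0 < j \<and> (i, j - 1, a, b, n) \<in> c)) \<and>
          (h (i + a) (Suc (j + b)) + n \<le> h i j \<longrightarrow> ((i, j, a, b, n) \<in> c \<longleftrightarrow> 0 < i \<and> (i - 1, j, a, b, n) \<in> c))) =
         ((h (Suc (i + a)) (j + b) + n \<le> h i j \<longrightarrow>
            ((i, j, a, b, n) \<in> c \<inter> ?V \<longleftrightarrow> 0 < j \<and> (i, j - 1, a, b, n) \<in> c \<inter> ?V)) \<and>
          (h (i + a) (Suc (j + b)) + n \<le> h i j \<longrightarrow>
            ((i, j, a, b, n) \<in> c \<inter> ?V \<longleftrightarrow> 0 < i \<and> (i - 1, j, a, b, n) \<in> c \<inter> ?V)))"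
        by blast
    qed
  qed
  have "card cells - card ?V = card squares"
    using squares_subset by (simp add: card_Diff_subset finite_subset[OF squares_subset] card_mono)
  moreover have "cochains = {c. c \<subseteq> ?V \<and> boundary c \<subseteq> edges}"
    by (simp add: cochains_def)
  ultimately show ?thesis
    using card_split_at[of cells ?V "\<lambda>c. boundary c \<subseteq> edges", OF finite_cells _ restrict] by simp
qed

text \<open>Here \<open>k = h i j - n\<close> is the third exponent of the target. In terms of
  \<open>k\<close>, the conditions for vertices, edges and squares become the same inequality and
  differ only in the lower bounds for \<open>a\<close> and \<open>b\<close>.\<close>

definition block :: "nat \<Rightarrow> nat \<Rightarrow> (nat \<times> nat \<times> nat \<times> nat \<times> nat) set" where
  "block s t = {(i, j, a, b, k). s \<le> a \<and> t \<le> b \<and> k < h (i + a) (j + b)}"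

lemma card_block:
  "card {(i, j, a, b, n). 0 < n \<and> n \<le> h i j \<and> h i j < h (i + a + s) (j + b + t) + n} = card (block s t)"
proof (rule bij_betw_same_card)
  show "bij_betw (\<lambda>(i, j, a, b, n). (i, j, a + s, b + t, h i j - n))
      {(i, j, a, b, n). 0 < n \<and> n \<le> h i j \<and> h i j < h (i + a + s) (j + b + t) + n} (block s t)"
  proof (rule bij_betw_byWitness[where f' = "\<lambda>(i, j, a, b, k). (i, j, a - s, b - t, h i j - k)"])
    have "k < h i j" if "k < h (i + a) (j + b)" for i j a b k
      using that mono[of i "i + a" j "j + b"] by simp
    then show "(\<lambda>(i, j, a, b, k). (i, j, a - s, b - t, h i j - k)) ` block s t \<subseteq>
        {(i, j, a, b, n). 0 < n \<and> n \<le> h i j \<and> h i j < h (i + a + s) (j + b + t) + n}"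
      by (fastforce simp: block_def)
    show "\<forall>v\<in>block s t. (\<lambda>(i, j, a, b, n). (i, j, a + s, b + t, h i j - n))
        ((\<lambda>(i, j, a, b, k). (i, j, a - s, b - t, h i j - k)) v) = v"
    proof
      fix v assume v: "v \<in> block s t"
      obtain i j a b k where "v = (i, j, a, b, k)" by (cases v)
      with v mono[of i "i + a" j "j + b"] show "(\<lambda>(i, j, a, b, n). (i, j, a + s, b + t, h i j - n))
        ((\<lambda>(i, j, a, b, k). (i, j, a - s, b - t, h i j - k)) v) = v"
        by (simp add: block_def)
    qed
  qed (auto simp: block_def add.assoc)
qed

text \<open>Inclusion and exclusion: \<open>block 1 0\<close> and \<open>block 0 1\<close> count the
  edges, their intersection \<open>block 1 1\<close> the squares, and what they leave of
  \<open>block 0 0\<close> is the part \<open>a = b = 0\<close>, a copy of the set of points below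
  the staircase.\<close>

lemma card_cells_euler:
  "card verts + card squares = card edges + card {(i, j, k). k < h i j}"
proof -
  have fin_block: "finite (block s t)" for s t
  proof (rule finite_subset)
    show "block s t \<subseteq> (\<lambda>((i, j), (a, b), k). (i, j, a, b, k)) `
      ({(i, j). 0 < h i j} \<times> {(i, j). 0 < h i j} \<times> {..h 0 0})"
    proof
      fix v assume v: "v \<in> block s t"
      obtain i j a b k where eq: "v = (i, j, a, b, k)" by (cases v)
      with v mono[of 0 "i + a" 0 "j + b"] mono[of i "i + a" j "j + b"] mono[of a "i + a" b "j + b"]
      show "v \<in> (\<lambda>((i, j), (a, b), k). (i, j, a, b, k)) `
          ({(i, j). 0 < h i j} \<times> {(i, j). 0 < h i j} \<times> {..h 0 0})"
        by (intro image_eqI[of _ _ "((i, j), (a, b), k)"]) (auto simp: block_def)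
    qed
  qed (use fin in auto)
  have V: "card verts = card (block 0 0)"
    using card_block[of 0 0] by (simp add: verts_def)
  have S: "card squares = card (block 1 1)"
    using card_block[of 1 1] by (simp add: squares_def)
  have E: "card edges = card (block 1 0) + card (block 0 1)"
  proof -
    let ?E1 = "{(i, j, a, b, n). 0 < n \<and> n \<le> h i j \<and> h i j < h (i + a + 1) (j + b + 0) + n}"
    let ?E2 = "{(i, j, a, b, n). 0 < n \<and> n \<le> h i j \<and> h i j < h (i + a + 0) (j + b + 1) + n}"
    have eq: "edges = ?E1 \<times> {True} \<union> ?E2 \<times> {False}"
      by (auto simp: edges_def split: if_splits)
    have "finite (?E1 \<times> {True})" "finite (?E2 \<times> {False})"
      using finite_edges unfolding eq by auto
    then have "card edges = card (?E1 \<times> {True}) + card (?E2 \<times> {False})"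
      unfolding eq by (intro card_Un_disjoint) auto
    then show ?thesis
      unfolding card_block[of 1 0] card_block[of 0 1] card_cartesian_product by simp
  qed
  let ?B0 = "(\<lambda>(i, j, k). (i, j, 0::nat, 0::nat, k)) ` {(i, j, k). k < h i j}"
  have "block 0 0 = (block 1 0 \<union> block 0 1) \<union> ?B0"
    by (auto simp: block_def image_iff Suc_le_eq; rule ccontr; simp)
  moreover have "(block 1 0 \<union> block 0 1) \<inter> ?B0 = {}"
    by (auto simp: block_def)
  moreover have "finite ?B0"
    by (rule finite_subset[OF _ fin_block[of 0 0]]) (auto simp: block_def)
  ultimately have "card (block 0 0) = card (block 1 0 \<union> block 0 1) + card ?B0"
    using fin_block by (simp add: card_Un_disjoint)
  moreover have "card ?B0 = card {(i, j, k). k < h i j}"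
    by (rule card_image) (auto simp: inj_on_def)
  moreover have "block 1 0 \<inter> block 0 1 = block 1 1"
    by (auto simp: block_def)
  then have "card (block 1 0) + card (block 0 1) = card (block 1 0 \<union> block 0 1) + card (block 1 1)"
    using card_Un_Int[OF fin_block fin_block, of 1 0 0 1] by simp
  ultimately show ?thesis
    unfolding V S E by simp
qed

theorem card_cocycles_cochains:
  "card cocycles = 2 ^ card {(i, j, k). k < h i j} * card cochains"
proof -
  have cancel: "x = t * z" if "x * d * e = z * s * c" "c = d * v" "s * v = t * e" "0 < d" "0 < e"
    for x z s c d e t v :: nat
  proof -
    have "x * (d * e) = z * (s * v) * d" using that(1,2) by (simp add: mult_ac)
    also have "\<dots> = t * z * (d * e)" using that(3) by (simp add: mult_ac)
    finally show ?thesis using that(4,5) by simp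
  qed
  show ?thesis
  proof (rule cancel)
    show "card cocycles * 2 ^ (card cells - card verts) * 2 ^ card edges =
        card cochains * 2 ^ card squares * 2 ^ card cells"
      using even_subsets_duality[OF finite_cells finite_edges, of endpoint]
      unfolding card_cocycles card_cycles card_cochains .
    show "(2::nat) ^ card cells = 2 ^ (card cells - card verts) * 2 ^ card verts"
      by (simp flip: power_add add: card_mono verts_subset)
    show "(2::nat) ^ card squares * 2 ^ card verts = 2 ^ card {(i, j, k). k < h i j} * 2 ^ card edges"
      using card_cells_euler by (simp flip: power_add add: add.commute)
  qed simp_all
qed

end

section \<open>Closed sets of pairs of exponents\<close>

text \<open>A pair \<open>(m, b)\<close> stands for the coefficient of the standard monomial \<open>b\<close> in the value of a
  homomorphism \<open>I \<rightarrow> S/I\<close> at the monomial \<open>m\<close> of \<open>I\<close>, and \<open>U\<close> for the multiplications by the variables.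
  The closed sets are the sets of pairs whose indicator functions are such homomorphisms.\<close>

definition closed_family :: "('a \<Rightarrow> 'a) set \<Rightarrow> 'a set \<Rightarrow> ('a \<times> 'a) set set" where
  "closed_family U B = {X. X \<subseteq> (- B) \<times> B \<and>
     (\<forall>u\<in>U. \<forall>m b. m \<notin> B \<longrightarrow> b \<in> B \<longrightarrow> ((u m, b) \<in> X \<longleftrightarrow> (\<exists>b'. b = u b' \<and> (m, b') \<in> X)))}"

lemma closed_familyD:
  assumes "X \<in> closed_family U B"
  shows "(m, b) \<in> X \<Longrightarrow> m \<notin> B \<and> b \<in> B"
    and "u \<in> U \<Longrightarrow> m \<notin> B \<Longrightarrow> b \<in> B \<Longrightarrow> (u m, b) \<in> X \<longleftrightarrow> (\<exists>b'. b = u b' \<and> (m, b') \<in> X)"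
  using assms unfolding closed_family_def by blast+

lemma closed_family_Union:
  assumes "\<X> \<subseteq> closed_family U B"
  shows "\<Union>\<X> \<in> closed_family U B"
  unfolding closed_family_def mem_Collect_eq
proof (intro conjI ballI allI impI)
  show "\<Union>\<X> \<subseteq> (- B) \<times> B" using closed_familyD(1)[OF subsetD[OF assms]] by auto
  fix u m b assume u: "u \<in> U" "m \<notin> B" "b \<in> B"
  have "(u m, b) \<in> X \<longleftrightarrow> (\<exists>b'. b = u b' \<and> (m, b') \<in> X)" if "X \<in> \<X>" for X
    by (rule closed_familyD(2)[OF subsetD[OF assms that] u])
  then show "(u m, b) \<in> \<Union>\<X> \<longleftrightarrow> (\<exists>b'. b = u b' \<and> (m, b') \<in> \<Union>\<X>)" by blast
qed

lemma closed_family_empty [simp]: "{} \<in> closed_family U B"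
  using closed_family_Union[of "{}" U B] by simp

text \<open>Meant for properties of the degree \<open>b - m\<close>, which does not change when both
  components are multiplied by the same variable.\<close>

lemma closed_family_filter:
  assumes X: "X \<in> closed_family U B" and P: "\<And>u m b. u \<in> U \<Longrightarrow> P (u m, u b) \<longleftrightarrow> P (m, b)"
  shows "{x\<in>X. P x} \<in> closed_family U B"
  unfolding closed_family_def
proof (rule CollectI, intro conjI ballI allI impI)
  show "{x\<in>X. P x} \<subseteq> (- B) \<times> B" using closed_familyD(1)[OF X] by auto
  fix u m b assume u: "u \<in> U" "m \<notin> B" "b \<in> B"
  then have "(u m, b) \<in> X \<longleftrightarrow> (\<exists>b'. b = u b' \<and> (m, b') \<in> X)"
    by (rule closed_familyD(2)[OF X])
  with P[OF u(1)] show "(u m, b) \<in> {x\<in>X. P x} \<longleftrightarrow> (\<exists>b'. b = u b' \<and> (m, b') \<in> {x\<in>X. P x})"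
    by (metis (mono_tags, lifting) mem_Collect_eq)
qed

lemma closed_family_diff:
  assumes X: "X \<in> closed_family U B" and Y: "Y \<in> closed_family U B" and inj: "\<And>u. u \<in> U \<Longrightarrow> inj u"
  shows "X - Y \<in> closed_family U B"
  unfolding closed_family_def
proof (rule CollectI, intro conjI ballI allI impI)
  show "X - Y \<subseteq> (- B) \<times> B" using closed_familyD(1)[OF X] by auto
  fix u m b assume u: "u \<in> U" "m \<notin> B" "b \<in> B"
  show "(u m, b) \<in> X - Y \<longleftrightarrow> (\<exists>b'. b = u b' \<and> (m, b') \<in> X - Y)"
    using closed_familyD(2)[OF X u] closed_familyD(2)[OF Y u] inj[OF u(1)] by (auto simp: inj_eq)
qed

text \<open>Transport of structure, used both for permuting the three variables and for passing from
  exponent vectors to triples of numbers.\<close>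

lemma closed_family_image:
  assumes "bij \<pi>"
  shows "closed_family ((\<lambda>u. \<pi> \<circ> u \<circ> inv_into UNIV \<pi>) ` U) (\<pi> ` B) = (`) (map_prod \<pi> \<pi>) ` closed_family U B"
proof -
  have inj: "inj \<pi>" and surj: "surj \<pi>" using assms by (auto simp: bij_def)
  have invs [simp]: "inv_into UNIV \<pi> (\<pi> x) = x" "\<pi> (inv_into UNIV \<pi> y) = y" for x y
    using inj surj by (auto simp: surj_f_inv_f)
  have all: "(\<forall>y. P y) \<longleftrightarrow> (\<forall>x. P (\<pi> x))" and ex: "(\<exists>y. P y) \<longleftrightarrow> (\<exists>x. P (\<pi> x))" for P
    by (metis invs(2))+
  have mem: "map_prod \<pi> \<pi> ` X \<in> closed_family ((\<lambda>u. \<pi> \<circ> u \<circ> inv_into UNIV \<pi>) ` U) (\<pi> ` B) \<longleftrightarrow> X \<in> closed_family U B" for X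
  proof -
    have [simp]: "(\<pi> x, \<pi> y) \<in> map_prod \<pi> \<pi> ` X \<longleftrightarrow> (x, y) \<in> X" for x y
      using inj_image_mem_iff[OF prod.inj_map[OF inj inj], of "(x, y)" X] by simp
    have [simp]: "\<pi> x \<in> \<pi> ` B \<longleftrightarrow> x \<in> B" for x
      using inj by (simp add: inj_image_mem_iff)
    have "map_prod \<pi> \<pi> x \<in> (- \<pi> ` B) \<times> \<pi> ` B \<longleftrightarrow> x \<in> (- B) \<times> B" for x
      by (cases x) simp
    then have "map_prod \<pi> \<pi> ` X \<subseteq> (- \<pi> ` B) \<times> \<pi> ` B \<longleftrightarrow> X \<subseteq> (- B) \<times> B"
      by (simp only: image_subset_iff subset_eq[of X])
    then show ?thesis
      unfolding closed_family_def mem_Collect_eq ball_simps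
      by (subst all, subst all, subst ex) (simp add: inj_eq[OF inj])
  qed
  show ?thesis
  proof (intro equalityI subsetI)
    fix Y assume Y: "Y \<in> closed_family ((\<lambda>u. \<pi> \<circ> u \<circ> inv_into UNIV \<pi>) ` U) (\<pi> ` B)"
    have "Y = map_prod \<pi> \<pi> ` (map_prod (inv_into UNIV \<pi>) (inv_into UNIV \<pi>) ` Y)"
      by (auto simp: image_iff) (metis (no_types, lifting) case_prod_conv invs(2) map_prod_simp)+
    with Y mem show "Y \<in> (`) (map_prod \<pi> \<pi>) ` closed_family U B" by (metis image_eqI)
  qed (use mem in auto)
qed

type_synonym point = "nat \<times> nat \<times> nat"

fun up1 :: "point \<Rightarrow> point" where "up1 (i, j, k) = (Suc i, j, k)"
fun up2 :: "point \<Rightarrow> point" where "up2 (i, j, k) = (i, Suc j, k)"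
fun up3 :: "point \<Rightarrow> point" where "up3 (i, j, k) = (i, j, Suc k)"

abbreviation closed_sets :: "point set \<Rightarrow> (point \<times> point) set set" where
  "closed_sets \<equiv> closed_family {up1, up2, up3}"

text \<open>The entry \<open>True\<close> marks a negative component of the degree \<open>b - m\<close>.\<close>

fun sgn3 :: "point \<times> point \<Rightarrow> bool \<times> bool \<times> bool" where
  "sgn3 ((i, j, k), (i', j', k')) = (i' < i, j' < j, k' < k)"

definition signed_sets :: "point set \<Rightarrow> bool \<times> bool \<times> bool \<Rightarrow> (point \<times> point) set set" where
  "signed_sets B s = {X \<in> closed_sets B. \<forall>x\<in>X. sgn3 x = s}"

lemma closed_sets_iff:
  "X \<in> closed_sets B \<longleftrightarrow> X \<subseteq> (- B) \<times> B \<and>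
    (\<forall>i j k i' j' k'. (i, j, k) \<notin> B \<longrightarrow> (i', j', k') \<in> B \<longrightarrow>
      (((Suc i, j, k), (i', j', k')) \<in> X \<longleftrightarrow> 0 < i' \<and> ((i, j, k), (i' - 1, j', k')) \<in> X) \<and>
      (((i, Suc j, k), (i', j', k')) \<in> X \<longleftrightarrow> 0 < j' \<and> ((i, j, k), (i', j' - 1, k')) \<in> X) \<and>
      (((i, j, Suc k), (i', j', k')) \<in> X \<longleftrightarrow> 0 < k' \<and> ((i, j, k), (i', j', k' - 1)) \<in> X))"
proof -
  have ex: "(\<exists>x. y = Suc x \<and> P x) \<longleftrightarrow> 0 < y \<and> P (y - Suc 0)" for y P
    by (cases y) auto
  show ?thesis
    unfolding closed_family_def mem_Collect_eq
    by (simp add: ex all_conj_distrib imp_conjR)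
qed

section \<open>Closed sets restricted to the bottoms of columns\<close>

context staircase
begin

definition under :: "point set" where
  "under = {(i, j, k). k < h i j}"

lemma closed_step:
  assumes "X \<in> closed_sets under" "h i j \<le> k" "k' < h i' j'"
  shows "((Suc i, j, k), (i', j', k')) \<in> X \<longleftrightarrow> 0 < i' \<and> ((i, j, k), (i' - 1, j', k')) \<in> X"
    and "((i, Suc j, k), (i', j', k')) \<in> X \<longleftrightarrow> 0 < j' \<and> ((i, j, k), (i', j' - 1, k')) \<in> X"
    and "((i, j, Suc k), (i', j', k')) \<in> X \<longleftrightarrow> 0 < k' \<and> ((i, j, k), (i', j', k' - 1)) \<in> X"
  using assms by (auto simp: closed_sets_iff under_def not_less)

lemma closed_sub:
  assumes "X \<in> closed_sets under" "((i, j, k), (i', j', k')) \<in> X"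
  shows "h i j \<le> k" "k' < h i' j'"
  using assms by (auto simp: closed_sets_iff under_def not_less)

text \<open>A column is governed by its bottom: sliding the source down by \<open>t\<close> is
  possible exactly as long as the third exponent of the target does not run out.\<close>

lemma closed_lower:
  assumes X: "X \<in> closed_sets under" and "k' < h i' j'"
  shows "((i, j, h i j + t), (i', j', k')) \<in> X \<longleftrightarrow> t \<le> k' \<and> ((i, j, h i j), (i', j', k' - t)) \<in> X"
  using assms(2)
proof (induction t arbitrary: k')
  case (Suc t)
  have "((i, j, h i j + Suc t), (i', j', k')) \<in> X \<longleftrightarrow> 0 < k' \<and> ((i, j, h i j + t), (i', j', k' - 1)) \<in> X"
    using closed_step(3)[OF X _ Suc.prems, of i j "h i j + t"] by simp
  also have "\<dots> \<longleftrightarrow> 0 < k' \<and> t \<le> k' - 1 \<and> ((i, j, h i j), (i', j', k' - 1 - t)) \<in> X"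
    using Suc.IH[of "k' - 1"] Suc.prems by auto
  finally show ?case by auto
qed simp

definition ppn_of :: "(point \<times> point) set \<Rightarrow> cell set" where
  "ppn_of X = {(i, j, a, b, n). 0 < n \<and> n \<le> h i j \<and> ((i, j, h i j), (i + a, j + b, h i j - n)) \<in> X}"

definition of_ppn :: "cell set \<Rightarrow> (point \<times> point) set" where
  "of_ppn Y = {((i, j, k), (i', j', k')). h i j \<le> k \<and> k' < h i' j' \<and>
     i \<le> i' \<and> j \<le> j' \<and> k' < k \<and> (i, j, i' - i, j' - j, k - k') \<in> Y}"

lemma cocycleD:
  assumes "Y \<in> cocycles" "0 < n" "n \<le> h i j"
  shows "h i j < h (Suc (i + a)) (j + b) + n \<Longrightarrow> (i, j, a, b, n) \<in> Y \<longleftrightarrow> (Suc i, j, a, b, n) \<in> Y"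
    and "h i j < h (i + a) (Suc (j + b)) + n \<Longrightarrow> (i, j, a, b, n) \<in> Y \<longleftrightarrow> (i, Suc j, a, b, n) \<in> Y"
proof -
  assume "h i j < h (Suc (i + a)) (j + b) + n"
  then have "((i, j, a, b, n), True) \<in> edges" using assms by (auto simp: edges_def)
  then show "(i, j, a, b, n) \<in> Y \<longleftrightarrow> (Suc i, j, a, b, n) \<in> Y"
    using assms(1) by (fastforce simp: cocycles_def)
next
  assume "h i j < h (i + a) (Suc (j + b)) + n"
  then have "((i, j, a, b, n), False) \<in> edges" using assms by (auto simp: edges_def)
  then show "(i, j, a, b, n) \<in> Y \<longleftrightarrow> (i, Suc j, a, b, n) \<in> Y"
    using assms(1) by (fastforce simp: cocycles_def)
qed

lemma ppn_of_cocycle: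
  assumes X: "X \<in> closed_sets under"
  shows "ppn_of X \<in> cocycles"
proof -
  have 1: "(i, j, a, b, n) \<in> ppn_of X \<longleftrightarrow> (Suc i, j, a, b, n) \<in> ppn_of X"
    if "0 < n" "n \<le> h i j" "h i j < h (Suc (i + a)) (j + b) + n" for i j a b n
  proof -
    have le: "h (Suc i) j \<le> h i j" by (rule mono) auto
    \<comment> \<open>A step from the bottom over \<open>(i, j)\<close> arrives at height
      \<open>h i j\<close>, at or above the bottom of the next column. Sliding down to that bottom
      is obstructed exactly if \<open>n\<close> exceeds the height of the next column.\<close>
    have "(i, j, a, b, n) \<in> ppn_of X \<longleftrightarrow> ((Suc i, j, h i j), (Suc (i + a), j + b, h i j - n)) \<in> X"
      using closed_step(1)[OF X, of i j "h i j" "h i j - n" "Suc (i + a)" "j + b"] that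
      by (auto simp: ppn_of_def)
    also have "\<dots> \<longleftrightarrow> n \<le> h (Suc i) j \<and> ((Suc i, j, h (Suc i) j), (Suc (i + a), j + b, h (Suc i) j - n)) \<in> X"
      using closed_lower[OF X, of "h i j - n" "Suc (i + a)" "j + b" "Suc i" j "h i j - h (Suc i) j"] that le
      by (auto simp: diff_diff_eq2)
    finally show ?thesis using that by (auto simp: ppn_of_def)
  qed
  have 2: "(i, j, a, b, n) \<in> ppn_of X \<longleftrightarrow> (i, Suc j, a, b, n) \<in> ppn_of X"
    if "0 < n" "n \<le> h i j" "h i j < h (i + a) (Suc (j + b)) + n" for i j a b n
  proof -
    have le: "h i (Suc j) \<le> h i j" by (rule mono) auto
    have "(i, j, a, b, n) \<in> ppn_of X \<longleftrightarrow> ((i, Suc j, h i j), (i + a, Suc (j + b), h i j - n)) \<in> X"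
      using closed_step(2)[OF X, of i j "h i j" "h i j - n" "i + a" "Suc (j + b)"] that
      by (auto simp: ppn_of_def)
    also have "\<dots> \<longleftrightarrow> n \<le> h i (Suc j) \<and> ((i, Suc j, h i (Suc j)), (i + a, Suc (j + b), h i (Suc j) - n)) \<in> X"
      using closed_lower[OF X, of "h i j - n" "i + a" "Suc (j + b)" i "Suc j" "h i j - h i (Suc j)"] that le
      by (auto simp: diff_diff_eq2)
    finally show ?thesis using that by (auto simp: ppn_of_def)
  qed
  have "ppn_of X \<subseteq> verts"
    using closed_sub(2)[OF X] by (fastforce simp: ppn_of_def verts_def)
  moreover have "(i, j, r) \<in> ppn_of X \<longleftrightarrow> (if d then (Suc i, j, r) else (i, Suc j, r)) \<in> ppn_of X"
    if "((i, j, r), d) \<in> edges" for i j r d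
    using that 1 2 by (cases r) (auto simp: edges_def split: if_splits)
  ultimately show ?thesis by (auto simp: cocycles_def)
qed

lemma of_ppn_closed:
  assumes Y: "Y \<in> cocycles"
  shows "of_ppn Y \<in> closed_sets under"
proof -
  have pos: "n \<le> h i j" if "(i, j, a, b, n) \<in> Y" for i j a b n
    using that Y by (auto simp: cocycles_def verts_def)
  have 1: "((Suc i, j, k), (i', j', k')) \<in> of_ppn Y \<longleftrightarrow> 0 < i' \<and> ((i, j, k), (i' - 1, j', k')) \<in> of_ppn Y"
    if "h i j \<le> k" "k' < h i' j'" for i j k i' j' k'
  proof (cases "Suc i \<le> i' \<and> j \<le> j' \<and> k' < k")
    case True
    then obtain a b n where eq: "i' = Suc (i + a)" "j' = j + b" "k = k' + n" "0 < n"
      by (metis add_Suc le_Suc_ex less_imp_add_positive)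
    have "(i, j, a, b, n) \<in> Y \<longleftrightarrow> (Suc i, j, a, b, n) \<in> Y"
    proof (cases "n \<le> h i j")
      case True
      then show ?thesis using cocycleD(1)[OF Y, of n i j a b] that eq by auto
    next
      case False
      then show ?thesis using pos[of i j a b n] pos[of "Suc i" j a b n] mono[of i "Suc i" j j] by auto
    qed
    then show ?thesis using that eq mono[of i "Suc i" j j] mono[of "i + a" "Suc (i + a)" "j + b" "j + b"]
      by (auto simp: of_ppn_def)
  qed (auto simp: of_ppn_def)
  have 2: "((i, Suc j, k), (i', j', k')) \<in> of_ppn Y \<longleftrightarrow> 0 < j' \<and> ((i, j, k), (i', j' - 1, k')) \<in> of_ppn Y"
    if "h i j \<le> k" "k' < h i' j'" for i j k i' j' k'
  proof (cases "i \<le> i' \<and> Suc j \<le> j' \<and> k' < k")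
    case True
    then obtain a b n where eq: "i' = i + a" "j' = Suc (j + b)" "k = k' + n" "0 < n"
      by (metis add_Suc le_Suc_ex less_imp_add_positive)
    have "(i, j, a, b, n) \<in> Y \<longleftrightarrow> (i, Suc j, a, b, n) \<in> Y"
    proof (cases "n \<le> h i j")
      case True
      then show ?thesis using cocycleD(2)[OF Y, of n i j a b] that eq by auto
    next
      case False
      then show ?thesis using pos[of i j a b n] pos[of i "Suc j" a b n] mono[of i i j "Suc j"] by auto
    qed
    then show ?thesis using that eq mono[of i i j "Suc j"] mono[of "i + a" "i + a" "j + b" "Suc (j + b)"]
      by (auto simp: of_ppn_def)
  qed (auto simp: of_ppn_def)
  have 3: "((i, j, Suc k), (i', j', k')) \<in> of_ppn Y \<longleftrightarrow> 0 < k' \<and> ((i, j, k), (i', j', k' - 1)) \<in> of_ppn Y"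
    if "h i j \<le> k" "k' < h i' j'" for i j k i' j' k'
  proof (cases k')
    \<comment> \<open>For target exponent 0 the degree would be \<open>- Suc k\<close>, but a vertex
      over \<open>(i, j)\<close> has \<open>n \<le> h i j \<le> k\<close>.\<close>
    case 0
    then show ?thesis using that pos[of i j "i' - i" "j' - j" "Suc k"] by (auto simp: of_ppn_def)
  next
    case (Suc l)
    then show ?thesis using that by (auto simp: of_ppn_def)
  qed
  have "of_ppn Y \<subseteq> (- under) \<times> under" by (auto simp: of_ppn_def under_def)
  with 1 2 3 show ?thesis
    unfolding closed_sets_iff under_def by (simp add: not_less)
qed

lemma card_ppn: "card (signed_sets under (False, False, True)) = card cocycles"
proof (rule bij_betw_same_card)
  show "bij_betw ppn_of (signed_sets under (False, False, True)) cocycles"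
  proof (rule bij_betw_byWitness[where f' = of_ppn])
    show "\<forall>X\<in>signed_sets under (False, False, True). of_ppn (ppn_of X) = X"
    proof
      fix X assume "X \<in> signed_sets under (False, False, True)"
      then have X: "X \<in> closed_sets under" and sg: "\<And>x. x \<in> X \<Longrightarrow> sgn3 x = (False, False, True)"
        by (auto simp: signed_sets_def)
      show "of_ppn (ppn_of X) = X"
      proof (rule Set.set_eqI)
        fix x :: "point \<times> point"
        obtain i j k i' j' k' where x: "x = ((i, j, k), (i', j', k'))" by (metis prod.exhaust)
        show "x \<in> of_ppn (ppn_of X) \<longleftrightarrow> x \<in> X"
        proof (cases "h i j \<le> k \<and> k' < h i' j' \<and> i \<le> i' \<and> j \<le> j' \<and> k' < k")
          case True
          then have "x \<in> X \<longleftrightarrow> k - h i j \<le> k' \<and> ((i, j, h i j), (i', j', k' - (k - h i j))) \<in> X"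
            using closed_lower[OF X, of k' i' j' i j "k - h i j"] x by simp
          moreover have "x \<in> of_ppn (ppn_of X) \<longleftrightarrow>
              k - k' \<le> h i j \<and> ((i, j, h i j), (i', j', h i j - (k - k'))) \<in> X"
            using True by (simp add: x of_ppn_def ppn_of_def)
          moreover have "k - k' \<le> h i j \<longleftrightarrow> k - h i j \<le> k'" by auto
          moreover have "h i j - (k - k') = k' - (k - h i j)" if "k - h i j \<le> k'"
            using True that by simp
          ultimately show ?thesis by metis
        next
          case False
          then show ?thesis
            using closed_sub[OF X, of i j k i' j' k'] sg[of x] by (auto simp: x of_ppn_def)
        qed
      qed
    qed
    show "\<forall>Y\<in>cocycles. ppn_of (of_ppn Y) = Y"
    proof
      fix Y assume "Y \<in> cocycles"
      then have "0 < n \<and> n \<le> h i j \<and> h i j < h (i + a) (j + b) + n" if "(i, j, a, b, n) \<in> Y" for i j a b n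
        using that by (auto simp: cocycles_def verts_def)
      then show "ppn_of (of_ppn Y) = Y"
        by (fastforce simp: ppn_of_def of_ppn_def)
    qed
    show "ppn_of ` signed_sets under (False, False, True) \<subseteq> cocycles"
      using ppn_of_cocycle by (auto simp: signed_sets_def)
    show "of_ppn ` cocycles \<subseteq> signed_sets under (False, False, True)"
      using of_ppn_closed by (auto simp: signed_sets_def of_ppn_def)
  qed
qed

text \<open>Now \<open>(i, j)\<close> is the column of the target, and the source is the bottom of
  the column over the opposite corner; the degree is \<open>(- a - 1, - b - 1, n - 1)\<close>. The
  shift of \<open>n\<close> is due to the third component, which may be zero for this sign, whereas
  cells have \<open>0 < n\<close>. With it, the target of a cell is standard exactly if the cell is
  outside \<open>squares\<close>.\<close>

definition nnp_of :: "(point \<times> point) set \<Rightarrow> cell set" where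
  "nnp_of X = {(i, j, a, b, n). 0 < n \<and>
     ((Suc (i + a), Suc (j + b), h (Suc (i + a)) (Suc (j + b))), (i, j, h (Suc (i + a)) (Suc (j + b)) + n - 1)) \<in> X}"

definition of_nnp :: "cell set \<Rightarrow> (point \<times> point) set" where
  "of_nnp Z = {((i, j, k), (i', j', k')). h i j \<le> k \<and> k' < h i' j' \<and>
     i' < i \<and> j' < j \<and> k \<le> k' \<and> (i', j', i - i' - 1, j - j' - 1, Suc k' - k) \<in> Z}"

lemma cochainD:
  assumes "Z \<in> cochains" "(i, j, a, b, n) \<in> cells"
  shows "h (Suc (i + a)) (j + b) + n \<le> h i j \<Longrightarrow> (i, j, a, b, n) \<in> Z \<longleftrightarrow> 0 < j \<and> (i, j - 1, a, b, n) \<in> Z"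
    and "h (i + a) (Suc (j + b)) + n \<le> h i j \<Longrightarrow> (i, j, a, b, n) \<in> Z \<longleftrightarrow> 0 < i \<and> (i - 1, j, a, b, n) \<in> Z"
proof -
  from assms(1) have "Z \<subseteq> cells" "boundary Z \<subseteq> edges" by (auto simp: cochains_def)
  with cochain_iff[of Z] assms(2)
  show "h (Suc (i + a)) (j + b) + n \<le> h i j \<Longrightarrow> (i, j, a, b, n) \<in> Z \<longleftrightarrow> 0 < j \<and> (i, j - 1, a, b, n) \<in> Z"
    and "h (i + a) (Suc (j + b)) + n \<le> h i j \<Longrightarrow> (i, j, a, b, n) \<in> Z \<longleftrightarrow> 0 < i \<and> (i - 1, j, a, b, n) \<in> Z"
    by fastforce+
qed

text \<open>If \<open>h a b = 0\<close>, the source can be divided by the first variable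
  \<open>i + 1\<close> times inside the ideal, but the target only \<open>i\<close> times. This
  confines the degrees to those in \<open>cells\<close>.\<close>

lemma nnp_far:
  assumes X: "X \<in> closed_sets under" and far: "h a b = 0"
  shows "((Suc (i + a), Suc (j + b), k), (i, j, k')) \<notin> X"
proof
  assume "((Suc (i + a), Suc (j + b), k), (i, j, k')) \<in> X"
  then show False
  proof (induction i)
    case 0
    have "h a (Suc (j + b)) = 0" using mono[of a a b "Suc (j + b)"] far by simp
    then show ?case
      using closed_step(1)[OF X, of a "Suc (j + b)" k k' 0 j] 0 closed_sub(2)[OF X 0] by simp
  next
    case (Suc i)
    have "h (Suc (i + a)) (Suc (j + b)) = 0" using mono[of a "Suc (i + a)" b "Suc (j + b)"] far by simp
    then show ?case
      using closed_step(1)[OF X, of "Suc (i + a)" "Suc (j + b)" k k' "Suc i" j] Suc.IH Suc.prems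
        closed_sub(2)[OF X Suc.prems] by simp
  qed
qed

lemma nnp_of_cochain:
  assumes X: "X \<in> closed_sets under"
  shows "nnp_of X \<in> cochains"
proof -
  have sub: "0 < n \<and> h (Suc (i + a)) (Suc (j + b)) + n \<le> h i j \<and> 0 < h a b"
    if "(i, j, a, b, n) \<in> nnp_of X" for i j a b n
  proof -
    let ?k = "h (Suc (i + a)) (Suc (j + b))"
    have *: "((Suc (i + a), Suc (j + b), ?k), (i, j, ?k + n - 1)) \<in> X" "0 < n"
      using that by (auto simp: nnp_of_def)
    with closed_sub(2)[OF X *(1)] nnp_far[OF X, of a b i j] show ?thesis
      by (cases "h a b = 0") auto
  qed
  have 1: "(i, j, a, b, n) \<in> nnp_of X \<longleftrightarrow> 0 < j \<and> (i, j - 1, a, b, n) \<in> nnp_of X"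
    if n: "0 < n" and le: "h (Suc (i + a)) (j + b) + n \<le> h i j" for i j a b n
  proof -
    \<comment> \<open>\<open>?l\<close> is the bottom of the column from which a step in direction 2
      leads to the source column. At this height the source can both slide down to its own bottom
      and step back, and \<open>le\<close> says that the target is still standard.\<close>
    let ?k = "h (Suc (i + a)) (Suc (j + b))" and ?l = "h (Suc (i + a)) (j + b)"
    have kl: "?k \<le> ?l" by (rule mono) auto
    have lt: "?l + n - 1 < h i j" using n le by simp
    have "(i, j, a, b, n) \<in> nnp_of X \<longleftrightarrow> ((Suc (i + a), Suc (j + b), ?l), (i, j, ?l + n - 1)) \<in> X"
      using closed_lower[OF X lt, of "Suc (i + a)" "Suc (j + b)" "?l - ?k"] n kl
      by (auto simp: nnp_of_def add.commute)
    also have "\<dots> \<longleftrightarrow> 0 < j \<and> ((Suc (i + a), j + b, ?l), (i, j - 1, ?l + n - 1)) \<in> X"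
      using closed_step(2)[OF X _ lt, of "Suc (i + a)" "j + b"] by simp
    also have "\<dots> \<longleftrightarrow> 0 < j \<and> (i, j - 1, a, b, n) \<in> nnp_of X"
      using n by (cases j) (auto simp: nnp_of_def)
    finally show ?thesis .
  qed
  have 2: "(i, j, a, b, n) \<in> nnp_of X \<longleftrightarrow> 0 < i \<and> (i - 1, j, a, b, n) \<in> nnp_of X"
    if n: "0 < n" and le: "h (i + a) (Suc (j + b)) + n \<le> h i j" for i j a b n
  proof -
    let ?k = "h (Suc (i + a)) (Suc (j + b))" and ?l = "h (i + a) (Suc (j + b))"
    have kl: "?k \<le> ?l" by (rule mono) auto
    have lt: "?l + n - 1 < h i j" using n le by simp
    have "(i, j, a, b, n) \<in> nnp_of X \<longleftrightarrow> ((Suc (i + a), Suc (j + b), ?l), (i, j, ?l + n - 1)) \<in> X"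
      using closed_lower[OF X lt, of "Suc (i + a)" "Suc (j + b)" "?l - ?k"] n kl
      by (auto simp: nnp_of_def add.commute)
    also have "\<dots> \<longleftrightarrow> 0 < i \<and> ((i + a, Suc (j + b), ?l), (i - 1, j, ?l + n - 1)) \<in> X"
      using closed_step(1)[OF X _ lt, of "i + a" "Suc (j + b)"] by simp
    also have "\<dots> \<longleftrightarrow> 0 < i \<and> (i - 1, j, a, b, n) \<in> nnp_of X"
      using n by (cases i) (auto simp: nnp_of_def)
    finally show ?thesis .
  qed
  have sub': "nnp_of X \<subseteq> cells - squares"
    using sub by (fastforce simp: cells_def squares_def)
  then have cells: "nnp_of X \<subseteq> cells" by auto
  have "boundary (nnp_of X) \<subseteq> edges"
    unfolding cochain_iff[OF cells]
  proof
    fix v assume "v \<in> cells"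
    moreover obtain i j a b n where "v = (i, j, a, b, n)" by (cases v)
    ultimately show "case v of (i, j, a, b, n) \<Rightarrow>
      (h (Suc (i + a)) (j + b) + n \<le> h i j \<longrightarrow> ((i, j, a, b, n) \<in> nnp_of X \<longleftrightarrow> 0 < j \<and> (i, j - 1, a, b, n) \<in> nnp_of X)) \<and>
      (h (i + a) (Suc (j + b)) + n \<le> h i j \<longrightarrow> ((i, j, a, b, n) \<in> nnp_of X \<longleftrightarrow> 0 < i \<and> (i - 1, j, a, b, n) \<in> nnp_of X))"
      using 1[of n i a j b] 2[of n i a j b] by (auto simp: cells_def)
  qed
  with sub' show ?thesis by (simp add: cochains_def)
qed

lemma of_nnp_closed:
  assumes Z: "Z \<in> cochains"
  shows "of_nnp Z \<in> closed_sets under"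
proof -
  have mem: "(i, j, a, b, n) \<in> cells \<and> 0 < n \<and> h (Suc (i + a)) (Suc (j + b)) + n \<le> h i j"
    if "(i, j, a, b, n) \<in> Z" for i j a b n
    using that Z by (auto simp: cochains_def cells_def squares_def)
  have 1: "((Suc i, j, k), (i', j', k')) \<in> of_nnp Z \<longleftrightarrow> 0 < i' \<and> ((i, j, k), (i' - 1, j', k')) \<in> of_nnp Z"
    if hyp: "h i j \<le> k" "k' < h i' j'" for i j k i' j' k'
  proof (cases "i' \<le> i \<and> j' < j \<and> k \<le> k'")
    case True
    then obtain a b n where eq: "i = i' + a" "j = Suc (j' + b)" "Suc k' = k + n" "0 < n"
      by (metis Suc_leI add_Suc add_Suc_right le_Suc_ex less_imp_Suc_add zero_less_Suc)
    have "(i', j', a, b, n) \<in> Z \<longleftrightarrow> 0 < i' \<and> (i' - 1, j', a, b, n) \<in> Z"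
    proof (cases "(i', j', a, b, n) \<in> cells")
      case True
      then show ?thesis using cochainD(2)[OF Z True] hyp eq by auto
    next
      case False
      then have "h a b = 0" using hyp eq by (auto simp: cells_def)
      then show ?thesis using mem[of i' j' a b n] mem[of "i' - 1" j' a b n] by (auto simp: cells_def)
    qed
    moreover have "Suc i - i' - 1 = a" "j - j' - 1 = b" "Suc k' - k = n" "i - (i' - 1) - 1 = a \<or> i' = 0"
      using eq by auto
    moreover have "h (Suc i) j \<le> k" using hyp mono[of i "Suc i" j j] by simp
    moreover have "k' < h (i' - 1) j'" using hyp mono[of "i' - 1" i' j' j'] by simp
    ultimately show ?thesis using hyp True by (auto simp: of_nnp_def)
  qed (auto simp: of_nnp_def)
  have 2: "((i, Suc j, k), (i', j', k')) \<in> of_nnp Z \<longleftrightarrow> 0 < j' \<and> ((i, j, k), (i', j' - 1, k')) \<in> of_nnp Z"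
    if hyp: "h i j \<le> k" "k' < h i' j'" for i j k i' j' k'
  proof (cases "i' < i \<and> j' \<le> j \<and> k \<le> k'")
    case True
    then obtain a b n where eq: "i = Suc (i' + a)" "j = j' + b" "Suc k' = k + n" "0 < n"
      by (metis Suc_leI add_Suc add_Suc_right le_Suc_ex less_imp_Suc_add zero_less_Suc)
    have "(i', j', a, b, n) \<in> Z \<longleftrightarrow> 0 < j' \<and> (i', j' - 1, a, b, n) \<in> Z"
    proof (cases "(i', j', a, b, n) \<in> cells")
      case True
      then show ?thesis using cochainD(1)[OF Z True] hyp eq by auto
    next
      case False
      then have "h a b = 0" using hyp eq by (auto simp: cells_def)
      then show ?thesis using mem[of i' j' a b n] mem[of i' "j' - 1" a b n] by (auto simp: cells_def)
    qed
    moreover have "i - i' - 1 = a" "Suc j - j' - 1 = b" "Suc k' - k = n" "j - (j' - 1) - 1 = b \<or> j' = 0"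
      using eq by auto
    moreover have "h i (Suc j) \<le> k" using hyp mono[of i i j "Suc j"] by simp
    moreover have "k' < h i' (j' - 1)" using hyp mono[of i' i' "j' - 1" j'] by simp
    ultimately show ?thesis using hyp True by (auto simp: of_nnp_def)
  qed (auto simp: of_nnp_def)
  have 3: "((i, j, Suc k), (i', j', k')) \<in> of_nnp Z \<longleftrightarrow> 0 < k' \<and> ((i, j, k), (i', j', k' - 1)) \<in> of_nnp Z"
    if "h i j \<le> k" "k' < h i' j'" for i j k i' j' k'
    using that mem[of i' j' "i - i' - 1" "j - j' - 1" 0] by (cases k') (auto simp: of_nnp_def)
  have "of_nnp Z \<subseteq> (- under) \<times> under" by (auto simp: of_nnp_def under_def)
  with 1 2 3 show ?thesis
    unfolding closed_sets_iff under_def by (simp add: not_less)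
qed

lemma card_nnp: "card (signed_sets under (True, True, False)) = card cochains"
proof (rule bij_betw_same_card)
  show "bij_betw nnp_of (signed_sets under (True, True, False)) cochains"
  proof (rule bij_betw_byWitness[where f' = of_nnp])
    show "\<forall>X\<in>signed_sets under (True, True, False). of_nnp (nnp_of X) = X"
    proof
      fix X assume "X \<in> signed_sets under (True, True, False)"
      then have X: "X \<in> closed_sets under" and sg: "\<And>x. x \<in> X \<Longrightarrow> sgn3 x = (True, True, False)"
        by (auto simp: signed_sets_def)
      show "of_nnp (nnp_of X) = X"
      proof (rule Set.set_eqI)
        fix x :: "point \<times> point"
        obtain i j k i' j' k' where x: "x = ((i, j, k), (i', j', k'))" by (metis prod.exhaust)
        show "x \<in> of_nnp (nnp_of X) \<longleftrightarrow> x \<in> X"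
        proof (cases "h i j \<le> k \<and> k' < h i' j' \<and> i' < i \<and> j' < j \<and> k \<le> k'")
          case True
          then have "x \<in> X \<longleftrightarrow> k - h i j \<le> k' \<and> ((i, j, h i j), (i', j', k' - (k - h i j))) \<in> X"
            using closed_lower[OF X, of k' i' j' i j "k - h i j"] x by simp
          moreover have "Suc (i' + (i - i' - 1)) = i" "Suc (j' + (j - j' - 1)) = j"
            "h i j + (Suc k' - k) - 1 = k' - (k - h i j)"
            using True by auto
          then have "x \<in> of_nnp (nnp_of X) \<longleftrightarrow> ((i, j, h i j), (i', j', k' - (k - h i j))) \<in> X"
            using True by (simp only: x of_nnp_def nnp_of_def mem_Collect_eq case_prod_conv) auto
          ultimately show ?thesis using True by auto
        next
          case False
          then show ?thesis
            using closed_sub[OF X, of i j k i' j' k'] sg[of x] by (auto simp: x of_nnp_def)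
        qed
      qed
    qed
    show "\<forall>Z\<in>cochains. nnp_of (of_nnp Z) = Z"
    proof
      fix Z assume "Z \<in> cochains"
      then have "0 < n \<and> h (Suc (i + a)) (Suc (j + b)) + n \<le> h i j" if "(i, j, a, b, n) \<in> Z" for i j a b n
        using that by (auto simp: cochains_def cells_def squares_def)
      then show "nnp_of (of_nnp Z) = Z"
        by (fastforce simp: nnp_of_def of_nnp_def)
    qed
    show "nnp_of ` signed_sets under (True, True, False) \<subseteq> cochains"
      using nnp_of_cochain by (auto simp: signed_sets_def)
    show "of_nnp ` cochains \<subseteq> signed_sets under (True, True, False)"
      using of_nnp_closed by (auto simp: signed_sets_def of_nnp_def)
  qed
qed

lemma card_ppn_nnp:
  "card (signed_sets under (False, False, True)) = 2 ^ card under * card (signed_sets under (True, True, False))"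
  unfolding card_ppn card_nnp using card_cocycles_cochains by (simp add: under_def)

end

section \<open>Sign patterns\<close>

lemma closed_sets_sgn3:
  assumes "X \<in> closed_sets B"
  shows "{x\<in>X. sgn3 x = s} \<in> closed_sets B"
proof -
  have "sgn3 (u m, u b) = sgn3 (m, b)" if "u \<in> {up1, up2, up3}" for u m b
    using that by (cases m; cases b) auto
  then show ?thesis by (intro closed_family_filter[OF assms]) auto
qed

text \<open>Multiplications preserve the sign, so a closed set amounts to an independent choice of
  one closed set for each of the eight patterns.\<close>

lemma card_closed_sets_prod:
  "card (closed_sets B) = (\<Prod>s\<in>UNIV. card (signed_sets B s))"
proof -
  have "bij_betw (\<lambda>X. \<lambda>s\<in>UNIV. {x\<in>X. sgn3 x = s}) (closed_sets B) (PiE UNIV (signed_sets B))"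
  proof (rule bij_betw_byWitness[where f' = "\<lambda>f. \<Union>(range f)"])
    show "(\<lambda>X. \<lambda>s\<in>UNIV. {x\<in>X. sgn3 x = s}) ` closed_sets B \<subseteq> PiE UNIV (signed_sets B)"
      by (auto simp: signed_sets_def closed_sets_sgn3)
    show "(\<lambda>f. \<Union>(range f)) ` PiE UNIV (signed_sets B) \<subseteq> closed_sets B"
      by (auto intro!: closed_family_Union simp: signed_sets_def PiE_iff)
    show "\<forall>f\<in>PiE UNIV (signed_sets B). (\<lambda>s\<in>UNIV. {x\<in>\<Union>(range f). sgn3 x = s}) = f"
    proof
      fix f assume f: "f \<in> PiE UNIV (signed_sets B)"
      have f: "\<And>s x. x \<in> f s \<Longrightarrow> sgn3 x = s"
        using f by (auto simp: signed_sets_def PiE_iff simp del: sgn3.simps)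
      have "{x\<in>\<Union>(range f). sgn3 x = s} = f s" for s
        using f by blast
      then show "(\<lambda>s\<in>UNIV. {x\<in>\<Union>(range f). sgn3 x = s}) = f" by auto
    qed
  qed auto
  then have "card (closed_sets B) = card (PiE UNIV (signed_sets B))"
    by (rule bij_betw_same_card)
  then show ?thesis by (simp add: card_PiE)
qed

fun swap13 :: "point \<Rightarrow> point" where "swap13 (i, j, k) = (k, j, i)"
fun swap23 :: "point \<Rightarrow> point" where "swap23 (i, j, k) = (i, k, j)"

lemma swap_inverse [simp]: "swap13 (swap13 p) = p" "swap23 (swap23 p) = p"
  by (cases p, simp)+

lemma bij_swap: "bij swap13" "bij swap23"
  by (auto intro: involuntory_imp_bij)

lemma inv_swap: "inv_into UNIV swap13 = swap13" "inv_into UNIV swap23 = swap23"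
  by (auto intro!: inv_unique_comp)

lemma card_signed_sets_image:
  assumes "bij \<pi>" "closed_sets (\<pi> ` B) = (`) (map_prod \<pi> \<pi>) ` closed_sets B"
    and "\<And>x. sgn3 (map_prod \<pi> \<pi> x) = s' \<longleftrightarrow> sgn3 x = s"
  shows "card (signed_sets (\<pi> ` B) s') = card (signed_sets B s)"
proof -
  have "(\<forall>y\<in>map_prod \<pi> \<pi> ` X. sgn3 y = s') \<longleftrightarrow> (\<forall>x\<in>X. sgn3 x = s)" for X
    by (simp only: ball_simps assms(3))
  then have "signed_sets (\<pi> ` B) s' = (`) (map_prod \<pi> \<pi>) ` signed_sets B s"
    unfolding signed_sets_def assms(2) by blast
  moreover have "inj (map_prod \<pi> \<pi>)"
    using assms(1) by (intro prod.inj_map) (auto simp: bij_def)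
  then have "inj ((`) (map_prod \<pi> \<pi>))"
    by (intro injI) (simp add: inj_image_eq_iff)
  ultimately show ?thesis by (simp add: card_image inj_on_subset)
qed

lemma card_signed_sets_swap:
  "card (signed_sets (swap13 ` B) (s3, s2, s1)) = card (signed_sets B (s1, s2, s3))"
  "card (signed_sets (swap23 ` B) (s1, s3, s2)) = card (signed_sets B (s1, s2, s3))"
proof -
  have conj: "swap13 \<circ> up1 \<circ> swap13 = up3" "swap13 \<circ> up2 \<circ> swap13 = up2" "swap13 \<circ> up3 \<circ> swap13 = up1"
    "swap23 \<circ> up1 \<circ> swap23 = up1" "swap23 \<circ> up2 \<circ> swap23 = up3" "swap23 \<circ> up3 \<circ> swap23 = up2"
    by auto
  have "closed_sets (swap13 ` B) = (`) (map_prod swap13 swap13) ` closed_sets B"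
    using closed_family_image[OF bij_swap(1), of "{up1, up2, up3}" B]
    by (simp add: inv_swap conj insert_commute)
  then show "card (signed_sets (swap13 ` B) (s3, s2, s1)) = card (signed_sets B (s1, s2, s3))"
    by (rule card_signed_sets_image[OF bij_swap(1)]) auto
  have "closed_sets (swap23 ` B) = (`) (map_prod swap23 swap23) ` closed_sets B"
    using closed_family_image[OF bij_swap(2), of "{up1, up2, up3}" B]
    by (simp add: inv_swap conj insert_commute)
  then show "card (signed_sets (swap23 ` B) (s1, s3, s2)) = card (signed_sets B (s1, s2, s3))"
    by (rule card_signed_sets_image[OF bij_swap(2)]) auto
qed

section \<open>Finite sets of standard monomials\<close>

locale finite_ideal_complement =
  fixes B :: "point set"
  assumes fin: "finite B"
    and down: "(i, j, k) \<in> B \<Longrightarrow> i' \<le> i \<Longrightarrow> j' \<le> j \<Longrightarrow> k' \<le> k \<Longrightarrow> (i', j', k') \<in> B"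
begin

lemma fin_section: "finite {k. (i, j, k) \<in> B}"
  by (rule finite_subset[OF _ finite_imageI[OF fin, of "\<lambda>(i, j, k). k"]]) force

lemma section_iff: "(i, j, k) \<in> B \<longleftrightarrow> k < (LEAST k. (i, j, k) \<notin> B)"
proof -
  have "\<exists>k. (i, j, k) \<notin> B" using fin_section[of i j] infinite_UNIV_nat
    by (metis (mono_tags, lifting) UNIV_eq_I mem_Collect_eq)
  then have "(i, j, LEAST k. (i, j, k) \<notin> B) \<notin> B" by (rule LeastI_ex)
  then show ?thesis using down[of i j k i j] not_less_Least[of k "\<lambda>k. (i, j, k) \<notin> B"] by (meson leI order_refl)
qed

lemma card_ppn_nnp:
  "card (signed_sets B (False, False, True)) = 2 ^ card B * card (signed_sets B (True, True, False))"
proof -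
  define h where "h i j = (LEAST k. (i, j, k) \<notin> B)" for i j
  have h: "(i, j, k) \<in> B \<longleftrightarrow> k < h i j" for i j k
    unfolding h_def by (rule section_iff)
  interpret staircase h
  proof
    fix i i' j j' :: nat assume "i \<le> i'" "j \<le> j'"
    then have "k < h i j" if "k < h i' j'" for k
      using that down unfolding h[symmetric] by blast
    then show "h i' j' \<le> h i j" by (meson leI less_irrefl)
  next
    have "{(i, j). 0 < h i j} \<subseteq> (\<lambda>(i, j, k). (i, j)) ` B"
      using h[of _ _ 0] by force
    then show "finite {(i, j). 0 < h i j}" using fin finite_subset by blast
  qed
  have "under = B" using h by (auto simp: under_def)
  with card_ppn_nnp show ?thesis by simp
qed

lemma closed_disjoint: "X \<in> closed_sets B \<Longrightarrow> (m, b) \<in> X \<Longrightarrow> m \<notin> B \<and> b \<in> B"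
  by (auto simp: closed_family_def)

lemma closed_down:
  assumes "X \<in> closed_sets B" "(i, j, k) \<notin> B"
  shows "((Suc i, j, k), (i', j', k')) \<in> X \<Longrightarrow> \<exists>l. i' = Suc l \<and> ((i, j, k), (l, j', k')) \<in> X"
    and "((i, Suc j, k), (i', j', k')) \<in> X \<Longrightarrow> \<exists>l. j' = Suc l \<and> ((i, j, k), (i', l, k')) \<in> X"
    and "((i, j, Suc k), (i', j', k')) \<in> X \<Longrightarrow> \<exists>l. k' = Suc l \<and> ((i, j, k), (i', j', l)) \<in> X"
  using assms closed_disjoint[OF assms(1)] unfolding closed_sets_iff
  by (metis Suc_pred')+

lemma closed_raise:
  assumes X: "X \<in> closed_sets B" and x: "((i, j, k), (i', j', k')) \<in> X"
  shows "(i' + t, j', k') \<in> B \<Longrightarrow> ((i + t, j, k), (i' + t, j', k')) \<in> X"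
    and "(i', j' + t, k') \<in> B \<Longrightarrow> ((i, j + t, k), (i', j' + t, k')) \<in> X"
    and "(i', j', k' + t) \<in> B \<Longrightarrow> ((i, j, k + t), (i', j', k' + t)) \<in> X"
proof -
  have m: "(i, j, k) \<notin> B" using closed_disjoint[OF X x] by simp
  show "(i' + t, j', k') \<in> B \<Longrightarrow> ((i + t, j, k), (i' + t, j', k')) \<in> X"
  proof (induction t)
    case (Suc t)
    then have "((i + t, j, k), (i' + t, j', k')) \<in> X" using down by auto
    moreover have "(i + t, j, k) \<notin> B" using m down by (meson le_add1 order_refl)
    ultimately show ?case using X Suc.prems unfolding closed_sets_iff by simp
  qed (use x in simp)
  show "(i', j' + t, k') \<in> B \<Longrightarrow> ((i, j + t, k), (i', j' + t, k')) \<in> X"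
  proof (induction t)
    case (Suc t)
    then have "((i, j + t, k), (i', j' + t, k')) \<in> X" using down by auto
    moreover have "(i, j + t, k) \<notin> B" using m down by (meson le_add1 order_refl)
    ultimately show ?case using X Suc.prems unfolding closed_sets_iff by simp
  qed (use x in simp)
  show "(i', j', k' + t) \<in> B \<Longrightarrow> ((i, j, k + t), (i', j', k' + t)) \<in> X"
  proof (induction t)
    case (Suc t)
    then have "((i, j, k + t), (i', j', k' + t)) \<in> X" using down by auto
    moreover have "(i, j, k + t) \<notin> B" using m down by (meson le_add1 order_refl)
    ultimately show ?case using X Suc.prems unfolding closed_sets_iff by simp
  qed (use x in simp)
qed

text \<open>Move up in direction 3 as far as possible; then a step down in direction 2 stays outside \<open>B\<close>, and
  this can be repeated forever.\<close>

lemma closed_no_descent: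
  assumes X: "X \<in> closed_sets B"
  shows "((i, j, k), (i', j', k')) \<in> X \<Longrightarrow> i' \<le> i \<Longrightarrow> j' < j \<Longrightarrow> k' < k \<Longrightarrow> False"
proof (induction j' arbitrary: j k k' rule: less_induct)
  case (less j')
  define K where "K = Max {k. (i', j', k) \<in> B}"
  have fin: "finite {k. (i', j', k) \<in> B}" by (rule fin_section)
  have b: "(i', j', k') \<in> B" using closed_disjoint[OF X less.prems(1)] by simp
  then have K: "(i', j', K) \<in> B" "k' \<le> K"
    using Max_in[OF fin] Max_ge[OF fin] by (auto simp: K_def)
  have "(i', j', Suc K) \<notin> B"
    using Max_ge[OF fin, of "Suc K"] by (auto simp: K_def)
  moreover obtain j0 where j: "j = Suc j0" using less.prems(3) by (cases j) auto
  moreover have "Suc K \<le> k + (K - k')" using less.prems(4) K(2) by simp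
  ultimately have "(i, j0, k + (K - k')) \<notin> B"
    using down[of i j0 "k + (K - k')" i' j' "Suc K"] less.prems(2,3) by auto
  moreover have "((i, Suc j0, k + (K - k')), (i', j', K)) \<in> X"
    using closed_raise(3)[OF X less.prems(1), of "K - k'"] K j by simp
  ultimately obtain l where l: "j' = Suc l" "((i, j0, k + (K - k')), (i', l, K)) \<in> X"
    using closed_down(2)[OF X] by blast
  show ?case
    by (rule less.IH[OF _ l(2)]) (use l less.prems j K in auto)
qed

text \<open>\<open>N\<close> exceeds the total degree of every standard monomial. If a source
  exponent exceeded the target exponent by more than \<open>N\<close>, it could be lowered inside
  the ideal more often than the target allows; so all sources lie in a box.\<close>

lemma closed_sets_bounded: "\<exists>S. finite S \<and> closed_sets B \<subseteq> Pow S"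
proof -
  define N where "N = Suc (Max ((\<lambda>(i, j, k). i + j + k) ` B))"
  have N: "i + j + k < N" if "(i, j, k) \<in> B" for i j k
    unfolding N_def using that fin by (auto simp: less_Suc_eq_le intro!: Max_ge image_eqI)
  have 1: "i \<le> N + i'" if X: "X \<in> closed_sets B" and x: "((i, j, k), (i', j', k')) \<in> X" for X i j k i' j' k'
  proof (rule ccontr)
    assume "\<not> i \<le> N + i'"
    then have "N + i' < i" by simp
    with x show False
    proof (induction i' arbitrary: i)
      case (0 i)
      then obtain i0 where i: "i = Suc i0" "N \<le> i0" by (cases i) auto
      then have "(i0, j, k) \<notin> B" using N[of i0 j k] by auto
      with closed_down(1)[OF X this] 0 i show False by blast
    next
      case (Suc i' i)
      then obtain i0 where i: "i = Suc i0" "N + i' < i0" by (cases i) auto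
      then have "(i0, j, k) \<notin> B" using N[of i0 j k] by auto
      with closed_down(1)[OF X this] Suc i show False by blast
    qed
  qed
  have 2: "j \<le> N + j'" if X: "X \<in> closed_sets B" and x: "((i, j, k), (i', j', k')) \<in> X" for X i j k i' j' k'
  proof (rule ccontr)
    assume "\<not> j \<le> N + j'"
    then have "N + j' < j" by simp
    with x show False
    proof (induction j' arbitrary: j)
      case (0 j)
      then obtain j0 where j: "j = Suc j0" "N \<le> j0" by (cases j) auto
      then have "(i, j0, k) \<notin> B" using N[of i j0 k] by auto
      with closed_down(2)[OF X this] 0 j show False by blast
    next
      case (Suc j' j)
      then obtain j0 where j: "j = Suc j0" "N + j' < j0" by (cases j) auto
      then have "(i, j0, k) \<notin> B" using N[of i j0 k] by auto
      with closed_down(2)[OF X this] Suc j show False by blast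
    qed
  qed
  have 3: "k \<le> N + k'" if X: "X \<in> closed_sets B" and x: "((i, j, k), (i', j', k')) \<in> X" for X i j k i' j' k'
  proof (rule ccontr)
    assume "\<not> k \<le> N + k'"
    then have "N + k' < k" by simp
    with x show False
    proof (induction k' arbitrary: k)
      case (0 k)
      then obtain k0 where k: "k = Suc k0" "N \<le> k0" by (cases k) auto
      then have "(i, j, k0) \<notin> B" using N[of i j k0] by auto
      with closed_down(3)[OF X this] 0 k show False by blast
    next
      case (Suc k' k)
      then obtain k0 where k: "k = Suc k0" "N + k' < k0" by (cases k) auto
      then have "(i, j, k0) \<notin> B" using N[of i j k0] by auto
      with closed_down(3)[OF X this] Suc k show False by blast
    qed
  qed
  have "closed_sets B \<subseteq> Pow (({..N + N} \<times> {..N + N} \<times> {..N + N}) \<times> B)"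
  proof (intro subsetI PowI)
    fix X x assume X: "X \<in> closed_sets B" and "x \<in> X"
    moreover obtain i j k i' j' k' where eq: "x = ((i, j, k), (i', j', k'))" by (metis prod.exhaust)
    ultimately have x: "((i, j, k), (i', j', k')) \<in> X" by simp
    then have b: "(i', j', k') \<in> B" using closed_disjoint[OF X] by blast
    show "x \<in> ({..N + N} \<times> {..N + N} \<times> {..N + N}) \<times> B"
      unfolding eq using b N[OF b] 1[OF X x] 2[OF X x] 3[OF X x] by auto
  qed
  moreover have "finite (({..N + N} \<times> {..N + N} \<times> {..N + N}) \<times> B)" using fin by simp
  ultimately show ?thesis by blast
qed

lemma finite_closed_sets: "finite (closed_sets B)"
  using closed_sets_bounded by (meson finite_Pow_iff finite_subset)

lemma finite_closed_set: "X \<in> closed_sets B \<Longrightarrow> finite X"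
  using closed_sets_bounded by (meson PowD finite_subset subsetD)

lemma signed_sets_nnn: "signed_sets B (True, True, True) = {{}}"
proof -
  have "X = {}" if X: "X \<in> closed_sets B" and s: "\<forall>x\<in>X. sgn3 x = (True, True, True)" for X
  proof (rule ccontr)
    assume "X \<noteq> {}"
    then obtain i j k i' j' k' where "((i, j, k), (i', j', k')) \<in> X" by (metis ex_in_conv prod.exhaust)
    with closed_no_descent[OF X this] s show False by auto
  qed
  then show ?thesis by (auto simp: signed_sets_def)
qed

lemma signed_sets_ppp: "signed_sets B (False, False, False) = {{}}"
proof -
  have "X = {}" if X: "X \<in> closed_sets B" and s: "\<forall>x\<in>X. sgn3 x = (False, False, False)" for X
  proof (rule ccontr)
    assume "X \<noteq> {}"
    then obtain i j k i' j' k' where x: "((i, j, k), (i', j', k')) \<in> X" by (metis ex_in_conv prod.exhaust)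
    with closed_disjoint[OF X x] s down[of i' j' k' i j k] show False by force
  qed
  then show ?thesis by (auto simp: signed_sets_def)
qed

end

lemma swap_finite_ideal_complement:
  assumes "finite_ideal_complement B"
  shows "finite_ideal_complement (swap13 ` B)" "finite_ideal_complement (swap23 ` B)"
proof -
  interpret finite_ideal_complement B by fact
  show "finite_ideal_complement (swap13 ` B)"
  proof
    fix i j k i' j' k' :: nat
    assume "(i, j, k) \<in> swap13 ` B" "i' \<le> i" "j' \<le> j" "k' \<le> k"
    then have "(k', j', i') \<in> B" using down by fastforce
    then show "(i', j', k') \<in> swap13 ` B" by (rule rev_image_eqI) simp
  qed (simp add: fin)
  show "finite_ideal_complement (swap23 ` B)"
  proof
    fix i j k i' j' k' :: nat
    assume "(i, j, k) \<in> swap23 ` B" "i' \<le> i" "j' \<le> j" "k' \<le> k"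
    then have "(i', k', j') \<in> B" using down by fastforce
    then show "(i', j', k') \<in> swap23 ` B" by (rule rev_image_eqI) simp
  qed (simp add: fin)
qed

context finite_ideal_complement
begin

lemma card_npp_pnn:
  "card (signed_sets B (True, False, False)) = 2 ^ card B * card (signed_sets B (False, True, True))"
proof -
  interpret S: finite_ideal_complement "swap13 ` B"
    using swap_finite_ideal_complement(1)[OF finite_ideal_complement_axioms] .
  have "card (swap13 ` B) = card B"
    using bij_swap(1) by (auto intro!: card_image simp: bij_def inj_on_def)
  then show ?thesis
    using S.card_ppn_nnp card_signed_sets_swap(1)[of B False False True] card_signed_sets_swap(1)[of B True True False]
    by simp
qed

lemma card_pnp_npn:
  "card (signed_sets B (False, True, False)) = 2 ^ card B * card (signed_sets B (True, False, True))"
proof -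
  interpret S: finite_ideal_complement "swap23 ` B"
    using swap_finite_ideal_complement(2)[OF finite_ideal_complement_axioms] .
  have "card (swap23 ` B) = card B"
    using bij_swap(2) by (auto intro!: card_image simp: bij_def inj_on_def)
  then show ?thesis
    using S.card_ppn_nnp card_signed_sets_swap(2)[of B False False True] card_signed_sets_swap(2)[of B True True False]
    by simp
qed

theorem card_closed_sets:
  "card (closed_sets B) = 2 ^ (3 * card B) * (card (signed_sets B (True, True, False)) *
     card (signed_sets B (True, False, True)) * card (signed_sets B (False, True, True)))\<^sup>2"
proof -
  have univ: "(UNIV :: (bool \<times> bool \<times> bool) set) = {(False, False, False), (False, False, True), (False, True, False),
      (False, True, True), (True, False, False), (True, False, True), (True, True, False), (True, True, True)}"
    by (auto simp: UNIV_bool simp flip: UNIV_Times_UNIV)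
  have "card (closed_sets B) = (2 ^ card B) ^ 3 * (card (signed_sets B (True, True, False)) *
     card (signed_sets B (True, False, True)) * card (signed_sets B (False, True, True)))\<^sup>2"
    unfolding card_closed_sets_prod univ
    by (simp add: signed_sets_nnn signed_sets_ppp card_ppn_nnp card_npp_pnn card_pnp_npn
        power2_eq_square power3_eq_cube mult_ac)
  then show ?thesis by (simp add: power_mult mult.commute flip: power_mult)
qed

end

section \<open>Strongly stable ideals in three variables\<close>

context finite_ideal_complement
begin

definition chain :: "point \<Rightarrow> point \<Rightarrow> nat \<Rightarrow> (point \<times> point) set" where
  "chain m b T = {((fst m, fst (snd m), snd (snd m) + t), (fst b, fst (snd b), snd (snd b) + t)) | t. t \<le> T}"

text \<open>A segment is closed by itself if it can be neither entered nor left. The source has no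
  predecessor in the ideal outside the segment; sideways this is checked at the top, which implies
  it below. The target cannot be raised out of the segment within \<open>B\<close>; sideways this is
  checked at the lowest point, which implies it above.\<close>

lemma chain_in_signed_sets:
  assumes m: "(i, j, k) \<notin> B" "k = 0 \<or> (i, j, k - 1) \<in> B"
      "i = 0 \<or> (i - 1, j, k + T) \<in> B" "j = 0 \<or> (i, j - 1, k + T) \<in> B"
    and b: "(i', j', k' + T) \<in> B" "(i', j', Suc (k' + T)) \<notin> B" "(Suc i', j', k') \<notin> B" "(i', Suc j', k') \<notin> B"
  shows "chain (i, j, k) (i', j', k') T \<in> signed_sets B (sgn3 ((i, j, k), (i', j', k')))"
proof -
  define X where "X = chain (i, j, k) (i', j', k') T"
  have mem: "((x, y, z), (x', y', z')) \<in> X \<longleftrightarrow>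
      x = i \<and> y = j \<and> x' = i' \<and> y' = j' \<and> (\<exists>t\<le>T. z = k + t \<and> z' = k' + t)" for x y z x' y' z'
    by (auto simp: X_def chain_def)
  have sub: "X \<subseteq> (- B) \<times> B"
  proof
    fix p assume "p \<in> X"
    then obtain t where "p = ((i, j, k + t), (i', j', k' + t))" "t \<le> T"
      unfolding X_def chain_def by auto
    then show "p \<in> (- B) \<times> B"
      using m(1) b(1) down[of i j "k + t" i j k] down[of i' j' "k' + T" i' j' "k' + t"] by auto
  qed
  have 1: "((Suc x, y, z), (x', y', z')) \<in> X \<longleftrightarrow> 0 < x' \<and> ((x, y, z), (x' - 1, y', z')) \<in> X"
    if "(x, y, z) \<notin> B" "(x', y', z') \<in> B" for x y z x' y' z'
  proof -
    have "((Suc x, y, z), (x', y', z')) \<notin> X"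
    proof
      assume "((Suc x, y, z), (x', y', z')) \<in> X"
      then obtain t where "Suc x = i" "y = j" "t \<le> T" "z = k + t" unfolding mem by auto
      with m(3) down[of x j "k + T" x j z] that(1) show False by auto
    qed
    moreover have "\<not> (0 < x' \<and> ((x, y, z), (x' - 1, y', z')) \<in> X)"
    proof
      assume "0 < x' \<and> ((x, y, z), (x' - 1, y', z')) \<in> X"
      then obtain t where "x' = Suc i'" "y' = j'" "z' = k' + t" unfolding mem by auto
      with b(3) down[of x' y' z' "Suc i'" j' k'] that(2) show False by auto
    qed
    ultimately show ?thesis by simp
  qed
  have 2: "((x, Suc y, z), (x', y', z')) \<in> X \<longleftrightarrow> 0 < y' \<and> ((x, y, z), (x', y' - 1, z')) \<in> X"
    if "(x, y, z) \<notin> B" "(x', y', z') \<in> B" for x y z x' y' z'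
  proof -
    have "((x, Suc y, z), (x', y', z')) \<notin> X"
    proof
      assume "((x, Suc y, z), (x', y', z')) \<in> X"
      then obtain t where "x = i" "Suc y = j" "t \<le> T" "z = k + t" unfolding mem by auto
      with m(4) down[of i y "k + T" i y z] that(1) show False by auto
    qed
    moreover have "\<not> (0 < y' \<and> ((x, y, z), (x', y' - 1, z')) \<in> X)"
    proof
      assume "0 < y' \<and> ((x, y, z), (x', y' - 1, z')) \<in> X"
      then obtain t where "x' = i'" "y' = Suc j'" "z' = k' + t" unfolding mem by auto
      with b(4) down[of x' y' z' i' "Suc j'" k'] that(2) show False by auto
    qed
    ultimately show ?thesis by simp
  qed
  have 3: "((x, y, Suc z), (x', y', z')) \<in> X \<longleftrightarrow> 0 < z' \<and> ((x, y, z), (x', y', z' - 1)) \<in> X"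
    if B: "(x, y, z) \<notin> B" "(x', y', z') \<in> B" for x y z x' y' z'
  proof
    assume "((x, y, Suc z), (x', y', z')) \<in> X"
    then obtain t where t: "x = i" "y = j" "x' = i'" "y' = j'" "t \<le> T" "Suc z = k + t" "z' = k' + t"
      unfolding mem by auto
    have "t \<noteq> 0"
    proof
      assume "t = 0"
      then have "z = k - 1" "k \<noteq> 0" using t(6) by auto
      then show False using m(2) B(1) t(1,2) by simp
    qed
    then obtain s where "t = Suc s" by (cases t) auto
    with t show "0 < z' \<and> ((x, y, z), (x', y', z' - 1)) \<in> X"
      unfolding mem by (auto intro!: exI[of _ s])
  next
    assume "0 < z' \<and> ((x, y, z), (x', y', z' - 1)) \<in> X"
    then obtain t where t: "x = i" "y = j" "x' = i'" "y' = j'" "t \<le> T" "z = k + t" "z' = Suc (k' + t)"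
      unfolding mem by (auto simp: Suc_diff_1)
    moreover have "t \<noteq> T" using b(2) B(2) t by auto
    ultimately show "((x, y, Suc z), (x', y', z')) \<in> X"
      unfolding mem by (auto intro!: exI[of _ "Suc t"])
  qed
  have "sgn3 x = sgn3 ((i, j, k), (i', j', k'))" if "x \<in> X" for x
    using that by (auto simp: X_def chain_def)
  with sub 1 2 3 have "X \<in> signed_sets B (sgn3 ((i, j, k), (i', j', k')))"
    unfolding signed_sets_def closed_sets_iff by simp
  then show ?thesis unfolding X_def .
qed

lemma chain_start: "(m, b) \<in> chain m b T"
  by (cases m; cases b) (auto simp: chain_def)

lemma finite_signed_sets: "finite (signed_sets B s)"
  by (rule finite_subset[OF _ finite_closed_sets]) (auto simp: signed_sets_def)

lemma empty_in_signed_sets: "{} \<in> signed_sets B s"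
  by (auto simp: signed_sets_def)

lemma card_signed_sets_ge_2:
  assumes "X \<in> signed_sets B s" "X \<noteq> {}"
  shows "2 \<le> card (signed_sets B s)"
  using card_mono[OF finite_signed_sets, of "{{}, X}" s] assms empty_in_signed_sets[of s] by auto

lemma card_signed_sets_ge_3:
  assumes "X \<in> signed_sets B s" "Y \<in> signed_sets B s" "X \<noteq> {}" "Y \<noteq> {}" "X \<noteq> Y"
  shows "3 \<le> card (signed_sets B s)"
  using card_mono[OF finite_signed_sets, of "{{}, X, Y}" s] assms empty_in_signed_sets[of s] by auto

definition minimal :: "point \<Rightarrow> bool" where
  "minimal m \<longleftrightarrow> (case m of (i, j, k) \<Rightarrow>
     (i = 0 \<or> (i - 1, j, k) \<in> B) \<and> (j = 0 \<or> (i, j - 1, k) \<in> B) \<and> (k = 0 \<or> (i, j, k - 1) \<in> B))"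

text \<open>Induction on the degree of the source: if it is not minimal, it can be divided by some
  variable inside the ideal, and membership in \<open>X\<close> and in \<open>Y\<close> is decided
  one step lower.\<close>

lemma closed_subset_minimal:
  assumes X: "X \<in> closed_sets B" and Y: "Y \<in> closed_sets B"
    and min: "\<And>m b. (m, b) \<in> X \<Longrightarrow> minimal m \<Longrightarrow> (m, b) \<in> Y"
  shows "X \<subseteq> Y"
proof -
  have "((i, j, k), b) \<in> Y" if "((i, j, k), b) \<in> X" for i j k b
    using that
  proof (induction "i + j + k" arbitrary: i j k b rule: less_induct)
    case less
    obtain i' j' k' where b: "b = (i', j', k')" by (cases b)
    have bB: "b \<in> B" using closed_disjoint[OF X less.prems] by simp
    consider "minimal (i, j, k)" | l where "i = Suc l" "(l, j, k) \<notin> B" | l where "j = Suc l" "(i, l, k) \<notin> B"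
      | l where "k = Suc l" "(i, j, l) \<notin> B"
      unfolding minimal_def by (cases i; cases j; cases k) auto
    then show ?case
    proof cases
      case 1
      then show ?thesis using min less.prems by auto
    next
      case (2 l)
      then obtain l' where l': "i' = Suc l'" "((l, j, k), (l', j', k')) \<in> X"
        using closed_down(1)[OF X 2(2)] less.prems b by blast
      then have "((l, j, k), (l', j', k')) \<in> Y" using less.hyps 2(1) by simp
      then show ?thesis using Y 2 l' bB b unfolding closed_sets_iff by simp
    next
      case (3 l)
      then obtain l' where l': "j' = Suc l'" "((i, l, k), (i', l', k')) \<in> X"
        using closed_down(2)[OF X 3(2)] less.prems b by blast
      then have "((i, l, k), (i', l', k')) \<in> Y" using less.hyps 3(1) by simp
      then show ?thesis using Y 3 l' bB b unfolding closed_sets_iff by simp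
    next
      case (4 l)
      then obtain l' where l': "k' = Suc l'" "((i, j, l), (i', j', l')) \<in> X"
        using closed_down(3)[OF X 4(2)] less.prems b by blast
      then have "((i, j, l), (i', j', l')) \<in> Y" using less.hyps 4(1) by simp
      then show ?thesis using Y 4 l' bB b unfolding closed_sets_iff by simp
    qed
  qed
  then show ?thesis by auto
qed

text \<open>If \<open>x\<close> is the only possible pair over a minimal generator, every nonempty
  member contains \<open>x\<close>, and then any two nonempty members contain each other.\<close>

lemma card_signed_sets_le_2:
  assumes "\<And>X m b. X \<in> signed_sets B s \<Longrightarrow> (m, b) \<in> X \<Longrightarrow> minimal m \<Longrightarrow> (m, b) = x"
  shows "card (signed_sets B s) \<le> 2"
proof -
  have closed: "X \<in> closed_sets B" if "X \<in> signed_sets B s" for X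
    using that by (simp add: signed_sets_def)
  have x: "x \<in> X" if X: "X \<in> signed_sets B s" "X \<noteq> {}" for X
  proof (rule ccontr)
    assume "x \<notin> X"
    then have "X \<subseteq> {}"
      using assms[OF X(1)] by (intro closed_subset_minimal[OF closed[OF X(1)] closed_family_empty]) auto
    with X(2) show False by simp
  qed
  have "X = Y" if X: "X \<in> signed_sets B s" "X \<noteq> {}" and Y: "Y \<in> signed_sets B s" "Y \<noteq> {}" for X Y
  proof (rule equalityI)
    show "X \<subseteq> Y"
      using assms[OF X(1)] x[OF Y] by (intro closed_subset_minimal closed X Y) auto
    show "Y \<subseteq> X"
      using assms[OF Y(1)] x[OF X] by (intro closed_subset_minimal closed X Y) auto
  qed
  then have "signed_sets B s \<subseteq> {{}, X}" if "X \<in> signed_sets B s" "X \<noteq> {}" for X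
    using that by blast
  then consider "signed_sets B s \<subseteq> {{}}" | X where "signed_sets B s \<subseteq> {{}, X}" by blast
  then show ?thesis
  proof cases
    case 1
    then show ?thesis using card_mono[of "{{}}" "signed_sets B s"] by simp
  next
    case (2 X)
    have "card (signed_sets B s) \<le> card {{}, X}" using 2 by (intro card_mono) auto
    also have "\<dots> \<le> 2" by (rule card_insert_le_m1) auto
    finally show ?thesis .
  qed
qed

end

definition J_complement :: "nat \<Rightarrow> nat \<Rightarrow> nat \<Rightarrow> point set" where
  "J_complement a b c = {(0, 0, k) | k. k \<le> c} \<union> {(0, 1, k) | k. k < b} \<union> {(1, 0, k) | k. k < a}"

lemma J_complement_iff:
  "(i, j, k) \<in> J_complement a b c \<longleftrightarrow>
    i = 0 \<and> j = 0 \<and> k \<le> c \<or> i = 0 \<and> j = 1 \<and> k < b \<or> i = 1 \<and> j = 0 \<and> k < a"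
  by (auto simp: J_complement_def)

text \<open>The exchanges are required for all monomials, not only for generators, and for
  neighbouring variables; exchanging \<open>z\<close> for \<open>x\<close> is the composite of the
  two.\<close>

locale strongly_stable_complement = finite_ideal_complement +
  assumes stable12: "(i, Suc j, k) \<notin> B \<Longrightarrow> (Suc i, j, k) \<notin> B"
    and stable23: "(i, j, Suc k) \<notin> B \<Longrightarrow> (i, Suc j, k) \<notin> B"
begin

definition h :: "nat \<Rightarrow> nat \<Rightarrow> nat" where
  "h i j = (LEAST k. (i, j, k) \<notin> B)"

lemma mem_iff: "(i, j, k) \<in> B \<longleftrightarrow> k < h i j"
  unfolding h_def by (rule section_iff)

lemma h_mono: "i \<le> i' \<Longrightarrow> j \<le> j' \<Longrightarrow> h i' j' \<le> h i j"
  using down[of i' j' "h i j" i j "h i j"] mem_iff by (meson leI less_irrefl order_refl)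

lemma h12: "h (Suc i) j \<le> h i (Suc j)"
  using stable12[of i j "h i (Suc j)"] mem_iff by (meson leI less_irrefl)

text \<open>In the column bottom over \<open>(i, j)\<close> one factor \<open>z\<close> can be
  exchanged for \<open>y\<close>, which gives a point outside \<open>B\<close> over
  \<open>(i, Suc j)\<close> that is one lower.\<close>

lemma h23: "0 < h i j \<Longrightarrow> h i (Suc j) < h i j"
  using stable23[of i j "h i j - 1"] mem_iff by (metis Suc_pred' less_irrefl not_less_eq)

lemma chain_signed:
  assumes "h i j \<le> k" "k = 0 \<or> k = h i j" "k' < h i' j'" "T = h i' j' - 1 - k'" "h (Suc i') j' \<le> k'" "h i' (Suc j') \<le> k'"
    and "i = 0 \<or> k + T < h (i - 1) j" "j = 0 \<or> k + T < h i (j - 1)"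
    and "sgn3 ((i, j, k), (i', j', k')) = s"
  shows "chain (i, j, k) (i', j', k') T \<in> signed_sets B s"
  unfolding assms(9)[symmetric]
  by (rule chain_in_signed_sets) (use assms in \<open>auto simp: mem_iff not_less\<close>)

text \<open>If \<open>x\<close> is in the ideal, a minimal source is \<open>x\<close> itself or has
  \<open>i = 0\<close>. For \<open>x\<close> only one component of the degree can be negative; for
  \<open>i = 0\<close> the negative ones would be the last two, which
  \<open>closed_no_descent\<close> excludes because targets also have first exponent 0.\<close>

lemma planar_card:
  assumes "h 1 0 = 0"
  shows "card (signed_sets B (True, True, False)) = 1" "card (signed_sets B (True, False, True)) = 1"
    "card (signed_sets B (False, True, True)) = 1"
proof -
  have B0: "i = 0" if "(i, j, k) \<in> B" for i j k
    using that h_mono[of 1 i 0 j] assms by (cases i) (auto simp: mem_iff)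
  have min: "False" if X: "X \<in> closed_sets B" and x: "(m, b) \<in> X" and sg: "\<And>x. x \<in> X \<Longrightarrow> sgn3 x = s"
    and s: "s \<in> {(True, True, False), (True, False, True), (False, True, True)}" and min: "minimal m" for X m b s
  proof -
    obtain i j k i' j' k' where eq: "m = (i, j, k)" "b = (i', j', k')" by (cases m; cases b)
    note x = x[unfolded eq]
    have i': "i' = 0" using closed_disjoint[OF X x] B0 by auto
    show False
    proof (cases "i = 0")
      case True
      then have "s = (False, True, True)" using sg[OF x] s by auto
      then show False using closed_no_descent[OF X x] sg[OF x] i' by auto
    next
      case False
      then have "(j = 0 \<or> (i, j - 1, k) \<in> B) \<and> (k = 0 \<or> (i, j, k - 1) \<in> B)"
        using min eq by (auto simp: minimal_def)
      then have "j = 0" "k = 0" using False B0 by auto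
      then show False using sg[OF x] s by auto
    qed
  qed
  have "signed_sets B s = {{}}" if s: "s \<in> {(True, True, False), (True, False, True), (False, True, True)}" for s
  proof -
    have "X = {}" if X: "X \<in> closed_sets B" "\<forall>x\<in>X. sgn3 x = s" for X
    proof -
      have "X \<subseteq> {}"
      proof (rule closed_subset_minimal[OF X(1) closed_family_empty])
        fix m b assume x: "(m, b) \<in> X" "minimal m"
        have False by (rule min[OF X(1) x(1) _ s x(2)]) (use X(2) in blast)
        then show "(m, b) \<in> {}" ..
      qed
      then show ?thesis by simp
    qed
    then show ?thesis by (auto simp: signed_sets_def)
  qed
  then show "card (signed_sets B (True, True, False)) = 1" "card (signed_sets B (True, False, True)) = 1"
    "card (signed_sets B (False, True, True)) = 1"
    by simp_all
qed

section \<open>Nonempty closed sets when \<open>x\<close> is not in the ideal\<close>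

context
  assumes pos: "0 < h 1 0"
begin

lemma h_order: "0 < h 0 1" "h 1 0 \<le> h 0 1" "h 0 1 < h 0 0"
  using pos h12[of 0 0] h_mono[of 0 0 0 1] h23[of 0 0] by auto

lemma section_vanishes: "\<exists>j. h i j = 0"
proof (rule ccontr)
  assume "\<nexists>j. h i j = 0"
  then have "range (\<lambda>j. (i, j, 0)) \<subseteq> B" by (auto simp: mem_iff)
  then have "finite (range (\<lambda>j::nat. (i, j, 0::nat)))" by (rule finite_subset[OF _ fin])
  moreover have "inj (\<lambda>j::nat. (i, j, 0::nat))" by (simp add: inj_on_def)
  ultimately show False using finite_imageD by fastforce
qed

text \<open>The source is the minimal generator \<open>x y^j\<close>; the target is the highest
  standard power of \<open>z\<close>, which every variable moves into the ideal since
  \<open>h 1 0\<close> and \<open>h 0 1\<close> are smaller than \<open>h 0 0\<close>.\<close>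

lemma nnp_exists:
  obtains j where "h 1 j = 0" "chain (1, j, 0) (0, 0, h 0 0 - 1) 0 \<in> signed_sets B (True, True, False)"
proof -
  define j where "j = (LEAST j. h 1 j = 0)"
  have j: "h 1 j = 0" unfolding j_def using section_vanishes by (rule LeastI_ex)
  have least: "j \<le> j'" if "h 1 j' = 0" for j' unfolding j_def using that by (rule Least_le)
  have "0 < j" using j pos by (cases j) auto
  moreover have h1: "0 < h 1 (j - 1)" using least[of "j - 1"] \<open>0 < j\<close> by (cases "h 1 (j - 1) = 0") auto
  moreover have "0 < h 0 j" using h12[of 0 "j - 1"] h1 \<open>0 < j\<close> by simp
  ultimately show ?thesis
    using j h_order by (intro that[of j] chain_signed) auto
qed

text \<open>The target \<open>x z^(h 1 0 - 1)\<close> is moved into the ideal by every variable,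
  because \<open>h 2 0 \<le> h 1 1 < h 1 0\<close>.\<close>

lemma pnn_exists: "chain (0, 1, h 0 1) (1, 0, h 1 0 - 1) 0 \<in> signed_sets B (False, True, True)"
  using pos h_order h23[of 1 0] h12[of 1 0] by (intro chain_signed) (auto simp: numeral_2_eq_2)

lemma npn_exists:
  obtains r k T where "0 < r" "h 0 (Suc r) = 0"
    "chain (1, 0, h 1 0) (0, r, k) T \<in> signed_sets B (True, False, True)"
proof -
  define l where "l = (LEAST j. h 0 j = 0)"
  define r where "r = l - 1"
  have z: "h 0 l = 0" unfolding l_def using section_vanishes by (rule LeastI_ex)
  have ne: "l \<noteq> 0" "l \<noteq> 1" using z h_order by (intro notI; simp)+
  have r: "0 < r" "h 0 (Suc r) = 0" using z ne by (auto simp: r_def)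
  have "r < l" using ne by (auto simp: r_def)
  then have "0 < h 0 r" using not_less_Least[of r "\<lambda>j. h 0 j = 0"] by (auto simp: l_def)
  moreover have "h 1 r = 0" using h12[of 0 r] r by simp
  moreover have "h 0 r \<le> h 0 1" using r by (intro h_mono) auto
  \<comment> \<open>The target exponent must stay below \<open>h 1 0\<close> for the third sign and
    below \<open>h 0 r\<close> to be standard, whence the minimum. The chain runs to the top of the
    target column; meanwhile the source climbs to at most \<open>h 0 1\<close>, which is below
    \<open>h 0 0\<close>, so that it cannot be divided by \<open>x\<close> inside the ideal.\<close>
  ultimately show ?thesis
    using r h_order pos
    by (intro that[of r "min (h 1 0) (h 0 r) - 1" "h 0 r - 1 - (min (h 1 0) (h 0 r) - 1)"] chain_signed)
      (auto simp: min_def)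
qed

lemma cards_ge_2:
  "2 \<le> card (signed_sets B (True, True, False))" "2 \<le> card (signed_sets B (True, False, True))"
  "2 \<le> card (signed_sets B (False, True, True))"
proof -
  show "2 \<le> card (signed_sets B (True, True, False))"
    by (rule nnp_exists, rule card_signed_sets_ge_2, assumption) (use chain_start in blast)
  show "2 \<le> card (signed_sets B (True, False, True))"
    by (rule npn_exists, rule card_signed_sets_ge_2, assumption) (use chain_start in blast)
  show "2 \<le> card (signed_sets B (False, True, True))"
    by (rule card_signed_sets_ge_2[OF pnn_exists]) (use chain_start in blast)
qed

text \<open>A second generator, \<open>x y z^(h 1 1)\<close>, can be sent to the target of
  \<open>nnp_exists\<close>. It is minimal because \<open>h 1 1\<close> is less than both
  \<open>h 0 1\<close> and \<open>h 1 0\<close>.\<close>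

lemma extra_if_xy:
  assumes "0 < h 1 1"
  shows "3 \<le> card (signed_sets B (True, True, False))"
proof -
  obtain j where j: "h 1 j = 0" "chain (1, j, 0) (0, 0, h 0 0 - 1) 0 \<in> signed_sets B (True, True, False)"
    using nnp_exists by metis
  have "h 1 1 < h 0 1"
    using h12[of 0 1] h23[of 0 1] h_order by (auto simp: numeral_2_eq_2)
  moreover have "h 1 1 < h 1 0" using h23[of 1 0] pos by simp
  ultimately have "chain (1, 1, h 1 1) (0, 0, h 0 0 - 1) 0 \<in> signed_sets B (True, True, False)"
    using h_order by (intro chain_signed) auto
  then show ?thesis
  proof (rule card_signed_sets_ge_3[OF j(2)])
    show "chain (1, j, 0) (0, 0, h 0 0 - 1) 0 \<noteq> chain (1, 1, h 1 1) (0, 0, h 0 0 - 1) 0"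
      using j(1) assms by (auto simp: chain_def)
  qed (use chain_start in blast)+
qed

text \<open>The generator \<open>y^2 z^(h 0 2)\<close> can be sent to the target of
  \<open>pnn_exists\<close> if this makes the third sign negative, that is, if
  \<open>h 1 0 \<le> h 0 2\<close>. Otherwise \<open>y\<close> moves \<open>y z^(h 1 0 - 1)\<close>
  into the ideal, so that this is a second target for \<open>x z^(h 1 0)\<close>.\<close>

lemma extra_if_yy:
  assumes "h 1 1 = 0" "0 < h 0 2"
  shows "3 \<le> card (signed_sets B (False, True, True)) \<or> 3 \<le> card (signed_sets B (True, False, True))"
proof (cases "h 1 0 \<le> h 0 2")
  case True
  have "h 2 0 \<le> h 1 1" using h12[of 1 0] by (simp add: numeral_2_eq_2)
  moreover have "h 0 2 < h 0 1" using h23[of 0 1] h_order by (simp add: numeral_2_eq_2)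
  ultimately have "chain (0, 2, h 0 2) (1, 0, h 1 0 - 1) 0 \<in> signed_sets B (False, True, True)"
    using assms True pos by (intro chain_signed) (auto simp: numeral_2_eq_2)
  then have "3 \<le> card (signed_sets B (False, True, True))"
  proof (rule card_signed_sets_ge_3[OF pnn_exists])
    show "chain (0, 1, h 0 1) (1, 0, h 1 0 - 1) 0 \<noteq> chain (0, 2, h 0 2) (1, 0, h 1 0 - 1) 0"
      by (auto simp: chain_def)
  qed (use chain_start in blast)+
  then show ?thesis ..
next
  case False
  obtain r k T where r: "h 0 (Suc r) = 0" "0 < r" "chain (1, 0, h 1 0) (0, r, k) T \<in> signed_sets B (True, False, True)"
    using npn_exists by metis
  have "r \<noteq> 1" using r assms by (auto simp: numeral_2_eq_2)
  have "chain (1, 0, h 1 0) (0, 1, h 1 0 - 1) (h 0 1 - 1 - (h 1 0 - 1)) \<in> signed_sets B (True, False, True)"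
    using False assms h_order pos by (intro chain_signed) (auto simp: numeral_2_eq_2)
  then have "3 \<le> card (signed_sets B (True, False, True))"
  proof (rule card_signed_sets_ge_3[OF r(3)])
    show "chain (1, 0, h 1 0) (0, r, k) T \<noteq>
        chain (1, 0, h 1 0) (0, 1, h 1 0 - 1) (h 0 1 - 1 - (h 1 0 - 1))"
      (is "_ \<noteq> ?Y")
    proof
      assume "chain (1, 0, h 1 0) (0, r, k) T = ?Y"
      with chain_start[of "(1, 0, h 1 0)" "(0, r, k)" T] have "((1, 0, h 1 0), (0, r, k)) \<in> ?Y" by simp
      with \<open>r \<noteq> 1\<close> show False by (auto simp: chain_def)
    qed
  qed (use chain_start in blast)+
  then show ?thesis ..
qed

text \<open>The inequalities give just the room for a chain one step longer than that of
  \<open>pnn_exists\<close>: its target starts one lower and its source climbs one higher. For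
  \<open>J a b c\<close> they read \<open>2 \<le> a\<close> and \<open>b < c\<close>.\<close>

lemma extra_if_middle:
  assumes "h 1 1 = 0" "2 \<le> h 1 0" "Suc (h 0 1) < h 0 0"
  shows "3 \<le> card (signed_sets B (False, True, True))"
proof -
  have "h 2 0 \<le> h 1 1" using h12[of 1 0] by (simp add: numeral_2_eq_2)
  then have "chain (0, 1, h 0 1) (1, 0, h 1 0 - 2) 1 \<in> signed_sets B (False, True, True)"
    using assms h_order by (intro chain_signed) (auto simp: numeral_2_eq_2)
  then show ?thesis
  proof (rule card_signed_sets_ge_3[OF pnn_exists])
    show "chain (0, 1, h 0 1) (1, 0, h 1 0 - 1) 0 \<noteq> chain (0, 1, h 0 1) (1, 0, h 1 0 - 2) 1"
      (is "_ \<noteq> ?Y")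
    proof
      assume "chain (0, 1, h 0 1) (1, 0, h 1 0 - 1) 0 = ?Y"
      with chain_start[of "(0, 1, h 0 1)" "(1, 0, h 1 0 - 1)" 0]
      have "((0, 1, h 0 1), (1, 0, h 1 0 - 1)) \<in> ?Y" by simp
      with assms(2) show False by (auto simp: chain_def)
    qed
  qed (use chain_start in blast)+
qed

lemma complement_eq_J:
  assumes "h 1 1 = 0" "h 0 2 = 0"
  shows "B = J_complement (h 1 0) (h 0 1) (h 0 0 - 1)"
proof -
  have z: "h i j = 0" if "2 \<le> i + j" for i j
  proof -
    have "h 2 0 = 0" using h12[of 1 0] assms by (simp add: numeral_2_eq_2)
    moreover have "2 \<le> i \<or> 1 \<le> i \<and> 1 \<le> j \<or> 2 \<le> j" using that by arith
    ultimately show ?thesis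
      using h_mono[of 2 i 0 j] h_mono[of 1 i 1 j] h_mono[of 0 i 2 j] assms by auto
  qed
  have "(i, j, k) \<in> B \<longleftrightarrow> (i, j, k) \<in> J_complement (h 1 0) (h 0 1) (h 0 0 - 1)" for i j k
  proof (cases "2 \<le> i + j")
    case True
    then show ?thesis using z[OF True] by (auto simp: mem_iff J_complement_iff)
  next
    case False
    then consider "i = 0" "j = 0" | "i = 0" "j = 1" | "i = 1" "j = 0" by linarith
    then show ?thesis using h_order by cases (auto simp: mem_iff J_complement_iff)
  qed
  then show ?thesis by auto
qed

end

text \<open>The signs leave one minimal generator as source in each pattern: \<open>x y\<close>,
  \<open>x z^a\<close> and \<open>y z^b\<close>. Multiplying source and target by variables leads to
  a source that can be divided by another variable inside the ideal, which the target lacks. This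
  bounds the exponent \<open>k'\<close> of the target from below.\<close>

lemma J_cards_le_2:
  assumes J: "B = J_complement a b c" and abc: "1 \<le> a" "a \<le> b" "b \<le> c" "a = 1 \<or> b = c"
  shows "card (signed_sets B (True, True, False)) \<le> 2" "card (signed_sets B (True, False, True)) \<le> 2"
    "card (signed_sets B (False, True, True)) \<le> 2"
proof -
  have mem: "(i, j, k) \<in> B \<longleftrightarrow> i = 0 \<and> j = 0 \<and> k \<le> c \<or> i = 0 \<and> j = 1 \<and> k < b \<or> i = 1 \<and> j = 0 \<and> k < a" for i j k
    unfolding J by (rule J_complement_iff)
  show "card (signed_sets B (True, True, False)) \<le> 2"
  proof (rule card_signed_sets_le_2)
    fix X m p assume X': "X \<in> signed_sets B (True, True, False)" and x': "(m, p) \<in> X" and "minimal m"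
    obtain i j k i' j' k' where eq: "m = (i, j, k)" "p = (i', j', k')" by (cases m; cases p)
    have X: "X \<in> closed_sets B" and sg: "i' < i" "j' < j" "k \<le> k'"
      using X' x' eq by (auto simp: signed_sets_def)
    have m: "i = 1" "j = 1" "k = 0" using \<open>minimal m\<close> sg unfolding eq minimal_def by (auto simp: mem)
    then have p: "i' = 0" "j' = 0" using sg by auto
    have x: "((1, 1, 0), (0, 0, k')) \<in> X" using x' eq m p by simp
    have k': "k' \<le> c" using closed_disjoint[OF X x] by (auto simp: mem)
    have "a \<le> k'"
    proof (rule ccontr)
      assume "\<not> a \<le> k'"
      then have "((2, 1, 0), (1, 0, k')) \<in> X"
        using closed_raise(1)[OF X x, of 1] by (auto simp: mem numeral_2_eq_2)
      then show False using closed_down(2)[OF X, of 2 0 0] by (auto simp: mem)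
    qed
    moreover have "b \<le> k'"
    proof (rule ccontr)
      assume "\<not> b \<le> k'"
      then have "((1, 2, 0), (0, 1, k')) \<in> X"
        using closed_raise(2)[OF X x, of 1] by (auto simp: mem numeral_2_eq_2)
      then show False using closed_down(1)[OF X, of 0 2 0] by (auto simp: mem)
    qed
    moreover have "c - k' < a"
    proof (rule ccontr)
      assume "\<not> c - k' < a"
      moreover have "((1, 1, c - k'), (0, 0, c)) \<in> X"
        using closed_raise(3)[OF X x, of "c - k'"] k' by (auto simp: mem)
      ultimately show False using closed_down(2)[OF X, of 1 0 "c - k'"] by (auto simp: mem)
    qed
    \<comment> \<open>If \<open>b = c\<close>, this follows from \<open>b \<le> k'\<close>; if
      \<open>a = 1\<close>, from \<open>c - k' < a\<close>.\<close>
    ultimately have "k' = c" using abc k' by auto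
    then show "(m, p) = ((1, 1, 0), (0, 0, c))" using eq m p by simp
  qed
  show "card (signed_sets B (True, False, True)) \<le> 2"
  proof (rule card_signed_sets_le_2)
    fix X m p assume X': "X \<in> signed_sets B (True, False, True)" and x': "(m, p) \<in> X" and "minimal m"
    obtain i j k i' j' k' where eq: "m = (i, j, k)" "p = (i', j', k')" by (cases m; cases p)
    have X: "X \<in> closed_sets B" and sg: "i' < i" "j \<le> j'" "k' < k"
      using X' x' eq by (auto simp: signed_sets_def)
    have "(i, j, k - 1) \<in> B" "(i, j, k) \<notin> B"
      using \<open>minimal m\<close> sg closed_disjoint[OF X x'] unfolding eq minimal_def by auto
    then have m: "i = 1" "j = 0" "k = a" using sg by (auto simp: mem)
    then have i': "i' = 0" using sg by auto
    have x: "((1, 0, a), (0, j', k')) \<in> X" using x' eq m i' by simp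
    have p: "(0, j', k') \<in> B" using closed_disjoint[OF X x] by simp
    have "j' \<noteq> 0"
    proof
      assume "j' = 0"
      then have "((1, 0, a + (c - k')), (0, 0, c)) \<in> X"
        using closed_raise(3)[OF X x, of "c - k'"] p by (auto simp: mem)
      moreover have "(0, 0, a + (c - k')) \<notin> B" using sg m abc by (simp add: mem)
      ultimately show False using closed_down(1)[OF X, of 0 0 "a + (c - k')"] by auto
    qed
    then have j': "j' = 1" "k' < b" using p by (auto simp: mem)
    then have "((1, 0, a + (b - 1 - k')), (0, 1, b - 1)) \<in> X"
      using closed_raise(3)[OF X x, of "b - 1 - k'"] by (auto simp: mem)
    then have "a + (b - 1 - k') \<le> c"
      using closed_down(1)[OF X, of 0 0 "a + (b - 1 - k')"] by (auto simp: mem)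
    \<comment> \<open>If \<open>a = 1\<close>, then \<open>k' < k = a\<close> leaves only 0; if
      \<open>b = c\<close>, the last bound reads \<open>a - 1 \<le> k'\<close>.\<close>
    then have "k' = a - 1" using abc j' sg m by auto
    then show "(m, p) = ((1, 0, a), (0, 1, a - 1))" using eq m i' j' by simp
  qed
  show "card (signed_sets B (False, True, True)) \<le> 2"
  proof (rule card_signed_sets_le_2)
    fix X m p assume X': "X \<in> signed_sets B (False, True, True)" and x': "(m, p) \<in> X" and "minimal m"
    obtain i j k i' j' k' where eq: "m = (i, j, k)" "p = (i', j', k')" by (cases m; cases p)
    have X: "X \<in> closed_sets B" and sg: "i \<le> i'" "j' < j" "k' < k"
      using X' x' eq by (auto simp: signed_sets_def)
    have "(i, j, k - 1) \<in> B" "(i, j, k) \<notin> B"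
      using \<open>minimal m\<close> sg closed_disjoint[OF X x'] unfolding eq minimal_def by auto
    then have m: "i = 0" "j = 1" "k = b" using sg by (auto simp: mem)
    then have j': "j' = 0" using sg by auto
    have x: "((0, 1, b), (i', 0, k')) \<in> X" using x' eq m j' by simp
    have p: "(i', 0, k') \<in> B" using closed_disjoint[OF X x] by simp
    have "i' \<noteq> 0"
    proof
      assume "i' = 0"
      then have "((0, 1, b + (c - k')), (0, 0, c)) \<in> X"
        using closed_raise(3)[OF X x, of "c - k'"] p by (auto simp: mem)
      moreover have "(0, 0, b + (c - k')) \<notin> B" using sg m abc by (simp add: mem)
      ultimately show False using closed_down(2)[OF X, of 0 0 "b + (c - k')"] by auto
    qed
    then have i': "i' = 1" "k' < a" using p by (auto simp: mem)
    then have "((0, 1, b + (a - 1 - k')), (1, 0, a - 1)) \<in> X"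
      using closed_raise(3)[OF X x, of "a - 1 - k'"] by (auto simp: mem)
    then have "b + (a - 1 - k') \<le> c"
      using closed_down(2)[OF X, of 0 0 "b + (a - 1 - k')"] by (auto simp: mem)
    then have "k' = a - 1" using abc i' by auto
    then show "(m, p) = ((0, 1, b), (1, 0, a - 1))" using eq m i' j' by simp
  qed
qed

theorem card_mixed_eq_8_iff:
  "card (signed_sets B (True, True, False)) * card (signed_sets B (True, False, True)) *
     card (signed_sets B (False, True, True)) = 8 \<longleftrightarrow>
   (\<exists>a b c. 1 \<le> a \<and> a \<le> b \<and> b \<le> c \<and> (a = 1 \<or> b = c) \<and> B = J_complement a b c)"
  (is "?x * ?y * ?z = 8 \<longleftrightarrow> ?J")
proof
  assume eq: "?x * ?y * ?z = 8"
  have pos: "0 < h 1 0"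
  proof (rule ccontr)
    assume "\<not> 0 < h 1 0"
    with planar_card eq show False by simp
  qed
  have "?x \<le> 2" "?y \<le> 2" "?z \<le> 2"
  proof -
    have *: "p \<le> 2" if "p * q * r = 8" "2 \<le> q" "2 \<le> r" for p q r :: nat
    proof (rule ccontr)
      assume "\<not> p \<le> 2"
      then have "3 * 2 * 2 \<le> p * q * r" using that by (intro mult_le_mono) auto
      with that show False by simp
    qed
    show "?x \<le> 2" "?y \<le> 2" "?z \<le> 2"
      using *[of ?x ?y ?z] *[of ?y ?x ?z] *[of ?z ?x ?y] eq cards_ge_2[OF pos] by (auto simp: mult_ac)
  qed
  then have z: "h 1 1 = 0" "h 0 2 = 0" "\<not> (2 \<le> h 1 0 \<and> Suc (h 0 1) < h 0 0)"
    using extra_if_xy[OF pos] extra_if_yy[OF pos] extra_if_middle[OF pos] by fastforce+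
  then have "B = J_complement (h 1 0) (h 0 1) (h 0 0 - 1)" using complement_eq_J[OF pos] by blast
  moreover have "1 \<le> h 1 0" "h 1 0 \<le> h 0 1" "h 0 1 \<le> h 0 0 - 1" "h 1 0 = 1 \<or> h 0 1 = h 0 0 - 1"
    using z(3) pos h_order[OF pos] by auto
  ultimately show ?J by blast
next
  assume ?J
  then obtain a b c where abc: "1 \<le> a" "a \<le> b" "b \<le> c" "a = 1 \<or> b = c" and J: "B = J_complement a b c" by blast
  have "(1, 0, 0) \<in> B" unfolding J J_complement_iff using abc by simp
  then have "0 < h 1 0" by (simp add: mem_iff)
  from cards_ge_2[OF this] J_cards_le_2[OF J abc] have "?x = 2" "?y = 2" "?z = 2" by auto
  then show "?x * ?y * ?z = 8" by simp
qed

end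

section \<open>Coordinates and polynomials\<close>

text \<open>A biorthogonal system whose functionals separate vectors; for finite \<open>A\<close>
  the vectors form a basis. \<open>A\<close> may be infinite here, since for \<open>S/I\<close> the
  finiteness of the index set is deduced from that of the dimension.\<close>

locale coordinate_system =
  V: vectorspace "class_ring :: 'k::field ring" V for V :: "('k::field, 'v) module" +
  fixes A :: "'i set" and L :: "'i \<Rightarrow> 'v \<Rightarrow> 'k" and v :: "'i \<Rightarrow> 'v"
  assumes L_add: "a \<in> A \<Longrightarrow> x \<in> carrier V \<Longrightarrow> y \<in> carrier V \<Longrightarrow> L a (x \<oplus>\<^bsub>V\<^esub> y) = L a x + L a y"
    and L_smult: "a \<in> A \<Longrightarrow> x \<in> carrier V \<Longrightarrow> L a (c \<odot>\<^bsub>V\<^esub> x) = c * L a x"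
    and v_closed: "a \<in> A \<Longrightarrow> v a \<in> carrier V"
    and L_v: "a \<in> A \<Longrightarrow> a' \<in> A \<Longrightarrow> L a (v a') = (if a = a' then 1 else 0)"
    and separating: "x \<in> carrier V \<Longrightarrow> (\<And>a. a \<in> A \<Longrightarrow> L a x = 0) \<Longrightarrow> x = \<zero>\<^bsub>V\<^esub>"
begin

lemma L_zero: "a \<in> A \<Longrightarrow> L a \<zero>\<^bsub>V\<^esub> = 0"
proof -
  assume "a \<in> A"
  then have "L a \<zero>\<^bsub>V\<^esub> + L a \<zero>\<^bsub>V\<^esub> = L a \<zero>\<^bsub>V\<^esub> + 0"
    using L_add[of a "\<zero>\<^bsub>V\<^esub>" "\<zero>\<^bsub>V\<^esub>"] by simp
  then show "L a \<zero>\<^bsub>V\<^esub> = 0" by (simp only: add_left_cancel)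
qed

lemma L_lincomb:
  assumes a: "a \<in> A" and S: "finite S" "S \<subseteq> carrier V"
  shows "L a (V.lincomb c S) = (\<Sum>s\<in>S. c s * L a s)"
  using S
proof (induction S rule: finite_induct)
  case empty
  then show ?case by (simp add: V.lincomb_def L_zero a)
next
  case (insert s S)
  then have "V.lincomb c (insert s S) = c s \<odot>\<^bsub>V\<^esub> s \<oplus>\<^bsub>V\<^esub> V.lincomb c S"
    unfolding V.lincomb_def by (intro V.finsum_insert) (auto intro!: V.smult_closed)
  moreover have "V.lincomb c S \<in> carrier V" using insert by (intro V.lincomb_closed) auto
  ultimately show ?case using insert a by (simp add: L_add L_smult V.smult_closed)
qed

lemma inj_v: "inj_on v A"
  using L_v by (intro inj_onI) (metis zero_neq_one)

lemma lin_indpt_v: "V.lin_indpt (v ` A)"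
proof
  assume "V.lin_dep (v ` A)"
  then obtain S c s where S: "finite S" "S \<subseteq> v ` A" "V.lincomb c S = \<zero>\<^bsub>V\<^esub>" "s \<in> S" "c s \<noteq> 0"
    unfolding V.lin_dep_def by auto
  then obtain a where a: "a \<in> A" "s = v a" by auto
  have "0 = (\<Sum>s\<in>S. c s * L a s)"
    using L_lincomb[OF a(1) S(1), of c] S(2,3) v_closed L_zero[OF a(1)] by auto
  also have "\<dots> = (\<Sum>t\<in>S. if t = s then c s else 0)"
    using S(2) a L_v inj_v by (intro sum.cong) (auto simp: inj_on_eq_iff)
  also have "\<dots> = c s" using S(1,4) by simp
  finally show False using S(5) by simp
qed

lemma gen_set_v:
  assumes fin: "finite A"
  shows "V.gen_set (v ` A)"
proof
  show "V.span (v ` A) \<subseteq> carrier V"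
    using v_closed by (intro V.span_is_subset2) auto
  show "carrier V \<subseteq> V.span (v ` A)"
  proof
    fix w assume w: "w \<in> carrier V"
    define c where "c x = L (inv_into A v x) w" for x
    define w' where "w' = V.lincomb c (v ` A)"
    have w': "w' \<in> carrier V"
      unfolding w'_def using v_closed by (intro V.lincomb_closed) auto
    have "w \<oplus>\<^bsub>V\<^esub> (- 1) \<odot>\<^bsub>V\<^esub> w' = \<zero>\<^bsub>V\<^esub>"
    proof (rule separating)
      fix a assume a: "a \<in> A"
      have "L a w' = (\<Sum>s\<in>v ` A. c s * L a s)"
        unfolding w'_def using a fin v_closed by (intro L_lincomb) auto
      also have "\<dots> = (\<Sum>a'\<in>A. if a' = a then L a w else 0)"
        unfolding sum.reindex[OF inj_v] using a by (intro sum.cong) (auto simp: c_def inj_v L_v)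
      also have "\<dots> = L a w" using a fin by simp
      finally show "L a (w \<oplus>\<^bsub>V\<^esub> (- 1) \<odot>\<^bsub>V\<^esub> w') = 0"
        using a w w' by (simp add: L_add L_smult V.smult_closed)
    qed (use w w' in \<open>auto intro!: V.smult_closed V.a_closed\<close>)
    moreover have "w' \<oplus>\<^bsub>V\<^esub> (- 1) \<odot>\<^bsub>V\<^esub> w' = \<zero>\<^bsub>V\<^esub>"
      using w' by (intro separating) (auto simp: L_add L_smult V.smult_closed intro!: V.a_closed)
    ultimately have "w = w'"
      using w w' V.smult_closed by (metis V.add.right_cancel UNIV_I partial_object.select_convs(1))
    then show "w \<in> V.span (v ` A)"
      unfolding V.span_def w'_def using fin by (auto intro!: exI[of _ c] exI[of _ "v ` A"])
  qed
qed

lemma finite_if_fin_dim: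
  assumes "V.fin_dim"
  shows "finite A"
proof -
  have "finite (v ` A)"
    by (rule V.fin_dim_li_fin[OF assms lin_indpt_v]) (use v_closed in auto)
  then show ?thesis using inj_v by (simp add: finite_image_iff)
qed

lemma has_dim_card:
  assumes "finite A"
  shows "has_dim class_ring V (card A)"
proof -
  have sub: "v ` A \<subseteq> carrier V" using v_closed by auto
  then have "V.basis (v ` A)"
    unfolding V.basis_def using lin_indpt_v gen_set_v[OF assms] by simp
  then have "V.dim = card (v ` A)" using assms by (intro V.dim_basis) auto
  moreover have "V.fin_dim"
    unfolding V.fin_dim_def using assms sub gen_set_v by blast
  ultimately show ?thesis
    unfolding has_dim_def using card_image[OF inj_v] by simp
qed

end

section \<open>Coefficients of products, and ideals described by supports\<close>

lemma poly_mapping_sum_single: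
  "p = (\<Sum>k\<in>Poly_Mapping.keys p. Poly_Mapping.single k (Poly_Mapping.lookup p k))"
proof (rule poly_mapping_eqI)
  fix k
  show "Poly_Mapping.lookup p k = Poly_Mapping.lookup
      (\<Sum>k\<in>Poly_Mapping.keys p. Poly_Mapping.single k (Poly_Mapping.lookup p k)) k"
    by (auto simp: lookup_sum lookup_single when_def in_keys_iff)
qed

lemma lookup_single_mult_add:
  fixes p :: "('n \<Rightarrow>\<^sub>0 nat) \<Rightarrow>\<^sub>0 'k::comm_ring_1"
  shows "Poly_Mapping.lookup (Poly_Mapping.single t c * p) (t + k) = c * Poly_Mapping.lookup p k"
  by (simp add: lookup_mult lookup_single when_mult)

lemma lookup_single_mult_eq_0:
  fixes p :: "('n \<Rightarrow>\<^sub>0 nat) \<Rightarrow>\<^sub>0 'k::comm_ring_1"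
  assumes "\<nexists>k. m = t + k"
  shows "Poly_Mapping.lookup (Poly_Mapping.single t c * p) m = 0"
proof -
  have "m \<notin> Poly_Mapping.keys (Poly_Mapping.single t c * p)"
    using keys_mult[of "Poly_Mapping.single t c" p] assms by (auto split: if_splits)
  then show ?thesis by (simp add: in_keys_iff)
qed

lemma lookup_single_0_mult:
  fixes p :: "('n \<Rightarrow>\<^sub>0 nat) \<Rightarrow>\<^sub>0 'k::comm_ring_1"
  shows "Poly_Mapping.lookup (Poly_Mapping.single 0 c * p) k = c * Poly_Mapping.lookup p k"
  using lookup_single_mult_add[of 0 c p k] by simp

lemma exponent_induct [case_names zero step]:
  fixes t :: "'n \<Rightarrow>\<^sub>0 nat"
  assumes zero: "P 0" and step: "\<And>t i. P t \<Longrightarrow> P (t + Poly_Mapping.single i 1)"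
  shows "P t"
proof (induction t rule: update_induct)
  case const
  show ?case by (rule zero)
next
  case (update t i n)
  have "P (t + Poly_Mapping.single i k)" for k
  proof (induction k)
    case (Suc k)
    have "t + Poly_Mapping.single i (Suc k) = t + Poly_Mapping.single i k + Poly_Mapping.single i 1"
      by (simp add: add.assoc flip: single_add)
    with step[OF Suc] show ?case by simp
  qed (use update in simp)
  moreover have "Poly_Mapping.update i n t = t + Poly_Mapping.single i n"
    using update by (intro poly_mapping_eqI) (auto simp: lookup_update lookup_add lookup_single in_keys_iff)
  ultimately show ?case by simp
qed

lemma keys_disjoint_ideal:
  fixes B :: "('n \<Rightarrow>\<^sub>0 nat) set"
  assumes down: "\<And>m t. m + t \<in> B \<Longrightarrow> m \<in> B"
  shows "ideal {f :: ('n, 'k::comm_ring_1) mpoly. Poly_Mapping.keys f \<inter> B = {}} poly_ring" (is "ideal ?I _")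
proof -
  have lookup: "f \<in> ?I \<longleftrightarrow> (\<forall>b\<in>B. Poly_Mapping.lookup f b = 0)" for f
    by (auto simp: in_keys_iff)
  have mult: "x * a \<in> ?I" if "a \<in> ?I" for a x
  proof -
    have "m \<notin> B" if m: "m \<in> Poly_Mapping.keys (x * a)" for m
    proof
      assume "m \<in> B"
      from m keys_mult[of x a] obtain k l where "m = k + l" "l \<in> Poly_Mapping.keys a" by auto
      with \<open>m \<in> B\<close> down[of l k] \<open>a \<in> ?I\<close> show False by (auto simp: add.commute)
    qed
    then show ?thesis by auto
  qed
  show ?thesis
  proof (rule idealI)
    show "ring (poly_ring :: ('n, 'k) mpoly ring)" by (rule class_ring.ring_axioms)
    show "subgroup ?I (add_monoid poly_ring)"
    proof (rule group.subgroupI)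
      show "Group.group (add_monoid (poly_ring :: ('n, 'k) mpoly ring))"
        by (rule abelian_group.a_group[OF ring.axioms(1)[OF class_ring.ring_axioms]])
      show "inv\<^bsub>add_monoid poly_ring\<^esub> a \<in> ?I" if "a \<in> ?I" for a
        unfolding a_inv_def[of poly_ring, symmetric]
        using that unfolding class_ring_simps lookup by simp
    qed (auto dest!: subsetD[OF Poly_Mapping.keys_add] intro!: exI[of _ 0])
  qed (use mult in \<open>auto simp: mult.commute\<close>)
qed

section \<open>The tangent space at a monomial ideal\<close>

definition atoms :: "'a set set \<Rightarrow> 'a set set" where
  "atoms \<X> = {X\<in>\<X>. X \<noteq> {} \<and> (\<forall>Y\<in>\<X>. Y \<subseteq> X \<longrightarrow> Y = {} \<or> Y = X)}"

lemma atomsD: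
  assumes "A \<in> atoms \<X>"
  shows "A \<in> \<X>" "A \<noteq> {}" "Y \<in> \<X> \<Longrightarrow> Y \<subseteq> A \<Longrightarrow> Y \<noteq> {} \<Longrightarrow> Y = A"
  using assms by (auto simp: atoms_def)

lemma atom_exists:
  assumes "finite \<X>" "X \<in> \<X>" "X \<noteq> {}"
  shows "\<exists>A\<in>atoms \<X>. A \<subseteq> X"
proof -
  obtain A where A: "A \<in> \<X> - {{}}" "A \<subseteq> X" "\<forall>Y\<in>\<X> - {{}}. Y \<subseteq> A \<longrightarrow> A = Y"
    using finite_has_minimal2[of "\<X> - {{}}" X] assms by auto
  then have "A \<in> atoms \<X>" unfolding atoms_def by blast
  with A(2) show ?thesis by blast
qed

text \<open>Every member is the union of the atoms below it: removing them leaves a member that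
  contains no atom, hence the empty set. Distinct atoms are disjoint because the ring is closed
  under intersection.\<close>

lemma card_ring_of_sets:
  assumes fin: "finite \<X>" and un: "\<And>\<Y>. \<Y> \<subseteq> \<X> \<Longrightarrow> \<Union>\<Y> \<in> \<X>" and diff: "\<And>X Y. X \<in> \<X> \<Longrightarrow> Y \<in> \<X> \<Longrightarrow> X - Y \<in> \<X>"
  shows "card \<X> = 2 ^ card (atoms \<X>)"
    and "A \<in> atoms \<X> \<Longrightarrow> A' \<in> atoms \<X> \<Longrightarrow> A \<noteq> A' \<Longrightarrow> A \<inter> A' = {}"
proof -
  show disj: "A \<inter> A' = {}" if A: "A \<in> atoms \<X>" "A' \<in> atoms \<X>" "A \<noteq> A'" for A A'
  proof -
    have "A - (A - A') \<in> \<X>"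
      using diff[OF atomsD(1)[OF A(1)] diff[OF atomsD(1)[OF A(1)] atomsD(1)[OF A(2)]]] .
    then have int: "A \<inter> A' \<in> \<X>" by (simp add: Diff_Diff_Int)
    show ?thesis
      using atomsD(3)[OF A(1) int] atomsD(3)[OF A(2) int] A(3) by blast
  qed
  have "bij_betw (\<lambda>X. {A\<in>atoms \<X>. A \<subseteq> X}) \<X> (Pow (atoms \<X>))"
  proof (rule bij_betw_byWitness[where f' = Union])
    show "\<forall>X\<in>\<X>. \<Union>{A\<in>atoms \<X>. A \<subseteq> X} = X"
    proof
      fix X assume X: "X \<in> \<X>"
      let ?Y = "\<Union>{A\<in>atoms \<X>. A \<subseteq> X}"
      have "?Y \<in> \<X>" by (rule un) (auto simp: atoms_def)
      with X have "X - ?Y \<in> \<X>" by (rule diff)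
      have "X - ?Y = {}"
      proof (rule ccontr)
        assume "X - ?Y \<noteq> {}"
        then obtain A where A: "A \<in> atoms \<X>" "A \<subseteq> X - ?Y"
          using atom_exists[OF fin \<open>X - ?Y \<in> \<X>\<close>] by blast
        then have "A \<subseteq> ?Y" by blast
        with A atomsD(2)[OF A(1)] show False by blast
      qed
      then show "?Y = X" by auto
    qed
    show "\<forall>\<Y>\<in>Pow (atoms \<X>). {A\<in>atoms \<X>. A \<subseteq> \<Union>\<Y>} = \<Y>"
    proof (intro ballI equalityI subsetI)
      fix \<Y> A assume Y: "\<Y> \<in> Pow (atoms \<X>)" and A: "A \<in> {A\<in>atoms \<X>. A \<subseteq> \<Union>\<Y>}"
      then obtain x where "x \<in> A" by (auto simp: atoms_def)
      with A obtain A' where "A' \<in> \<Y>" "x \<in> A'" by blast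
      with disj[of A A'] \<open>x \<in> A\<close> A Y show "A \<in> \<Y>" by blast
    qed auto
    show "Union ` Pow (atoms \<X>) \<subseteq> \<X>" using un by (auto simp: atoms_def)
  qed auto
  then have "card \<X> = card (Pow (atoms \<X>))" by (rule bij_betw_same_card)
  then show "card \<X> = 2 ^ card (atoms \<X>)" using fin by (simp add: card_Pow atoms_def)
qed

abbreviation unit :: "'n \<Rightarrow> 'n \<Rightarrow>\<^sub>0 nat" where
  "unit i \<equiv> Poly_Mapping.single i 1"

definition shifts :: "(('n \<Rightarrow>\<^sub>0 nat) \<Rightarrow> ('n \<Rightarrow>\<^sub>0 nat)) set" where
  "shifts = range (\<lambda>i m. m + unit i)"

section \<open>Homomorphisms from a monomial ideal in coordinates\<close>

locale monomial_quotient =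
  fixes B :: "('n \<Rightarrow>\<^sub>0 nat) set" and I :: "('n, 'k::field) mpoly set"
  assumes I_eq: "I = {f. Poly_Mapping.keys f \<inter> B = {}}"
    and down: "m + t \<in> B \<Longrightarrow> m \<in> B"
begin

lemma ideal_I: "ideal I poly_ring"
  unfolding I_eq by (rule keys_disjoint_ideal[OF down])

lemma mem_I: "f \<in> I \<longleftrightarrow> (\<forall>b\<in>B. Poly_Mapping.lookup f b = 0)"
  by (auto simp: I_eq in_keys_iff)

lemma mon_mem_I: "mon m \<in> I \<longleftrightarrow> m \<notin> B"
  by (auto simp: mem_I mon_def lookup_single when_def)

lemma mult_mem_I: "f \<in> I \<Longrightarrow> g * f \<in> I"
  using ideal.I_l_closed[OF ideal_I, of f g] by simp

definition cls :: "('n, 'k) mpoly \<Rightarrow> ('n, 'k) mpoly set" where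
  "cls f = a_r_coset poly_ring I f"

text \<open>Two representatives of a class modulo \<open>I\<close> agree at the exponents in
  \<open>B\<close>, so the choice does not matter there; elsewhere the value is arbitrary.\<close>

definition coeff_of :: "('n, 'k) mpoly set \<Rightarrow> ('n \<Rightarrow>\<^sub>0 nat) \<Rightarrow> 'k" where
  "coeff_of X b = Poly_Mapping.lookup (SOME f. f \<in> X) b"

lemma mem_cls: "g \<in> cls f \<longleftrightarrow> (\<forall>b\<in>B. Poly_Mapping.lookup g b = Poly_Mapping.lookup f b)"
proof
  assume "g \<in> cls f"
  then show "\<forall>b\<in>B. Poly_Mapping.lookup g b = Poly_Mapping.lookup f b"
    by (auto simp: cls_def a_r_coset_def' lookup_add mem_I)
next
  assume "\<forall>b\<in>B. Poly_Mapping.lookup g b = Poly_Mapping.lookup f b"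
  then have "g - f \<in> I" by (simp add: mem_I lookup_minus)
  then show "g \<in> cls f"
    unfolding cls_def a_r_coset_def' by (force intro: bexI[of _ "g - f"])
qed

lemma cls_eq_iff: "cls f = cls g \<longleftrightarrow> (\<forall>b\<in>B. Poly_Mapping.lookup f b = Poly_Mapping.lookup g b)"
proof
  assume "cls f = cls g"
  then have "f \<in> cls g" using mem_cls[of f f] by simp
  then show "\<forall>b\<in>B. Poly_Mapping.lookup f b = Poly_Mapping.lookup g b" by (simp add: mem_cls)
qed (auto simp: mem_cls)

lemma coeff_of_cls: "b \<in> B \<Longrightarrow> coeff_of (cls f) b = Poly_Mapping.lookup f b"
  unfolding coeff_of_def using someI[of "\<lambda>g. g \<in> cls f" f] mem_cls by auto

lemma carrier_Quot: "carrier (poly_ring Quot I) = range cls"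
  by (auto simp: FactRing_def A_RCOSETS_def' cls_def)

lemma Quot_ring_hom: "ring_hom_ring poly_ring (poly_ring Quot I) cls"
  using ideal.rcos_ring_hom_ring[OF ideal_I] by (simp add: cls_def[abs_def])

lemma add_Quot: "cls f \<oplus>\<^bsub>poly_ring Quot I\<^esub> cls g = cls (f + g)"
  using ring_hom_add[OF ring_hom_ring.homh[OF Quot_ring_hom], of f g] by simp

lemma mult_Quot: "cls f \<otimes>\<^bsub>poly_ring Quot I\<^esub> cls g = cls (f * g)"
  using ring_hom_mult[OF ring_hom_ring.homh[OF Quot_ring_hom], of f g] by simp

lemma zero_Quot: "\<zero>\<^bsub>poly_ring Quot I\<^esub> = cls 0"
  by (auto simp: FactRing_def mem_cls mem_I)

lemma coordinate_system_coord_space: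
  "coordinate_system (coord_space I) B (\<lambda>b X. coeff_of X b) (\<lambda>b. cls (mon b))"
proof -
  interpret vectorspace class_ring "coord_space I" by (rule vectorspace_coord_space[OF ideal_I])
  have cs: "carrier (coord_space I) = range cls" "\<zero>\<^bsub>coord_space I\<^esub> = cls 0"
    "cls f \<oplus>\<^bsub>coord_space I\<^esub> cls g = cls (f + g)"
    "c \<odot>\<^bsub>coord_space I\<^esub> cls f = cls (const c * f)" for f g c
    by (simp_all add: coord_space_def restrict_scalars_def quot_module_def carrier_Quot zero_Quot add_Quot
        mult_Quot flip: cls_def)
  show ?thesis
  proof unfold_locales
    fix b X Y assume "b \<in> B" "X \<in> carrier (coord_space I)" "Y \<in> carrier (coord_space I)"
    then show "coeff_of (X \<oplus>\<^bsub>coord_space I\<^esub> Y) b = coeff_of X b + coeff_of Y b"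
      by (auto simp: cs coeff_of_cls lookup_add)
  next
    fix b X c assume "b \<in> B" "X \<in> carrier (coord_space I)"
    then show "coeff_of (c \<odot>\<^bsub>coord_space I\<^esub> X) b = c * coeff_of X b"
      by (auto simp: cs coeff_of_cls const_def lookup_single_0_mult)
  next
    fix X assume "X \<in> carrier (coord_space I)" and 0: "\<And>b. b \<in> B \<Longrightarrow> coeff_of X b = 0"
    then obtain f where "X = cls f" by (auto simp: cs)
    with 0 show "X = \<zero>\<^bsub>coord_space I\<^esub>" by (auto simp: cs cls_eq_iff coeff_of_cls)
  qed (auto simp: cs coeff_of_cls mon_def lookup_single when_def)
qed

lemma coord_space_dim:
  assumes "has_dim class_ring (coord_space I) d"
  shows "finite B" "card B = d"
proof -
  interpret coordinate_system "coord_space I" B "\<lambda>b X. coeff_of X b" "\<lambda>b. cls (mon b)"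
    by (rule coordinate_system_coord_space)
  show "finite B" using assms by (auto simp: has_dim_def intro: finite_if_fin_dim)
  from has_dim_card[OF this] assms show "card B = d" by (simp add: has_dim_def)
qed

lemma closed_shift:
  assumes X: "X \<in> closed_family shifts B" and "m \<notin> B" "b \<in> B"
  shows "(t + m, b) \<in> X \<longleftrightarrow> (\<exists>b'. b = t + b' \<and> (m, b') \<in> X)"
  using assms(3)
proof (induction t arbitrary: b rule: exponent_induct)
  case zero
  then show ?case by simp
next
  case (step t i)
  let ?e = "Poly_Mapping.single i 1"
  have "t + m \<notin> B" using assms(2) down[of m t] by (auto simp: add.commute)
  then have "(t + m + ?e, b) \<in> X \<longleftrightarrow> (\<exists>b'. b = b' + ?e \<and> (t + m, b') \<in> X)"
    using step.prems by (intro closed_familyD(2)[OF X]) (auto simp: shifts_def)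
  also have "\<dots> \<longleftrightarrow> (\<exists>b'. b = b' + ?e \<and> (\<exists>b''. b' = t + b'' \<and> (m, b'') \<in> X))"
    using step.IH step.prems down by blast
  also have "\<dots> \<longleftrightarrow> (\<exists>b''. b = t + b'' + ?e \<and> (m, b'') \<in> X)" by blast
  finally show ?case by (simp add: add_ac)
qed

text \<open>The linear map on polynomials whose matrix is the indicator function of
  \<open>X\<close>. Only modulo \<open>I\<close>, and on elements of \<open>I\<close>, does it
  commute with multiplication by polynomials.\<close>

definition indicator_poly :: "(('n \<Rightarrow>\<^sub>0 nat) \<times> ('n \<Rightarrow>\<^sub>0 nat)) set \<Rightarrow> ('n, 'k) mpoly \<Rightarrow> ('n, 'k) mpoly" where
  "indicator_poly X p = (\<Sum>(m, b)\<in>X. Poly_Mapping.single b (Poly_Mapping.lookup p m))"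

lemma lookup_indicator_poly:
  assumes "finite X"
  shows "Poly_Mapping.lookup (indicator_poly X p) b = (\<Sum>m\<in>{m. (m, b) \<in> X}. Poly_Mapping.lookup p m)"
proof -
  have "Poly_Mapping.lookup (indicator_poly X p) b = (\<Sum>x\<in>X. if snd x = b then Poly_Mapping.lookup p (fst x) else 0)"
    unfolding indicator_poly_def
    by (simp add: lookup_sum lookup_single when_def case_prod_beta')
  also have "\<dots> = (\<Sum>x\<in>{x\<in>X. snd x = b}. Poly_Mapping.lookup p (fst x))"
    using assms by (simp add: sum.inter_filter)
  also have "\<dots> = (\<Sum>m\<in>{m. (m, b) \<in> X}. Poly_Mapping.lookup p m)"
    by (rule sum.reindex_bij_witness[of _ "\<lambda>m. (m, b)" fst]) auto
  finally show ?thesis .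
qed

lemma indicator_poly_add: "indicator_poly X (p + q) = indicator_poly X p + indicator_poly X q"
  by (simp add: indicator_poly_def lookup_add single_add case_prod_unfold sum.distrib)

lemma indicator_poly_single_mult:
  assumes X: "X \<in> closed_family shifts B" "finite X" and p: "p \<in> I"
  shows "cls (indicator_poly X (Poly_Mapping.single t c * p)) = cls (Poly_Mapping.single t c * indicator_poly X p)"
  unfolding cls_eq_iff
proof
  fix b assume b: "b \<in> B"
  have fin: "finite {m. (m, b) \<in> X}" for b
    by (rule finite_subset[OF _ finite_imageI[OF X(2), of fst]]) force
  let ?q = "Poly_Mapping.single t c * p"
  have "Poly_Mapping.lookup (indicator_poly X ?q) b = (\<Sum>m\<in>{m. (m, b) \<in> X}. Poly_Mapping.lookup ?q m)"
    by (rule lookup_indicator_poly[OF X(2)])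
  \<comment> \<open>Only exponents \<open>t + k\<close> can occur in \<open>?q\<close>, and those
    with \<open>k\<close> in \<open>B\<close> have coefficient zero since \<open>p\<close> lies in
    \<open>I\<close>. For the others closedness applies.\<close>
  also have "\<dots> = (\<Sum>m\<in>(+) t ` {m. m \<notin> B \<and> (t + m, b) \<in> X}. Poly_Mapping.lookup ?q m)"
  proof (rule sum.mono_neutral_right[OF fin])
    show "\<forall>m\<in>{m. (m, b) \<in> X} - (+) t ` {m. m \<notin> B \<and> (t + m, b) \<in> X}. Poly_Mapping.lookup ?q m = 0"
    proof
      fix m assume m: "m \<in> {m. (m, b) \<in> X} - (+) t ` {m. m \<notin> B \<and> (t + m, b) \<in> X}"
      show "Poly_Mapping.lookup ?q m = 0"
      proof (cases "\<exists>k. m = t + k")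
        case True
        then obtain k where k: "m = t + k" by blast
        with m have "k \<in> B" by auto
        with p show ?thesis by (simp add: k lookup_single_mult_add mem_I)
      qed (rule lookup_single_mult_eq_0)
    qed
  qed auto
  also have "\<dots> = (\<Sum>m\<in>{m. m \<notin> B \<and> (t + m, b) \<in> X}. c * Poly_Mapping.lookup p m)"
    by (subst sum.reindex) (auto simp: lookup_single_mult_add inj_on_def)
  also have "\<dots> = Poly_Mapping.lookup (Poly_Mapping.single t c * indicator_poly X p) b"
  proof (cases "\<exists>b'. b = t + b'")
    case True
    then obtain b' where b': "b = t + b'" by blast
    have "{m. m \<notin> B \<and> (t + m, b) \<in> X} = {m. (m, b') \<in> X}"
      using closed_shift[OF X(1) _ b] closed_familyD(1)[OF X(1)] b' by auto
    then show ?thesis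
      by (simp add: b' lookup_single_mult_add lookup_indicator_poly[OF X(2)] sum_distrib_left)
  next
    case False
    then have "{m. m \<notin> B \<and> (t + m, b) \<in> X} = {}"
      using closed_shift[OF X(1) _ b] by auto
    then show ?thesis
      unfolding \<open>{m. m \<notin> B \<and> (t + m, b) \<in> X} = {}\<close>
      using lookup_single_mult_eq_0[OF False, of c "indicator_poly X p"] by simp
  qed
  finally show "Poly_Mapping.lookup (indicator_poly X ?q) b =
      Poly_Mapping.lookup (Poly_Mapping.single t c * indicator_poly X p) b" .
qed

lemma indicator_poly_mult:
  assumes X: "X \<in> closed_family shifts B" "finite X" and p: "p \<in> I"
  shows "cls (indicator_poly X (r * p)) = cls (r * indicator_poly X p)"
proof -
  have "cls (indicator_poly X ((\<Sum>k\<in>S. Poly_Mapping.single k (f k)) * p)) =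
      cls ((\<Sum>k\<in>S. Poly_Mapping.single k (f k)) * indicator_poly X p)" if "finite S" for S f
    using that
  proof (induction S rule: finite_induct)
    case empty
    show ?case by (simp add: indicator_poly_def case_prod_unfold)
  next
    case (insert k S)
    then show ?case
      using indicator_poly_single_mult[OF X p, of k "f k"]
      by (simp add: distrib_right indicator_poly_add flip: add_Quot)
  qed
  from this[of "Poly_Mapping.keys r" "Poly_Mapping.lookup r"] show ?thesis
    unfolding poly_mapping_sum_single[of r, symmetric] by simp
qed

definition indicator_hom :: "(('n \<Rightarrow>\<^sub>0 nat) \<times> ('n \<Rightarrow>\<^sub>0 nat)) set \<Rightarrow> ('n, 'k) mpoly \<Rightarrow> ('n, 'k) mpoly set" where
  "indicator_hom X = (\<lambda>p\<in>I. cls (indicator_poly X p))"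

lemma carrier_tangent_space:
  "F \<in> carrier (tangent_space I) \<longleftrightarrow> F \<in> extensional I \<and> (\<forall>p\<in>I. F p \<in> range cls) \<and>
     (\<forall>p\<in>I. \<forall>q\<in>I. F (p + q) = F p \<oplus>\<^bsub>poly_ring Quot I\<^esub> F q) \<and>
     (\<forall>r. \<forall>p\<in>I. F (r * p) = cls r \<otimes>\<^bsub>poly_ring Quot I\<^esub> F p)"
  by (auto simp: tangent_space_def restrict_scalars_def hom_module_def LinearCombinations.module_hom_def
      ideal_module_def ring_module_def quot_module_def carrier_Quot Pi_iff simp flip: cls_def)

lemma tangent_vector_mon:
  assumes "F \<in> carrier (tangent_space I)" "m \<notin> B"
  obtains f where "F (mon m) = cls f"
proof -
  have "F (mon m) \<in> range cls"
    using assms mon_mem_I[of m] by (simp add: carrier_tangent_space)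
  then show ?thesis using that by blast
qed

lemma indicator_hom_closed:
  assumes "X \<in> closed_family shifts B" "finite X"
  shows "indicator_hom X \<in> carrier (tangent_space I)"
proof -
  have "p + q \<in> I" if "p \<in> I" "q \<in> I" for p q using that by (simp add: mem_I lookup_add)
  then show ?thesis
    unfolding carrier_tangent_space
    by (auto simp: indicator_hom_def mult_mem_I indicator_poly_add add_Quot mult_Quot indicator_poly_mult[OF assms])
qed

lemma coeff_indicator_hom:
  assumes "X \<in> closed_family shifts B" "finite X" "m \<notin> B" "b \<in> B"
  shows "coeff_of (indicator_hom X (mon m)) b = (if (m, b) \<in> X then 1 else 0)"
proof -
  have fin: "finite {m. (m, b) \<in> X}"
    by (rule finite_subset[OF _ finite_imageI[OF assms(2), of fst]]) force
  have "coeff_of (indicator_hom X (mon m)) b = Poly_Mapping.lookup (indicator_poly X (mon m)) b"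
    using assms by (simp add: indicator_hom_def mon_mem_I coeff_of_cls)
  then show ?thesis
    using fin by (simp add: lookup_indicator_poly[OF assms(2)] mon_def lookup_single when_def sum.delta)
qed

text \<open>Multiplication by a variable carries the coefficients of \<open>F\<close> along and puts
  zero where the target is not divisible by that variable. The set where a value is attained is thus
  closed unless the value is zero.\<close>

lemma level_set_closed:
  assumes F: "F \<in> carrier (tangent_space I)" and c: "c \<noteq> 0"
  shows "{(m, b). m \<notin> B \<and> b \<in> B \<and> coeff_of (F (mon m)) b = c} \<in> closed_family shifts B"
  unfolding closed_family_def
proof (rule CollectI, intro conjI ballI allI impI)
  fix u :: "('n \<Rightarrow>\<^sub>0 nat) \<Rightarrow> ('n \<Rightarrow>\<^sub>0 nat)" and m b assume "u \<in> shifts" and m: "m \<notin> B" and b: "b \<in> B"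
  then obtain i where u: "u = (\<lambda>m. m + Poly_Mapping.single i 1)" by (auto simp: shifts_def)
  let ?e = "Poly_Mapping.single i 1"
  have me: "m + ?e \<notin> B" using m down by blast
  obtain f where f: "F (mon m) = cls f"
    using tangent_vector_mon[OF F m] .
  have "F (mon (m + ?e)) = F (Poly_Mapping.single ?e 1 * mon m)"
    by (simp add: mon_def mult_single add.commute)
  also have "\<dots> = cls (Poly_Mapping.single ?e 1 * f)"
    using F m f by (simp add: carrier_tangent_space mon_mem_I mult_Quot)
  finally have Fe: "coeff_of (F (mon (m + ?e))) b = Poly_Mapping.lookup (Poly_Mapping.single ?e 1 * f) b"
    using b by (simp add: coeff_of_cls)
  show "(u m, b) \<in> {(m, b). m \<notin> B \<and> b \<in> B \<and> coeff_of (F (mon m)) b = c} \<longleftrightarrow>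
      (\<exists>b'. b = u b' \<and> (m, b') \<in> {(m, b). m \<notin> B \<and> b \<in> B \<and> coeff_of (F (mon m)) b = c})"
  proof (cases "\<exists>b'. b = ?e + b'")
    case True
    then obtain b' where b': "b = ?e + b'" by blast
    then have "b' \<in> B" using b down[of b' ?e] by (simp add: add.commute)
    moreover have "b = b' + ?e" using b' by (simp add: add.commute)
    moreover have "coeff_of (F (mon (m + ?e))) b = Poly_Mapping.lookup f b'"
      using Fe by (simp add: b' lookup_single_mult_add)
    ultimately show ?thesis using m me b f by (simp add: u coeff_of_cls)
  next
    case False
    then show ?thesis using Fe lookup_single_mult_eq_0[OF False, of 1 f] c by (auto simp: u add.commute)
  qed
qed auto

lemma hom_eq_zero:
  assumes F: "F \<in> carrier (tangent_space I)"
    and 0: "\<And>m b. m \<notin> B \<Longrightarrow> b \<in> B \<Longrightarrow> coeff_of (F (mon m)) b = 0"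
  shows "F = (\<lambda>p\<in>I. cls 0)"
proof -
  have mono: "F (mon m) = cls 0" if m: "m \<notin> B" for m
  proof -
    obtain f where "F (mon m) = cls f" using tangent_vector_mon[OF F m] .
    then show ?thesis using 0[OF m] by (simp add: cls_eq_iff coeff_of_cls)
  qed
  have single: "F (Poly_Mapping.single m c) = cls 0" if m: "m \<notin> B" for m c
  proof -
    have "Poly_Mapping.single m c = const c * mon m" by (simp add: const_def mon_def mult_single)
    then show ?thesis using F m mono[OF m] by (simp add: carrier_tangent_space mon_mem_I mult_Quot)
  qed
  have sum: "F (\<Sum>k\<in>S. Poly_Mapping.single k (f k)) = cls 0 \<and> (\<Sum>k\<in>S. Poly_Mapping.single k (f k)) \<in> I"
    if "finite S" "S \<inter> B = {}" for S f
    using that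
  proof (induction S rule: finite_induct)
    case empty
    have "0 \<in> I" by (simp add: mem_I)
    \<comment> \<open>That \<open>F\<close> vanishes at 0 is deduced from linearity over the
      polynomial ring, with scalar 0.\<close>
    then have "F (0 * 0) = cls 0 \<otimes>\<^bsub>poly_ring Quot I\<^esub> F 0" "F 0 \<in> range cls"
      using F unfolding carrier_tangent_space by blast+
    moreover from this(2) obtain f where "F 0 = cls f" by blast
    ultimately show ?case by (simp add: mult_Quot mem_I)
  next
    case (insert k S)
    then have "Poly_Mapping.single k (f k) \<in> I" by (auto simp: mem_I lookup_single when_def)
    with insert F single[of k "f k"] show ?case
      by (auto simp: carrier_tangent_space add_Quot mem_I lookup_add)
  qed
  have "F p = cls 0" if "p \<in> I" for p
    using sum[of "Poly_Mapping.keys p" "Poly_Mapping.lookup p"] that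
    unfolding poly_mapping_sum_single[of p, symmetric] by (simp add: I_eq)
  moreover have "F \<in> extensional I" using F by (simp add: carrier_tangent_space)
  ultimately show ?thesis by (intro extensionalityI[of F I]) auto
qed

text \<open>One pair \<open>pt A\<close> is chosen in every atom, and the coefficient there is the
  functional. Disjointness of the atoms makes these functionals biorthogonal to the indicator
  homomorphisms. They separate: the level set of a nonzero coefficient contains an atom, and the
  functional of that atom takes the same nonzero value.\<close>

theorem tangent_space_dim:
  assumes finite_closed: "finite (closed_family shifts B)" "\<And>X. X \<in> closed_family shifts B \<Longrightarrow> finite X"
  shows "has_dim class_ring (tangent_space I) n \<longleftrightarrow> card (closed_family shifts B) = 2 ^ n"
proof -
  let ?\<X> = "closed_family shifts B"
  have inj: "inj u" if "u \<in> shifts" for u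
    using that by (auto simp: shifts_def inj_def)
  have ring: "card ?\<X> = 2 ^ card (atoms ?\<X>)"
    "A \<in> atoms ?\<X> \<Longrightarrow> A' \<in> atoms ?\<X> \<Longrightarrow> A \<noteq> A' \<Longrightarrow> A \<inter> A' = {}" for A A'
    by (rule card_ring_of_sets[OF finite_closed(1) closed_family_Union closed_family_diff[OF _ _ inj]]; assumption)+
  have fin_atoms: "finite (atoms ?\<X>)"
    by (rule finite_subset[OF _ finite_closed(1)]) (auto dest: atomsD(1))
  define pt where "pt A = (SOME x. x \<in> A)" for A :: "(('n \<Rightarrow>\<^sub>0 nat) \<times> ('n \<Rightarrow>\<^sub>0 nat)) set"
  have pt: "pt A \<in> A" if "A \<in> atoms ?\<X>" for A
    unfolding pt_def using atomsD(2)[OF that] by (rule some_in_eq[THEN iffD2])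
  have atom: "A \<in> ?\<X>" "finite A" "fst (pt A) \<notin> B" "snd (pt A) \<in> B" if "A \<in> atoms ?\<X>" for A
    using atomsD(1)[OF that] pt[OF that] finite_closed(2) closed_familyD(1)[OF atomsD(1)[OF that], of "fst (pt A)" "snd (pt A)"]
    by simp_all
  interpret vectorspace class_ring "tangent_space I" by (rule vectorspace_tangent_space[OF ideal_I])
  have ts: "\<zero>\<^bsub>tangent_space I\<^esub> = (\<lambda>p\<in>I. cls 0)"
    "(F \<oplus>\<^bsub>tangent_space I\<^esub> G) = (\<lambda>p\<in>I. F p \<oplus>\<^bsub>poly_ring Quot I\<^esub> G p)"
    "(c \<odot>\<^bsub>tangent_space I\<^esub> F) = (\<lambda>p\<in>I. cls (const c) \<otimes>\<^bsub>poly_ring Quot I\<^esub> F p)" for F G c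
    by (simp_all add: tangent_space_def restrict_scalars_def hom_module_def ideal_module_def ring_module_def
        quot_module_def zero_Quot flip: cls_def)
  interpret coordinate_system "tangent_space I" "atoms ?\<X>" "\<lambda>A F. coeff_of (F (mon (fst (pt A)))) (snd (pt A))" indicator_hom
  proof unfold_locales
    fix A F G assume A: "A \<in> atoms ?\<X>" and F: "F \<in> carrier (tangent_space I)" "G \<in> carrier (tangent_space I)"
    have m: "mon (fst (pt A)) \<in> I" using atom(3)[OF A] by (simp add: mon_mem_I)
    obtain f g where "F (mon (fst (pt A))) = cls f" "G (mon (fst (pt A))) = cls g"
      using tangent_vector_mon[OF F(1) atom(3)[OF A]] tangent_vector_mon[OF F(2) atom(3)[OF A]] by metis
    then show "coeff_of ((F \<oplus>\<^bsub>tangent_space I\<^esub> G) (mon (fst (pt A)))) (snd (pt A)) =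
        coeff_of (F (mon (fst (pt A)))) (snd (pt A)) + coeff_of (G (mon (fst (pt A)))) (snd (pt A))"
      using m atom(4)[OF A] by (simp add: ts add_Quot coeff_of_cls lookup_add)
  next
    fix A F c assume A: "A \<in> atoms ?\<X>" and F: "F \<in> carrier (tangent_space I)"
    have m: "mon (fst (pt A)) \<in> I" using atom(3)[OF A] by (simp add: mon_mem_I)
    obtain f where "F (mon (fst (pt A))) = cls f"
      using tangent_vector_mon[OF F atom(3)[OF A]] .
    then show "coeff_of ((c \<odot>\<^bsub>tangent_space I\<^esub> F) (mon (fst (pt A)))) (snd (pt A)) =
        c * coeff_of (F (mon (fst (pt A)))) (snd (pt A))"
      using m atom(4)[OF A] by (simp add: ts mult_Quot coeff_of_cls const_def lookup_single_0_mult)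
  next
    fix A assume "A \<in> atoms ?\<X>"
    then show "indicator_hom A \<in> carrier (tangent_space I)"
      using atom indicator_hom_closed by blast
  next
    fix A A' assume A: "A \<in> atoms ?\<X>" "A' \<in> atoms ?\<X>"
    have "pt A \<in> A' \<longleftrightarrow> A = A'" using ring(2)[OF A] pt[OF A(1)] by auto
    then show "coeff_of (indicator_hom A' (mon (fst (pt A)))) (snd (pt A)) = (if A = A' then 1 else 0)"
      using coeff_indicator_hom[OF atom(1,2)[OF A(2)] atom(3,4)[OF A(1)]] by simp
  next
    fix F assume F: "F \<in> carrier (tangent_space I)"
      and 0: "\<And>A. A \<in> atoms ?\<X> \<Longrightarrow> coeff_of (F (mon (fst (pt A)))) (snd (pt A)) = 0"
    have "coeff_of (F (mon m)) b = 0" if mb: "m \<notin> B" "b \<in> B" for m b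
    proof (rule ccontr)
      assume c: "coeff_of (F (mon m)) b \<noteq> 0"
      let ?X = "{(m', b'). m' \<notin> B \<and> b' \<in> B \<and> coeff_of (F (mon m')) b' = coeff_of (F (mon m)) b}"
      have "?X \<noteq> {}" using mb by auto
      from atom_exists[OF finite_closed(1) level_set_closed[OF F c] this]
      obtain A where A: "A \<in> atoms ?\<X>" "A \<subseteq> ?X" by (rule bexE)
      have "pt A \<in> ?X" by (rule subsetD[OF A(2) pt[OF A(1)]])
      then show False using 0[OF A(1)] c by (auto simp: case_prod_unfold)
    qed
    then show "F = \<zero>\<^bsub>tangent_space I\<^esub>" unfolding ts by (rule hom_eq_zero[OF F])
  qed
  have "has_dim class_ring (tangent_space I) (card (atoms ?\<X>))"
    by (rule has_dim_card[OF fin_atoms])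
  then have "has_dim class_ring (tangent_space I) n \<longleftrightarrow> card (atoms ?\<X>) = n"
    by (auto simp: has_dim_def)
  then show ?thesis using ring(1) by simp
qed

end

section \<open>Ideals generated by monomials\<close>

lemma UNIV_3: "(UNIV :: 3 set) = {0, 1, 2}"
proof -
  have "card {0, 1, 2 :: 3} = CARD(3)" by simp
  then show ?thesis by (metis card_subset_eq finite subset_UNIV)
qed

lemma less_3: "(0 :: 3) < 1" "(1 :: 3) < 2"
  by (simp_all add: less_bit1_def bit1.Rep_0 bit1.Rep_1 bit1.Rep_numeral)

lemma exponent_add_iff:
  fixes g m :: "'n \<Rightarrow>\<^sub>0 nat"
  shows "(\<exists>t. m = g + t) \<longleftrightarrow> (\<forall>i. Poly_Mapping.lookup g i \<le> Poly_Mapping.lookup m i)"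
proof
  assume "\<forall>i. Poly_Mapping.lookup g i \<le> Poly_Mapping.lookup m i"
  then have "m = g + (m - g)"
    by (intro poly_mapping_eqI) (simp add: lookup_add lookup_minus)
  then show "\<exists>t. m = g + t" ..
qed (auto simp: lookup_add)

lemma mon_add: "mon (m + m') = (mon m * mon m' :: ('n, 'k::comm_ring_1) mpoly)"
  by (simp add: mon_def mult_single)

lemma mon_dvd_iff: "(mon g :: ('n, 'k::comm_ring_1) mpoly) dvd mon m \<longleftrightarrow> (\<exists>t. m = g + t)"
proof
  assume "(mon g :: ('n, 'k) mpoly) dvd mon m"
  then obtain q :: "('n, 'k) mpoly" where q: "mon m = mon g * q" by (elim dvdE)
  have "m \<in> Poly_Mapping.keys (mon m :: ('n, 'k) mpoly)" by (simp add: mon_def)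
  then show "\<exists>t. m = g + t"
    using keys_mult[of "mon g" q] unfolding q by (auto simp: mon_def split: if_splits)
qed (auto simp: mon_add)

lemma genideal_mon:
  "genideal poly_ring (mon ` M) =
    {f :: ('n, 'k::comm_ring_1) mpoly. Poly_Mapping.keys f \<inter> {m. \<not> (\<exists>g\<in>M. \<exists>t. m = g + t)} = {}}" (is "?L = ?R")
proof
  show "?L \<subseteq> ?R"
  proof (rule ring.genideal_minimal[OF class_ring.ring_axioms])
    show "ideal ?R poly_ring"
    proof (rule keys_disjoint_ideal)
      fix m t assume *: "m + t \<in> {m. \<not> (\<exists>g\<in>M. \<exists>t. m = g + t)}"
      show "m \<in> {m. \<not> (\<exists>g\<in>M. \<exists>t. m = g + t)}"
      proof
        show "\<not> (\<exists>g\<in>M. \<exists>t. m = g + t)"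
        proof
          assume "\<exists>g\<in>M. \<exists>t. m = g + t"
          then obtain g s where "g \<in> M" "m + t = g + (s + t)" by (auto simp: add.assoc)
          with * show False by blast
        qed
      qed
    qed
    show "mon ` M \<subseteq> ?R"
      by (auto simp: mon_def)
  qed
  show "?R \<subseteq> ?L"
  proof
    fix f assume f: "f \<in> ?R"
    have J: "ideal ?L poly_ring" by (rule ring.genideal_ideal[OF class_ring.ring_axioms]) simp
    have gen: "mon g \<in> ?L" if "g \<in> M" for g
      using ring.genideal_self[OF class_ring.ring_axioms, of "mon ` M"] that by auto
    have single: "Poly_Mapping.single k c \<in> ?L" if k: "k \<in> Poly_Mapping.keys f" for k c
    proof -
      have "\<exists>g\<in>M. \<exists>t. k = g + t" using f k by blast
      then obtain g t where g: "g \<in> M" "k = g + t" by blast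
      have "Poly_Mapping.single t c * mon g \<in> ?L"
        using ideal.I_l_closed[OF J gen[OF g(1)], of "Poly_Mapping.single t c"] by simp
      then show ?thesis by (simp add: g mon_def mult_single add.commute)
    qed
    have "(\<Sum>k\<in>S. Poly_Mapping.single k (Poly_Mapping.lookup f k)) \<in> ?L"
      if "finite S" "S \<subseteq> Poly_Mapping.keys f" for S
      using that
    proof (induction S rule: finite_induct)
      case empty
      show ?case using additive_subgroup.zero_closed[OF ideal.axioms(1)[OF J]] by simp
    next
      case (insert k S)
      then show ?case
        using additive_subgroup.a_closed[OF ideal.axioms(1)[OF J], of "Poly_Mapping.single k (Poly_Mapping.lookup f k)"] single
        by simp
    qed
    from this[of "Poly_Mapping.keys f"] show "f \<in> ?L"
      by (simp flip: poly_mapping_sum_single)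
  qed
qed

lemma genideal_mon_mem:
  "(mon m :: ('n, 'k::comm_ring_1) mpoly) \<in> genideal poly_ring (mon ` M) \<longleftrightarrow> (\<exists>g\<in>M. \<exists>t. m = g + t)"
  unfolding genideal_mon by (auto simp: mon_def)

lemma monomial_ideal_quotient:
  fixes I :: "('n, 'k::field) mpoly set"
  assumes "monomial_ideal I"
  shows "monomial_quotient {m. mon m \<notin> I} I"
proof -
  obtain M where I: "I = genideal poly_ring (mon ` M)" using assms by (auto simp: monomial_ideal_def)
  show ?thesis
  proof
    show "I = {f. Poly_Mapping.keys f \<inter> {m. mon m \<notin> I} = {}}"
      unfolding I genideal_mon_mem by (rule genideal_mon)
    show "m \<in> {m. mon m \<notin> I}" if "m + t \<in> {m. mon m \<notin> I}" for m t
      using that unfolding I genideal_mon_mem mem_Collect_eq by (metis add.assoc)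
  qed
qed

section \<open>Exponent vectors in three variables as triples\<close>

definition exponents :: "(3 \<Rightarrow>\<^sub>0 nat) \<Rightarrow> point" where
  "exponents m = (Poly_Mapping.lookup m 0, Poly_Mapping.lookup m 1, Poly_Mapping.lookup m 2)"

fun of_exponents :: "point \<Rightarrow> (3 \<Rightarrow>\<^sub>0 nat)" where
  "of_exponents (i, j, k) = Poly_Mapping.single 0 i + Poly_Mapping.single 1 j + Poly_Mapping.single 2 k"

lemma exponents_of_exponents [simp]: "exponents (of_exponents p) = p"
  by (cases p) (simp add: exponents_def lookup_add lookup_single when_def)

lemma of_exponents_exponents [simp]: "of_exponents (exponents m) = m"
proof (rule poly_mapping_eqI)
  fix i :: 3
  have "i \<in> {0, 1, 2}" using UNIV_3 by auto
  then show "Poly_Mapping.lookup (of_exponents (exponents m)) i = Poly_Mapping.lookup m i"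
    by (auto simp: exponents_def lookup_add lookup_single when_def)
qed

lemma bij_exponents: "bij exponents"
  by (rule o_bij[of of_exponents]) (auto simp: fun_eq_iff)

lemma inv_exponents: "inv_into UNIV exponents = of_exponents"
  by (rule inv_unique_comp) (auto simp: fun_eq_iff)

lemma of_exponents_up:
  "of_exponents (up1 p) = of_exponents p + unit 0"
  "of_exponents (up2 p) = of_exponents p + unit 1"
  "of_exponents (up3 p) = of_exponents p + unit 2"
proof -
  obtain i j k where p: "p = (i, j, k)" by (cases p)
  have Suc: "Poly_Mapping.single l (Suc n) = Poly_Mapping.single l n + unit l" for l :: 3 and n :: nat
    by (simp flip: single_add)
  show "of_exponents (up1 p) = of_exponents p + unit 0" "of_exponents (up2 p) = of_exponents p + unit 1"
    "of_exponents (up3 p) = of_exponents p + unit 2"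
    by (simp_all only: p up1.simps up2.simps up3.simps of_exponents.simps Suc[of _ i] Suc[of _ j] Suc[of _ k] add_ac)
qed

lemma exponents_unit:
  "exponents (m + unit 0) = up1 (exponents m)" "exponents (m + unit 1) = up2 (exponents m)"
  "exponents (m + unit 2) = up3 (exponents m)"
  using of_exponents_up[of "exponents m"] by (metis exponents_of_exponents of_exponents_exponents)+

lemma exponents_le_iff:
  "(\<exists>t. m = of_exponents (i, j, k) + t) \<longleftrightarrow>
    (case exponents m of (i', j', k') \<Rightarrow> i \<le> i' \<and> j \<le> j' \<and> k \<le> k')"
proof -
  have "(\<forall>l::3. P l) \<longleftrightarrow> P 0 \<and> P 1 \<and> P 2" for P
    using UNIV_3 by (metis UNIV_I empty_iff insert_iff)
  then show ?thesis
    unfolding exponent_add_iff by (simp add: exponents_def lookup_add lookup_single when_def)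
qed

lemma closed_sets_exponents:
  fixes C :: "(3 \<Rightarrow>\<^sub>0 nat) set"
  shows "closed_sets (exponents ` C) = (`) (map_prod exponents exponents) ` closed_family shifts C"
proof -
  have "exponents \<circ> (\<lambda>m. m + unit i) \<circ> of_exponents =
      (if i = 0 then up1 else if i = 1 then up2 else up3)" for i :: 3
  proof -
    have "i \<in> {0, 1, 2}" using UNIV_3 by auto
    then have "exponents (of_exponents p + unit i) = (if i = 0 then up1 else if i = 1 then up2 else up3) p" for p
      using exponents_unit[of "of_exponents p"] by (auto simp del: single_one One_nat_def of_exponents.simps)
    then show ?thesis by (simp add: fun_eq_iff del: single_one One_nat_def of_exponents.simps split_paired_All)
  qed
  then have "(\<lambda>u. exponents \<circ> u \<circ> inv_into UNIV exponents) ` shifts = {up1, up2, up3}"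
    unfolding shifts_def inv_exponents image_image UNIV_3 by (auto simp del: One_nat_def)
  with closed_family_image[OF bij_exponents, of shifts C] show ?thesis by simp
qed

lemma min_mon_gen_exists:
  fixes I :: "(3, 'k::comm_ring_1) mpoly set"
  assumes "mon m \<in> I"
  shows "\<exists>g\<in>min_mon_gens I. \<exists>t. m = g + t"
proof -
  define size where "size g = (case exponents g of (i, j, k) \<Rightarrow> i + j + k)" for g
  have size_add: "size (g + t) = size g + size t" for g t
    by (simp add: size_def exponents_def lookup_add)
  have size_0: "t = 0" if "size t = 0" for t
  proof -
    have "exponents t = (0, 0, 0)" using that by (simp add: size_def exponents_def)
    then have "t = of_exponents (0, 0, 0)" by (metis of_exponents_exponents)
    then show ?thesis by simp
  qed
  define P where "P g \<longleftrightarrow> (mon g :: (3, 'k) mpoly) \<in> I \<and> (\<exists>t. m = g + t)" for g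
  have "P m" using assms by (auto simp: P_def intro: exI[of _ 0])
  then obtain g where g: "P g" "\<And>g'. P g' \<Longrightarrow> size g \<le> size g'"
    using ex_has_least_nat[of P m size] by blast
  have "g' = g" if g': "(mon g' :: (3, 'k) mpoly) \<in> I" "(mon g' :: (3, 'k) mpoly) dvd mon g" for g'
  proof -
    obtain s where s: "g = g' + s" using g'(2) by (auto simp: mon_dvd_iff)
    then have "P g'" using g(1) g'(1) by (auto simp: P_def add.assoc)
    then have "size s = 0" using g(2)[of g'] by (simp add: s size_add)
    then show ?thesis using size_0 s by simp
  qed
  with g(1) show ?thesis unfolding P_def min_mon_gens_def by blast
qed

text \<open>The definition speaks of minimal generators only. Let \<open>g\<close> be one that
  divides the given monomial. If the variable \<open>j\<close> divides \<open>g\<close>, it is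
  exchanged in \<open>g\<close>; otherwise it divides the cofactor, and \<open>g\<close> already
  divides \<open>m\<close>.\<close>

lemma strongly_stable_step:
  fixes I :: "(3, 'k::field) mpoly set"
  assumes stable: "strongly_stable I" and "i < j" and "mon (m + unit j) \<in> I"
  shows "mon (m + unit i) \<in> I"
proof -
  interpret monomial_quotient "{m. mon m \<notin> I}" I
    using stable by (intro monomial_ideal_quotient) (simp add: strongly_stable_def)
  have mult: "mon (g + t) \<in> I" if "mon g \<in> I" for g t
    using that mult_mem_I[of "mon g" "mon t"] by (simp add: mon_add mult.commute)
  obtain g t where g: "g \<in> min_mon_gens I" and t: "m + unit j = g + t"
    using min_mon_gen_exists[OF assms(3)] by blast
  have gI: "mon g \<in> I" using g by (simp add: min_mon_gens_def)
  show ?thesis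
  proof (cases "\<exists>g'. g = unit j + g'")
    case True
    then obtain g' where g': "g = unit j + g'" by blast
    then have "(var j :: (3, 'k) mpoly) dvd mon g" by (simp add: var_def mon_add del: One_nat_def)
    with stable g \<open>i < j\<close> have "mon (g - unit j + unit i) \<in> I"
      unfolding strongly_stable_def by blast
    moreover have "g - unit j = g'" by (simp add: g')
    moreover have "m = g' + t"
      using t unfolding g' by (metis add.commute add.left_commute add_left_cancel)
    ultimately show ?thesis using mult[of "g' + unit i" t] by (simp add: add_ac)
  next
    case False
    then have g0: "Poly_Mapping.lookup g j = 0"
      unfolding exponent_add_iff by (auto simp: lookup_single when_def split: if_splits)
    have "Poly_Mapping.lookup (m + unit j) j = Poly_Mapping.lookup (g + t) j" using t by simp
    then have "\<exists>t'. t = unit j + t'"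
      unfolding exponent_add_iff using g0 by (auto simp: lookup_add lookup_single when_def)
    then obtain t' where "t = unit j + t'" by blast
    with t have "m = g + t'" by (metis add.commute add.left_commute add_left_cancel)
    then show ?thesis using mult[OF gI, of "t' + unit i"] by (simp add: add.assoc)
  qed
qed

lemma strongly_stable_exponents:
  fixes I :: "(3, 'k::field) mpoly set"
  assumes stable: "strongly_stable I" and fin: "finite {m. mon m \<notin> I}"
  shows "strongly_stable_complement (exponents ` {m. mon m \<notin> I})"
proof -
  let ?B = "exponents ` {m. mon m \<notin> I}"
  interpret monomial_quotient "{m. mon m \<notin> I}" I
    using stable by (intro monomial_ideal_quotient) (simp add: strongly_stable_def)
  have mem: "p \<in> ?B \<longleftrightarrow> mon (of_exponents p) \<notin> I" for p
  proof -
    have "p = exponents (of_exponents p)" by simp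
    then show ?thesis by (metis (mono_tags, lifting) image_iff mem_Collect_eq of_exponents_exponents)
  qed
  show ?thesis
  proof
    show "finite ?B" using fin by simp
    fix i j k i' j' k' :: nat assume B: "(i, j, k) \<in> ?B" and le: "i' \<le> i" "j' \<le> j" "k' \<le> k"
    then have "\<exists>t. of_exponents (i, j, k) = of_exponents (i', j', k') + t"
      unfolding exponents_le_iff by (simp del: of_exponents.simps)
    then obtain t where "of_exponents (i, j, k) = of_exponents (i', j', k') + t" ..
    with B down[of "of_exponents (i', j', k')" t] show "(i', j', k') \<in> ?B" by (simp add: mem)
  next
    fix i j k :: nat
    show "(i, Suc j, k) \<notin> ?B \<Longrightarrow> (Suc i, j, k) \<notin> ?B"
      using strongly_stable_step[OF stable less_3(1), of "of_exponents (i, j, k)"]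
        of_exponents_up(1,2)[of "(i, j, k)"] by (simp add: mem)
    show "(i, j, Suc k) \<notin> ?B \<Longrightarrow> (i, Suc j, k) \<notin> ?B"
      using strongly_stable_step[OF stable less_3(2), of "of_exponents (i, j, k)"]
        of_exponents_up(2,3)[of "(i, j, k)"] by (simp add: mem)
  qed
qed

section \<open>The ideals \<open>J a b c\<close> and their standard monomials\<close>

lemma var_power: "(var i :: ('n, 'k::comm_ring_1) mpoly) ^ n = mon (Poly_Mapping.single i n)"
proof (induction n)
  case (Suc n)
  have "Poly_Mapping.single i (Suc n) = unit i + Poly_Mapping.single i n"
    by (simp flip: single_add)
  with Suc show ?case by (simp add: var_def mon_add)
qed (simp add: mon_def)

lemma J_genideal:
  "J a b c = genideal poly_ring (mon ` of_exponents `
     {(2, 0, 0), (1, 1, 0), (0, 2, 0), (1, 0, a), (0, 1, b), (0, 0, Suc c)})"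
  unfolding J_def Let_def var_power Suc_eq_plus1
  by (simp add: var_def mon_add flip: One_nat_def)

text \<open>The inequalities ensure that \<open>z^(c + 1)\<close> does not cut off the columns over
  \<open>x\<close> and \<open>y\<close>.\<close>

lemma mon_notin_J_iff:
  assumes "a \<le> b" "b \<le> c"
  shows "(mon m :: (3, 'k::field) mpoly) \<notin> J a b c \<longleftrightarrow> exponents m \<in> J_complement a b c"
proof -
  obtain i j k where m: "exponents m = (i, j, k)" by (cases "exponents m")
  have "(mon m :: (3, 'k) mpoly) \<in> J a b c \<longleftrightarrow>
      2 \<le> i \<or> (1 \<le> i \<and> 1 \<le> j) \<or> 2 \<le> j \<or> (1 \<le> i \<and> a \<le> k) \<or> (1 \<le> j \<and> b \<le> k) \<or> Suc c \<le> k"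
    unfolding J_genideal genideal_mon_mem
    by (simp add: exponents_le_iff m del: of_exponents.simps)
  then have iff: "(mon m :: (3, 'k) mpoly) \<notin> J a b c \<longleftrightarrow>
      \<not> (2 \<le> i \<or> (1 \<le> i \<and> 1 \<le> j) \<or> 2 \<le> j \<or> (1 \<le> i \<and> a \<le> k) \<or> (1 \<le> j \<and> b \<le> k) \<or> Suc c \<le> k)"
    by simp
  consider "2 \<le> i \<or> 2 \<le> j \<or> 1 \<le> i \<and> 1 \<le> j" | "i = 0" "j = 0" | "i = 0" "j = 1" | "i = 1" "j = 0"
    by linarith
  then show ?thesis
    unfolding iff m J_complement_iff using assms by cases auto
qed

lemma eq_J_iff:
  fixes I :: "(3, 'k::field) mpoly set"
  assumes I: "monomial_ideal I" and "a \<le> b" "b \<le> c"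
  shows "I = J a b c \<longleftrightarrow> exponents ` {m. mon m \<notin> I} = J_complement a b c"
proof -
  have J: "monomial_ideal (J a b c :: (3, 'k) mpoly set)"
    unfolding monomial_ideal_def J_genideal by blast
  have "I = J a b c \<longleftrightarrow> {m. mon m \<notin> I} = {m. (mon m :: (3, 'k) mpoly) \<notin> J a b c}"
  proof
    assume eq: "{m. mon m \<notin> I} = {m. (mon m :: (3, 'k) mpoly) \<notin> J a b c}"
    have "I = {f. Poly_Mapping.keys f \<inter> {m. mon m \<notin> I} = {}}"
      by (rule monomial_quotient.I_eq[OF monomial_ideal_quotient[OF I]])
    also have "\<dots> = {f. Poly_Mapping.keys f \<inter> {m. (mon m :: (3, 'k) mpoly) \<notin> J a b c} = {}}"
      by (simp only: eq)
    also have "\<dots> = J a b c"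
      by (rule monomial_quotient.I_eq[OF monomial_ideal_quotient[OF J], symmetric])
    finally show "I = J a b c" .
  qed simp
  also have "\<dots> \<longleftrightarrow> exponents ` {m. mon m \<notin> I} = exponents ` {m. (mon m :: (3, 'k) mpoly) \<notin> J a b c}"
    by (rule inj_image_eq_iff[OF bij_is_inj[OF bij_exponents], symmetric])
  also have "{m. (mon m :: (3, 'k) mpoly) \<notin> J a b c} = exponents -` J_complement a b c"
    by (simp only: mon_notin_J_iff[OF assms(2,3)] vimage_def)
  also have "exponents ` (exponents -` J_complement a b c) = J_complement a b c"
    by (rule surj_image_vimage_eq[OF bij_is_surj[OF bij_exponents]])
  finally show ?thesis .
qed

theorem theorem5p13:
  fixes I :: "(3, 'k::field) mpoly set" and d :: nat
  assumes "strongly_stable I"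
    and "has_dim class_ring (coord_space I) d"
  shows "has_dim class_ring (tangent_space I) (3 * d + 6) \<longleftrightarrow>
    (\<exists>a b c :: nat. 1 \<le> a \<and> a \<le> b \<and> b \<le> c \<and> (a = 1 \<or> b = c) \<and> I = J a b c)"
proof -
  let ?C = "{m. mon m \<notin> I}" and ?B = "exponents ` {m. mon m \<notin> I}"
  have monomial: "monomial_ideal I" using assms(1) by (simp add: strongly_stable_def)
  interpret Q: monomial_quotient ?C I by (rule monomial_ideal_quotient[OF monomial])
  note C = Q.coord_space_dim[OF assms(2)]
  interpret P: strongly_stable_complement ?B by (rule strongly_stable_exponents[OF assms(1) C(1)])
  have card_B: "card ?B = d"
    using C(2) card_image[OF inj_on_subset[OF bij_is_inj[OF bij_exponents] subset_UNIV]] by simp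
  have inj: "inj (map_prod exponents exponents)"
    using bij_exponents by (intro prod.inj_map) (auto simp: bij_def)
  then have inj': "inj ((`) (map_prod exponents exponents))"
    by (intro injI) (simp add: inj_image_eq_iff)
  note eq = closed_sets_exponents[of ?C]
  have fin: "finite (closed_family shifts ?C)"
    using P.finite_closed_sets inj' unfolding eq by (simp add: finite_image_iff inj_on_subset)
  have fin': "finite X" if "X \<in> closed_family shifts ?C" for X
  proof -
    have "finite (map_prod exponents exponents ` X)"
      using P.finite_closed_set that unfolding eq by blast
    then show ?thesis using inj by (simp add: finite_image_iff inj_on_subset)
  qed
  have card: "card (closed_sets ?B) = card (closed_family shifts ?C)"
    unfolding eq using inj' by (simp add: card_image inj_on_subset)
  let ?n = "card (signed_sets ?B (True, True, False)) * card (signed_sets ?B (True, False, True)) *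
    card (signed_sets ?B (False, True, True))"
  have "has_dim class_ring (tangent_space I) (3 * d + 6) \<longleftrightarrow> card (closed_family shifts ?C) = 2 ^ (3 * d + 6)"
    by (rule Q.tangent_space_dim[OF fin fin'])
  also have "\<dots> \<longleftrightarrow> 2 ^ (3 * d) * ?n\<^sup>2 = 2 ^ (3 * d + 6)"
    by (simp only: card[symmetric] P.card_closed_sets card_B)
  also have "\<dots> \<longleftrightarrow> ?n\<^sup>2 = 8\<^sup>2" by (simp add: power_add)
  also have "\<dots> \<longleftrightarrow> ?n = 8" by (rule power2_eq_iff_nonneg) auto
  also have "\<dots> \<longleftrightarrow> (\<exists>a b c. 1 \<le> a \<and> a \<le> b \<and> b \<le> c \<and> (a = 1 \<or> b = c) \<and> ?B = J_complement a b c)"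
    by (rule P.card_mixed_eq_8_iff)
  also have "\<dots> \<longleftrightarrow> (\<exists>a b c. 1 \<le> a \<and> a \<le> b \<and> b \<le> c \<and> (a = 1 \<or> b = c) \<and> I = J a b c)"
    using eq_J_iff[OF monomial] by metis
  finally show ?thesis .
qed

end
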